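(* Let $K\subset\mathbb{R}^n$ and $L\subset\mathbb{R}^m$ be non-trivial closed convex cones, $G\in\mathbb{R}^{m\times n}$ a standard Gaussian matrix, and $G^{-1}L\equiv\{\mu\in\mathbb{R}^n:G\mu\in L\}$. There exists a universal constant $C>0$ such that for every $t\ge1$: (1) if $\sqrt{\delta(K)}-\sqrt{m-\delta(L)}\le -C\sqrt t$, then $\mathbb{P}\big(K\cap G^{-1}L=\{0\}\big)\ge1-e^{-t}$; (2) if $\sqrt{\delta(K)}-\sqrt{m-\delta(L)}\ge C\sqrt t$, then $\mathbb{P}\big(K\cap G^{-1}L\neq\{0\}\big)\ge1-e^{-t}$.
   Context: A standard Gaussian matrix has i.i.d. $\mathcal{N}(0,1)$ entries. A closed convex cone is non-trivial if it is not $\{0\}$. For a closed convex cone $K\subset\mathbb{R}^n$, $\delta(K)\equiv\mathbb{E}\|\Pi_K(g)\|^2$ with $g\sim\mathcal{N}(0,I_n)$, where $\Pi_K$ is the Euclidean metric projection onto $K$. *)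

theory Defs
  imports "HOL-Probability.Probability"
begin

text \<open>Vectors of R^n are represented as extensional functions on {..<n}
  (elements of PiE {..<n} (\<lambda>_. UNIV)); m x n matrices as extensional
  functions on {..<m} \<times> {..<n}.\<close>

definition rvec :: "nat \<Rightarrow> (nat \<Rightarrow> real) set" where
  "rvec n = PiE {..<n} (\<lambda>_. UNIV)"

definition zvec :: "nat \<Rightarrow> (nat \<Rightarrow> real)" where
  "zvec n = restrict (\<lambda>_. 0) {..<n}"

definition sqnorm :: "nat \<Rightarrow> (nat \<Rightarrow> real) \<Rightarrow> real" where
  "sqnorm n x = (\<Sum>i<n. (x i)\<^sup>2)"

text \<open>Closed convex cone in R^n (closedness w.r.t. the product topology,
  which on rvec n is the Euclidean topology).\<close>
definition closed_convex_cone :: "nat \<Rightarrow> (nat \<Rightarrow> real) set \<Rightarrow> bool" where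
  "closed_convex_cone n K \<longleftrightarrow>
     K \<subseteq> rvec n \<and> zvec n \<in> K \<and> closed K \<and>
     (\<forall>x\<in>K. \<forall>c::real. c \<ge> 0 \<longrightarrow> restrict (\<lambda>i. c * x i) {..<n} \<in> K) \<and>
     (\<forall>x\<in>K. \<forall>y\<in>K. \<forall>u::real. 0 \<le> u \<and> u \<le> 1 \<longrightarrow>
        restrict (\<lambda>i. u * x i + (1 - u) * y i) {..<n} \<in> K)"

definition proj :: "nat \<Rightarrow> (nat \<Rightarrow> real) set \<Rightarrow> (nat \<Rightarrow> real) \<Rightarrow> (nat \<Rightarrow> real)" where
  "proj n K x = (THE p. p \<in> K \<and>
     (\<forall>q\<in>K. sqnorm n (\<lambda>i. x i - p i) \<le> sqnorm n (\<lambda>i. x i - q i)))"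

definition gauss_vec :: "nat \<Rightarrow> (nat \<Rightarrow> real) measure" where
  "gauss_vec n = PiM {..<n} (\<lambda>_. density lborel std_normal_density)"

definition gauss_mat :: "nat \<Rightarrow> nat \<Rightarrow> (nat \<times> nat \<Rightarrow> real) measure" where
  "gauss_mat m n = PiM ({..<m} \<times> {..<n}) (\<lambda>_. density lborel std_normal_density)"

definition matvec :: "nat \<Rightarrow> nat \<Rightarrow> (nat \<times> nat \<Rightarrow> real) \<Rightarrow> (nat \<Rightarrow> real) \<Rightarrow> (nat \<Rightarrow> real)" where
  "matvec m n G x = restrict (\<lambda>i. \<Sum>j<n. G (i, j) * x j) {..<m}"

definition sdim :: "nat \<Rightarrow> (nat \<Rightarrow> real) set \<Rightarrow> real" where
  "sdim n K = (\<integral>g. sqnorm n (proj n K g) \<partial>gauss_vec n)"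

definition preimg :: "nat \<Rightarrow> nat \<Rightarrow> (nat \<times> nat \<Rightarrow> real) \<Rightarrow> (nat \<Rightarrow> real) set \<Rightarrow> (nat \<Rightarrow> real) set" where
  "preimg m n G L = {\<mu> \<in> rvec n. matvec m n G \<mu> \<in> L}"

end

theory Submission
  imports Defs "HOL-Real_Asymp.Real_Asymp"
begin

text \<open>
  Let \<open>L\<degree>\<close> be the polar cone, so that \<open>m - \<delta>(L) = E |\<Pi>\<^bsub>L\<degree>\<^esub> h|\<^sup>2\<close>. If \<open>G \<mu> \<in> L\<close> for a unit vector \<open>\<mu> \<in> K\<close>,
  then \<open>\<langle>v, G \<mu>\<rangle> \<le> 0\<close> for all unit \<open>v \<in> L\<degree>\<close>. If \<open>G\<inverse> L\<close> meets \<open>K\<close> trivially, then \<open>G K - L\<close> is a closed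
  cone, and separation gives a unit \<open>v \<in> L\<degree>\<close> with \<open>\<langle>v, G \<mu>\<rangle> \<ge> 0\<close> for all \<open>\<mu> \<in> K\<close>. So both parts bound the
  probability that \<open>min\<^sub>x max\<^sub>y\<close> of a bilinear Gaussian form over unit vectors is nonpositive.

  Interpolating between the form and the decoupled process \<open>\<langle>h, y\<rangle> - \<langle>g, x\<rangle>\<close> along a rotation path, Gaussian
  integration by parts gives \<open>E exp (- \<lambda> min max) \<le> exp (- \<lambda>\<^sup>2 / 2) E exp (\<lambda> max\<^sub>x \<langle>g, x\<rangle>) E exp (- \<lambda> max\<^sub>y \<langle>h, y\<rangle>)\<close>.
  The same interpolation, applied to two independent copies of one process against a single shared copy, gives
  the sub-Gaussian concentration \<open>E exp (\<lambda> M) E exp (- \<lambda> M) \<le> exp (\<lambda>\<^sup>2)\<close> of a maximum \<open>M\<close>, hence also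
  \<open>E M = \<surd>\<delta> + O(1)\<close>. Taking \<open>\<lambda> = \<surd>t\<close> finishes the proof.
\<close>

section \<open>Gaussian integration by parts\<close>

text \<open>Gordon's comparison usually adds an independent normal variable to the bilinear form so
  that the variances agree. Here the mismatch stays: for unit vectors with inner products P and Q
  the two covariances differ by \<open>(1 - P) * (1 - Q) - 1\<close>. The constant -1 acts exactly,
  because raising every entry of the array by s multiplies the smooth functional by
  \<open>exp (- \<lambda> * s)\<close>. It produces the factor
  \<open>exp (- \<lambda>\<^sup>2 / 2)\<close>.

  Only exponential moments are used. Replacing a maximum by a sum costs a power of a cardinality
  whose exponent tends to 0.

  Separation needs a point outside G K - L. For a subspace K this cone can be the whole space
  although the intersection is trivial, so K is then cut by a half-space. This cut, like the case
  where the projection vanishes and all forms are negative, costs at most 2 |<a, x>| for one unit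
  vector a, which has bounded second moment. Passing from the mean of a maximum to the root of a
  statistical dimension costs 6 on each side, and the constant is 15 = 6 + 6 + 3, the 3 paying for
  the terms quadratic in \<open>\<lambda>\<close>.\<close>

abbreviation gauss :: "'b set \<Rightarrow> ('b \<Rightarrow> real) measure" where
  "gauss B \<equiv> PiM B (\<lambda>_. std_normal_distribution)"

lemma prob_space_std_normal: "prob_space std_normal_distribution"
  using real_dist_normal_dist by (simp add: real_distribution_def)

interpretation gauss: product_prob_space "\<lambda>_. std_normal_distribution" B for B :: "'b set"
  by (intro product_prob_spaceI prob_space_std_normal)

lemma product_sigma_finite_std_normal: "product_sigma_finite (\<lambda>_. std_normal_distribution)"
  by (intro product_sigma_finite.intro prob_space_imp_sigma_finite prob_space_std_normal)

section \<open>One Gaussian variable: exponential moments and integration by parts\<close>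

lemma integrable_exp_linear_std_normal: "integrable std_normal_distribution (\<lambda>x. exp (c * x))"
proof -
  \<comment> \<open>Completing the square turns the exponential factor into a shift of the
    mean.\<close>
  have "std_normal_density x * exp (c * x) = exp (c\<^sup>2 / 2) * normal_density c 1 x" for x
    by (simp add: normal_density_def mult.commute exp_add[symmetric] power2_eq_square field_simps)
  moreover have "integrable lborel (\<lambda>x. exp (c\<^sup>2 / 2) * normal_density c 1 x)"
    by (intro integrable_mult_right integrable_normal_density) simp
  ultimately show ?thesis
    by (subst integrable_real_density) auto
qed

lemma integrable_exp_abs_std_normal: "integrable std_normal_distribution (\<lambda>x. exp (c * \<bar>x\<bar>))"
proof (rule Bochner_Integration.integrable_bound)
  show "integrable std_normal_distribution (\<lambda>x. exp (c * x) + exp (- c * x))"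
    by (intro Bochner_Integration.integrable_add integrable_exp_linear_std_normal)
  show "AE x in std_normal_distribution. norm (exp (c * \<bar>x\<bar>)) \<le> norm (exp (c * x) + exp (- c * x))"
  proof (rule AE_I2)
    fix x show "norm (exp (c * \<bar>x\<bar>)) \<le> norm (exp (c * x) + exp (- c * x))"
      by (cases "x \<ge> 0") (auto simp: abs_of_pos add_pos_pos)
  qed
qed simp

lemma abs_le_exp_abs: "\<bar>x\<bar> \<le> exp \<bar>x::real\<bar>"
  using exp_ge_add_one_self[of "\<bar>x\<bar>"] by linarith

text \<open>These are the boundary terms of the integration by parts in
  \<open>std_normal_stein\<close>. The Gaussian factor beats every
  \<open>exp (c * \<bar>x\<bar>)\<close>.\<close>

lemma exp_growth_times_density_tendsto:
  assumes "\<And>x. \<bar>f x\<bar> \<le> C * exp (c * \<bar>x\<bar>)"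
  shows "((\<lambda>x. f x * std_normal_density x) \<longlongrightarrow> 0) at_top"
    "((\<lambda>x. f x * std_normal_density x) \<longlongrightarrow> 0) at_bot"
proof -
  have bd: "norm (f x * std_normal_density x) \<le> C * exp (c * \<bar>x\<bar>) * std_normal_density x" for x
    using mult_right_mono[OF assms[of x], of "std_normal_density x"] by (simp add: abs_mult)
  have lim: "((\<lambda>x. C * (1 / sqrt (2 * pi)) * exp (d * x - x\<^sup>2 / 2)) \<longlongrightarrow> 0) F"
    if "F = at_top \<or> F = at_bot" for d :: real and F
  proof -
    have "((\<lambda>x. exp (d * x - x\<^sup>2 / 2)) \<longlongrightarrow> 0) F" using that by (elim disjE; hypsubst) real_asymp+
    then show ?thesis by (rule tendsto_mult_right_zero)
  qed
  have top: "((\<lambda>x. C * exp (c * \<bar>x\<bar>) * std_normal_density x) \<longlongrightarrow> 0) at_top"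
    by (rule Lim_transform_eventually[OF lim[of at_top c]])
      (auto simp: std_normal_density_def exp_add[symmetric] eventually_at_top_linorder intro!: exI[of _ 0])
  have bot: "((\<lambda>x. C * exp (c * \<bar>x\<bar>) * std_normal_density x) \<longlongrightarrow> 0) at_bot"
    by (rule Lim_transform_eventually[OF lim[of at_bot "-c"]])
      (auto simp: std_normal_density_def exp_add[symmetric] eventually_at_bot_linorder intro!: exI[of _ 0])
  show "((\<lambda>x. f x * std_normal_density x) \<longlongrightarrow> 0) at_top"
    by (rule Lim_null_comparison[OF _ top]) (use bd in auto)
  show "((\<lambda>x. f x * std_normal_density x) \<longlongrightarrow> 0) at_bot"
    by (rule Lim_null_comparison[OF _ bot]) (use bd in auto)
qed

text \<open>The standard normal density has derivative - x times itself, so the difference of the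
  two integrands, taken against the density, is the derivative of \<open>f\<close> times the
  density. Its integral over the line is a difference of two vanishing boundary values.\<close>

lemma std_normal_stein:
  fixes f f' :: "real \<Rightarrow> real"
  assumes deriv: "\<And>x. (f has_real_derivative f' x) (at x)" and cont: "\<And>x. isCont f' x"
    and f: "\<And>x. \<bar>f x\<bar> \<le> C * exp (c * \<bar>x\<bar>)" and f': "\<And>x. \<bar>f' x\<bar> \<le> C * exp (c * \<bar>x\<bar>)"
  shows "(\<integral>x. x * f x \<partial>std_normal_distribution) = (\<integral>x. f' x \<partial>std_normal_distribution)"
proof -
  let ?N = std_normal_distribution and ?\<phi> = std_normal_density
  have C: "C \<ge> 0" using order_trans[OF abs_ge_zero f[of 0]] by simp
  have cf: "isCont f x" for x using deriv by (rule DERIV_isCont)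
  have mf[measurable]: "f \<in> borel_measurable borel" "f' \<in> borel_measurable borel"
    by (intro borel_measurable_continuous_onI continuous_at_imp_continuous_on ballI cf cont)+
  have if': "integrable ?N f'"
    by (rule Bochner_Integration.integrable_bound[OF integrable_mult_right[OF integrable_exp_abs_std_normal[of c], of C]])
      (use f' C in \<open>auto simp: abs_mult\<close>)
  have ixf: "integrable ?N (\<lambda>x. x * f x)"
  proof (rule Bochner_Integration.integrable_bound[OF integrable_mult_right[OF integrable_exp_abs_std_normal[of "1 + c"], of C]])
    show "AE x in ?N. norm (x * f x) \<le> norm (C * exp ((1 + c) * \<bar>x\<bar>))"
    proof (rule AE_I2)
      fix x
      have "\<bar>x\<bar> * \<bar>f x\<bar> \<le> exp \<bar>x\<bar> * (C * exp (c * \<bar>x\<bar>))"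
        by (intro mult_mono abs_le_exp_abs f) auto
      then show "norm (x * f x) \<le> norm (C * exp ((1 + c) * \<bar>x\<bar>))"
        using C by (simp add: abs_mult exp_add[symmetric] algebra_simps)
    qed
  qed simp
  have int: "integrable lborel (\<lambda>x. f' x * ?\<phi> x - x * f x * ?\<phi> x)"
    using if' ixf by (simp add: integrable_real_density mult_ac)
  have dphi: "(?\<phi> has_real_derivative (- x * ?\<phi> x)) (at x)" for x
    unfolding std_normal_density_def
    by (auto intro!: derivative_eq_intros simp: field_simps power2_eq_square)
  have "(LBINT x=-\<infinity>..\<infinity>. f' x * ?\<phi> x - x * f x * ?\<phi> x) = 0 - 0"
  proof (rule interval_integral_FTC_integrable[where F="\<lambda>x. f x * ?\<phi> x"])
    show "((\<lambda>x. f x * ?\<phi> x) has_vector_derivative f' x * ?\<phi> x - x * f x * ?\<phi> x) (at x)" for x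
      unfolding has_real_derivative_iff_has_vector_derivative[symmetric]
      by (auto intro!: derivative_eq_intros deriv dphi simp: field_simps)
    show "isCont (\<lambda>x. f' x * ?\<phi> x - x * f x * ?\<phi> x) x" for x
      by (intro continuous_intros cont cf DERIV_isCont[OF dphi])
    show "set_integrable lborel (einterval (- \<infinity>) \<infinity>) (\<lambda>x. f' x * ?\<phi> x - x * f x * ?\<phi> x)"
      using int by (simp add: set_integrable_def)
    show "(((\<lambda>x. f x * ?\<phi> x) \<circ> real_of_ereal) \<longlongrightarrow> 0) (at_right (- \<infinity>))"
      using exp_growth_times_density_tendsto[of f C c, OF f]
      unfolding ereal_tendsto_simps by simp
    show "(((\<lambda>x. f x * ?\<phi> x) \<circ> real_of_ereal) \<longlongrightarrow> 0) (at_left \<infinity>)"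
      using exp_growth_times_density_tendsto[of f C c, OF f]
      unfolding ereal_tendsto_simps by simp
  qed auto
  then have "(\<integral>x. f' x * ?\<phi> x - x * f x * ?\<phi> x \<partial>lborel) = 0"
    by (simp add: interval_lebesgue_integral_def set_lebesgue_integral_def)
  moreover have "integrable lborel (\<lambda>x. f' x * ?\<phi> x)" "integrable lborel (\<lambda>x. x * f x * ?\<phi> x)"
    using if' ixf by (simp_all add: integrable_real_density mult_ac)
  ultimately show ?thesis
    by (simp add: integral_real_density mult_ac)
qed

section \<open>Finitely many independent Gaussian variables\<close>

lemma integrable_exp_sum_abs:
  assumes "finite B"
  shows "integrable (gauss B) (\<lambda>\<xi>. exp (c * (\<Sum>b\<in>B. \<bar>\<xi> b\<bar>)))"
proof -
  have "(\<lambda>\<xi>. exp (c * (\<Sum>b\<in>B. \<bar>\<xi> b\<bar>))) = (\<lambda>\<xi>. \<Prod>b\<in>B. exp (c * \<bar>\<xi> b\<bar>))"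
    by (simp add: sum_distrib_left exp_sum assms)
  then show ?thesis
    using product_sigma_finite.product_integrable_prod[OF product_sigma_finite_std_normal assms integrable_exp_abs_std_normal]
    by simp
qed

text \<open>The growth class has the l1 norm in the exponent. The dominating function is then a
  product over coordinates, and the class survives linear substitutions and multiplication by a
  coordinate.\<close>

lemma integrable_exp_growth:
  assumes "finite B" "f \<in> borel_measurable (gauss B)"
    and f: "\<And>\<xi>. \<bar>f \<xi>\<bar> \<le> C * exp (c * (\<Sum>b\<in>B. \<bar>\<xi> b\<bar>))"
  shows "integrable (gauss B) f"
proof (rule Bochner_Integration.integrable_bound[OF integrable_mult_right[OF integrable_exp_sum_abs[OF assms(1), of c], of C]])
  show "AE \<xi> in gauss B. norm (f \<xi>) \<le> norm (C * exp (c * (\<Sum>b\<in>B. \<bar>\<xi> b\<bar>)))"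
    using order_trans[OF f abs_ge_self] by (intro AE_I2) simp
qed fact

lemma exp_growth_times_coord:
  assumes "finite B" "b \<in> B" and f: "\<bar>f\<bar> \<le> C * exp (c * (\<Sum>b\<in>B. \<bar>\<xi> b\<bar>))"
  shows "\<bar>\<xi> b * f\<bar> \<le> C * exp ((1 + c) * (\<Sum>b\<in>B. \<bar>\<xi> b :: real\<bar>))"
proof -
  have "\<bar>\<xi> b\<bar> \<le> (\<Sum>b\<in>B. \<bar>\<xi> b\<bar>)" using assms by (intro member_le_sum) auto
  also have "\<dots> \<le> exp (\<Sum>b\<in>B. \<bar>\<xi> b\<bar>)"
    using exp_ge_add_one_self[of "(\<Sum>b\<in>B. \<bar>\<xi> b\<bar>)"] by linarith
  finally have "\<bar>\<xi> b\<bar> * \<bar>f\<bar> \<le> exp (\<Sum>b\<in>B. \<bar>\<xi> b\<bar>) * (C * exp (c * (\<Sum>b\<in>B. \<bar>\<xi> b\<bar>)))"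
    by (intro mult_mono f) auto
  then show ?thesis by (simp add: abs_mult distrib_right exp_add mult_ac)
qed

text \<open>Fubini singles out the coordinate \<open>b\<close>. With the other coordinates frozen,
  their share of the growth bound joins the constant and \<open>std_normal_stein\<close>
  applies.\<close>

lemma gauss_stein:
  fixes \<psi> \<psi>' :: "('b \<Rightarrow> real) \<Rightarrow> real"
  assumes B: "finite B" "b \<in> B"
    and deriv: "\<And>\<xi> t. ((\<lambda>t. \<psi> (\<xi>(b := t))) has_real_derivative \<psi>' (\<xi>(b := t))) (at t)"
    and cont: "\<And>\<xi> t. isCont (\<lambda>t. \<psi>' (\<xi>(b := t))) t"
    and [measurable]: "\<psi> \<in> borel_measurable (gauss B)" "\<psi>' \<in> borel_measurable (gauss B)"
    and f: "\<And>\<xi>. \<bar>\<psi> \<xi>\<bar> \<le> C * exp (c * (\<Sum>b\<in>B. \<bar>\<xi> b\<bar>))"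
    and f': "\<And>\<xi>. \<bar>\<psi>' \<xi>\<bar> \<le> C * exp (c * (\<Sum>b\<in>B. \<bar>\<xi> b\<bar>))"
  shows "(\<integral>\<xi>. \<xi> b * \<psi> \<xi> \<partial>gauss B) = (\<integral>\<xi>. \<psi>' \<xi> \<partial>gauss B)"
proof -
  define J where "J = B - {b}"
  have J: "finite J" "b \<notin> J" "B = insert b J" using B by (auto simp: J_def)
  have [measurable]: "(\<lambda>\<xi>. \<xi> b) \<in> borel_measurable (gauss B)"
    using B measurable_component_singleton[of b B "\<lambda>_. std_normal_distribution"] by simp
  have i1: "integrable (gauss B) (\<lambda>\<xi>. \<xi> b * \<psi> \<xi>)"
    by (rule integrable_exp_growth[OF B(1) _ exp_growth_times_coord[OF B f]]) measurable
  have i2: "integrable (gauss B) \<psi>'"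
    by (rule integrable_exp_growth[OF B(1) _ f']) measurable
  have s: "(\<Sum>b'\<in>B. \<bar>(\<xi>(b := t)) b'\<bar>) = (\<Sum>b'\<in>J. \<bar>\<xi> b'\<bar>) + \<bar>t\<bar>" for \<xi> :: "'b \<Rightarrow> real" and t
  proof -
    have "(\<Sum>b'\<in>J. \<bar>(\<xi>(b := t)) b'\<bar>) = (\<Sum>b'\<in>J. \<bar>\<xi> b'\<bar>)"
      using J by (intro sum.cong) auto
    then show ?thesis using J by simp
  qed
  have "(\<integral>\<xi>. \<xi> b * \<psi> \<xi> \<partial>gauss B) = (\<integral>\<xi>. (\<integral>t. t * \<psi> (\<xi>(b := t)) \<partial>std_normal_distribution) \<partial>gauss J)"
    using product_sigma_finite.product_integral_insert[OF product_sigma_finite_std_normal J(1,2) i1[unfolded J(3)]]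
    by (simp add: J(3))
  also have "\<dots> = (\<integral>\<xi>. (\<integral>t. \<psi>' (\<xi>(b := t)) \<partial>std_normal_distribution) \<partial>gauss J)"
  proof (rule Bochner_Integration.integral_cong[OF refl])
    fix \<xi> :: "'b \<Rightarrow> real"
    show "(\<integral>t. t * \<psi> (\<xi>(b := t)) \<partial>std_normal_distribution) = (\<integral>t. \<psi>' (\<xi>(b := t)) \<partial>std_normal_distribution)"
    proof (rule std_normal_stein[where C="C * exp (c * (\<Sum>b'\<in>J. \<bar>\<xi> b'\<bar>))" and c=c])
      show "\<bar>\<psi> (\<xi>(b := t))\<bar> \<le> C * exp (c * (\<Sum>b'\<in>J. \<bar>\<xi> b'\<bar>)) * exp (c * \<bar>t\<bar>)" for t
        using f[of "\<xi>(b := t)"] unfolding s by (simp add: distrib_left exp_add mult_ac)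
      show "\<bar>\<psi>' (\<xi>(b := t))\<bar> \<le> C * exp (c * (\<Sum>b'\<in>J. \<bar>\<xi> b'\<bar>)) * exp (c * \<bar>t\<bar>)" for t
        using f'[of "\<xi>(b := t)"] unfolding s by (simp add: distrib_left exp_add mult_ac)
    qed (use deriv cont in auto)
  qed
  also have "\<dots> = (\<integral>\<xi>. \<psi>' \<xi> \<partial>gauss B)"
    using product_sigma_finite.product_integral_insert[OF product_sigma_finite_std_normal J(1,2) i2[unfolded J(3)]]
    by (simp add: J(3))
  finally show ?thesis .
qed

section \<open>Comparison of Gaussian processes along a rotation path\<close>

text \<open>Differentiability is encoded through curves. Coordinates outside \<open>A\<close> stay
  unconstrained, and the same notion serves for motion in the angle of the path and for motion in a
  single Gaussian coordinate.\<close>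

definition chain_rule :: "'a set \<Rightarrow> (('a \<Rightarrow> real) \<Rightarrow> real) \<Rightarrow> ('a \<Rightarrow> ('a \<Rightarrow> real) \<Rightarrow> real) \<Rightarrow> bool" where
  "chain_rule A F F' \<longleftrightarrow> (\<forall>x x' t. (\<forall>a\<in>A. (x a has_real_derivative x' a) (at t)) \<longrightarrow>
     ((\<lambda>s. F (\<lambda>a. x a s)) has_real_derivative (\<Sum>a\<in>A. F' a (\<lambda>a. x a t) * x' a)) (at t))"

definition continuous_along_curves :: "'a set \<Rightarrow> (('a \<Rightarrow> real) \<Rightarrow> real) \<Rightarrow> bool" where
  "continuous_along_curves A F \<longleftrightarrow>
     (\<forall>x t. (\<forall>a\<in>A. isCont (x a) (t::real)) \<longrightarrow> isCont (\<lambda>s. F (\<lambda>a. x a s)) t)"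

definition exp_growth :: "'a set \<Rightarrow> real \<Rightarrow> real \<Rightarrow> (('a \<Rightarrow> real) \<Rightarrow> real) \<Rightarrow> bool" where
  "exp_growth A C l F \<longleftrightarrow> (\<forall>x. \<bar>F x\<bar> \<le> C * exp (l * (\<Sum>a\<in>A. \<bar>x a\<bar>)))"

lemma chain_ruleD:
  assumes "chain_rule A F F'" "\<And>a. a \<in> A \<Longrightarrow> (x a has_real_derivative x' a) (at t)"
  shows "((\<lambda>s. F (\<lambda>a. x a s)) has_real_derivative (\<Sum>a\<in>A. F' a (\<lambda>a. x a t) * x' a)) (at t)"
  using assms unfolding chain_rule_def by blast

lemma continuous_along_curvesD:
  "continuous_along_curves A F \<Longrightarrow> (\<And>a. a \<in> A \<Longrightarrow> isCont (x a) (t::real)) \<Longrightarrow> isCont (\<lambda>s. F (\<lambda>a. x a s)) t"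
  unfolding continuous_along_curves_def by blast

text \<open>The interpolation runs from the process with coefficients \<open>c\<close> at angle 0 to
  the one with coefficients \<open>d\<close> at angle \<open>pi / 2\<close>. A rotation, unlike
  weights sqrt (1 - t) and sqrt t, is smooth up to both endpoints. Both processes use the same
  Gaussian vector; the hypothesis \<open>cross\<close> below makes them independent.\<close>

definition gpath :: "'b set \<Rightarrow> ('a \<Rightarrow> 'b \<Rightarrow> real) \<Rightarrow> ('a \<Rightarrow> 'b \<Rightarrow> real) \<Rightarrow> real \<Rightarrow> ('b \<Rightarrow> real) \<Rightarrow> 'a \<Rightarrow> real" where
  "gpath B c d \<theta> \<xi> a = (\<Sum>b\<in>B. (cos \<theta> * c a b + sin \<theta> * d a b) * \<xi> b)"

definition gpath' :: "'b set \<Rightarrow> ('a \<Rightarrow> 'b \<Rightarrow> real) \<Rightarrow> ('a \<Rightarrow> 'b \<Rightarrow> real) \<Rightarrow> real \<Rightarrow> ('b \<Rightarrow> real) \<Rightarrow> 'a \<Rightarrow> real" where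
  "gpath' B c d \<theta> \<xi> a = (\<Sum>b\<in>B. (cos \<theta> * d a b - sin \<theta> * c a b) * \<xi> b)"

lemma gpath_deriv: "((\<lambda>\<theta>. gpath B c d \<theta> \<xi> a) has_real_derivative gpath' B c d \<theta> \<xi> a) (at \<theta>)"
  unfolding gpath_def gpath'_def
  by (auto intro!: derivative_eq_intros sum.cong simp: algebra_simps)

lemma gpath_coord_deriv:
  assumes "finite B" "b \<in> B"
  shows "((\<lambda>t. gpath B c d \<theta> (\<xi>(b := t)) a) has_real_derivative (cos \<theta> * c a b + sin \<theta> * d a b)) (at t)"
proof -
  have "gpath B c d \<theta> (\<xi>(b := t)) a = (cos \<theta> * c a b + sin \<theta> * d a b) * t
      + (\<Sum>b'\<in>B - {b}. (cos \<theta> * c a b' + sin \<theta> * d a b') * \<xi> b')" for t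
    unfolding gpath_def using assms by (subst sum.remove[of B b]) (auto intro!: sum.cong)
  then show ?thesis by (auto intro!: derivative_eq_intros)
qed

lemma borel_measurable_coord:
  "b \<in> B \<Longrightarrow> (\<lambda>\<xi>. \<xi> b) \<in> borel_measurable (gauss B)"
  using measurable_component_singleton[of b B "\<lambda>_. std_normal_distribution"] by simp

lemma gpath_measurable_pair:
  "(\<lambda>(\<theta>, \<xi>). gpath B c d \<theta> \<xi> a) \<in> borel_measurable (lborel \<Otimes>\<^sub>M gauss B)"
  "(\<lambda>(\<theta>, \<xi>). gpath' B c d \<theta> \<xi> a) \<in> borel_measurable (lborel \<Otimes>\<^sub>M gauss B)"
  unfolding gpath_def gpath'_def case_prod_beta
  by (intro borel_measurable_sum borel_measurable_times measurable_compose[OF measurable_snd borel_measurable_coord]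
      measurable_compose[OF measurable_fst] borel_measurable_continuous_onI continuous_intros; simp;
      intro borel_measurable_continuous_onI continuous_intros)+

lemma gpath_measurable:
  "(\<lambda>\<xi>. gpath B c d \<theta> \<xi> a) \<in> borel_measurable (gauss B)"
  "(\<lambda>\<xi>. gpath' B c d \<theta> \<xi> a) \<in> borel_measurable (gauss B)"
  unfolding gpath_def gpath'_def
  by (intro borel_measurable_sum borel_measurable_times borel_measurable_const borel_measurable_coord; assumption)+

lemma abs_rotation_le: "\<bar>cos \<theta> * u + sin \<theta> * v\<bar> \<le> \<bar>u\<bar> + \<bar>v :: real\<bar>"
proof -
  have "\<bar>cos \<theta>\<bar> * \<bar>u\<bar> \<le> 1 * \<bar>u\<bar>" "\<bar>sin \<theta>\<bar> * \<bar>v\<bar> \<le> 1 * \<bar>v\<bar>" by (intro mult_right_mono; simp)+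
  then show ?thesis
    using abs_triangle_ineq[of "cos \<theta> * u" "sin \<theta> * v"] by (simp add: abs_mult)
qed

text \<open>A crude l1 operator norm that serves all angles at once, for the path and for its
  derivative.\<close>

definition coeff_bound :: "'a set \<Rightarrow> 'b set \<Rightarrow> ('a \<Rightarrow> 'b \<Rightarrow> real) \<Rightarrow> ('a \<Rightarrow> 'b \<Rightarrow> real) \<Rightarrow> real" where
  "coeff_bound A B c d = (\<Sum>a\<in>A. \<Sum>b\<in>B. \<bar>c a b\<bar> + \<bar>d a b\<bar>)"

lemma coeff_bound_ge:
  assumes "finite A" "finite B" "a \<in> A" "b \<in> B"
  shows "\<bar>c a b\<bar> + \<bar>d a b\<bar> \<le> coeff_bound A B c d"
proof -
  have "\<bar>c a b\<bar> + \<bar>d a b\<bar> \<le> (\<Sum>b\<in>B. \<bar>c a b\<bar> + \<bar>d a b\<bar>)"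
    using assms by (intro member_le_sum) auto
  also have "\<dots> \<le> coeff_bound A B c d" unfolding coeff_bound_def
    using assms by (intro member_le_sum[of a A "\<lambda>a. \<Sum>b\<in>B. \<bar>c a b\<bar> + \<bar>d a b\<bar>"] sum_nonneg) auto
  finally show ?thesis .
qed

lemma sum_abs_linear_le:
  assumes "finite A" "finite B" "\<And>a b. a \<in> A \<Longrightarrow> b \<in> B \<Longrightarrow> \<bar>e a b\<bar> \<le> \<bar>c a b\<bar> + \<bar>d a b :: real\<bar>"
  shows "(\<Sum>a\<in>A. \<bar>\<Sum>b\<in>B. e a b * \<xi> b\<bar>) \<le> coeff_bound A B c d * (\<Sum>b\<in>B. \<bar>\<xi> b\<bar>)"
proof -
  have "(\<Sum>a\<in>A. \<bar>\<Sum>b\<in>B. e a b * \<xi> b\<bar>) \<le> (\<Sum>a\<in>A. \<Sum>b\<in>B. (\<bar>c a b\<bar> + \<bar>d a b\<bar>) * (\<Sum>b\<in>B. \<bar>\<xi> b\<bar>))"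
  proof (intro sum_mono order_trans[OF sum_abs])
    fix a b assume "a \<in> A" "b \<in> B"
    then show "\<bar>e a b * \<xi> b\<bar> \<le> (\<bar>c a b\<bar> + \<bar>d a b\<bar>) * (\<Sum>b\<in>B. \<bar>\<xi> b\<bar>)"
      unfolding abs_mult using assms by (intro mult_mono assms member_le_sum) auto
  qed
  then show ?thesis by (simp add: coeff_bound_def sum_distrib_right)
qed

lemma sum_abs_gpath_le:
  assumes "finite A" "finite B"
  shows "(\<Sum>a\<in>A. \<bar>gpath B c d \<theta> \<xi> a\<bar>) \<le> coeff_bound A B c d * (\<Sum>b\<in>B. \<bar>\<xi> b\<bar>)"
    and "(\<Sum>a\<in>A. \<bar>gpath' B c d \<theta> \<xi> a\<bar>) \<le> coeff_bound A B c d * (\<Sum>b\<in>B. \<bar>\<xi> b\<bar>)"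
proof -
  show "(\<Sum>a\<in>A. \<bar>gpath B c d \<theta> \<xi> a\<bar>) \<le> coeff_bound A B c d * (\<Sum>b\<in>B. \<bar>\<xi> b\<bar>)"
    unfolding gpath_def by (intro sum_abs_linear_le assms abs_rotation_le)
  have "\<bar>cos \<theta> * d a b - sin \<theta> * c a b\<bar> \<le> \<bar>c a b\<bar> + \<bar>d a b\<bar>" for a b
    using abs_rotation_le[of \<theta> "d a b" "- c a b"] by simp
  then show "(\<Sum>a\<in>A. \<bar>gpath' B c d \<theta> \<xi> a\<bar>) \<le> coeff_bound A B c d * (\<Sum>b\<in>B. \<bar>\<xi> b\<bar>)"
    unfolding gpath'_def by (intro sum_abs_linear_le assms)
qed

lemma coeff_bound_nonneg: "0 \<le> coeff_bound A B c d"
  unfolding coeff_bound_def by (intro sum_nonneg) auto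

lemma exp_growth_gpath:
  assumes "finite A" "finite B" "exp_growth A C l F" "0 \<le> C" "0 \<le> l"
  shows "\<bar>F (gpath B c d \<theta> \<xi>)\<bar> \<le> C * exp (l * coeff_bound A B c d * (\<Sum>b\<in>B. \<bar>\<xi> b\<bar>))"
proof -
  have "\<bar>F (gpath B c d \<theta> \<xi>)\<bar> \<le> C * exp (l * (\<Sum>a\<in>A. \<bar>gpath B c d \<theta> \<xi> a\<bar>))"
    using assms(3) by (simp add: exp_growth_def)
  also have "\<dots> \<le> C * exp (l * (coeff_bound A B c d * (\<Sum>b\<in>B. \<bar>\<xi> b\<bar>)))"
    using assms by (intro mult_left_mono iffD2[OF exp_le_cancel_iff] sum_abs_gpath_le) auto
  finally show ?thesis by (simp add: mult.assoc)
qed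

lemma measurable_gpath_comp:
  assumes "F \<in> borel_measurable (PiM UNIV (\<lambda>_. borel))"
  shows "(\<lambda>\<xi>. F (gpath B c d \<theta> \<xi>)) \<in> borel_measurable (gauss B)"
    "(\<lambda>(\<theta>, \<xi>). F (gpath B c d \<theta> \<xi>)) \<in> borel_measurable (lborel \<Otimes>\<^sub>M gauss B)"
proof -
  show "(\<lambda>\<xi>. F (gpath B c d \<theta> \<xi>)) \<in> borel_measurable (gauss B)"
    by (rule measurable_compose[OF measurable_abs_UNIV[OF gpath_measurable(1)] assms])
  show "(\<lambda>(\<theta>, \<xi>). F (gpath B c d \<theta> \<xi>)) \<in> borel_measurable (lborel \<Otimes>\<^sub>M gauss B)"
    unfolding case_prod_beta
    by (rule measurable_compose[OF measurable_abs_UNIV[OF gpath_measurable_pair(1)[unfolded case_prod_beta]] assms])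
qed

lemma sum_swap3:
  "(\<Sum>a\<in>A. \<Sum>b\<in>B. \<Sum>c\<in>C. f a b c) = (\<Sum>a\<in>A. \<Sum>c\<in>C. \<Sum>b\<in>B. f a b c)"
  by (rule sum.cong[OF refl], rule sum.swap)

lemma integral_nonpos:
  assumes "\<And>x. f x \<le> (0::real)"
  shows "integral\<^sup>L M f \<le> 0"
proof -
  have "0 \<le> integral\<^sup>L M (\<lambda>x. - f x)" using assms by (intro Bochner_Integration.integral_nonneg) simp
  then show ?thesis by simp
qed

section \<open>Derivative of the expected functional along the path, and the comparison
  theorem\<close>

context
  fixes A :: "'a set" and B :: "'b set" and F :: "('a \<Rightarrow> real) \<Rightarrow> real" and F1 F2 and c d :: "'a \<Rightarrow> 'b \<Rightarrow> real"
    and C l :: real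
  assumes finA: "finite A" and finB: "finite B"
    and F1: "chain_rule A F F1" and F2: "\<And>a. a \<in> A \<Longrightarrow> chain_rule A (F1 a) (F2 a)"
    and F2_cont: "\<And>a a'. a \<in> A \<Longrightarrow> a' \<in> A \<Longrightarrow> continuous_along_curves A (F2 a a')"
    and growth: "exp_growth A C l F" "\<And>a. a \<in> A \<Longrightarrow> exp_growth A C l (F1 a)"
      "\<And>a a'. a \<in> A \<Longrightarrow> a' \<in> A \<Longrightarrow> exp_growth A C l (F2 a a')"
    and meas: "F \<in> borel_measurable (PiM UNIV (\<lambda>_. borel))"
      "\<And>a. a \<in> A \<Longrightarrow> F1 a \<in> borel_measurable (PiM UNIV (\<lambda>_. borel))"
      "\<And>a a'. a \<in> A \<Longrightarrow> a' \<in> A \<Longrightarrow> F2 a a' \<in> borel_measurable (PiM UNIV (\<lambda>_. borel))"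
    and l: "0 \<le> l"
begin

lemma C_nonneg: "0 \<le> C"
proof -
  have "\<bar>F (\<lambda>_. 0)\<bar> \<le> C" using growth(1)[unfolded exp_growth_def, rule_format, of "\<lambda>_. 0"] by simp
  then show ?thesis by linarith
qed

lemmas growth_gpath = exp_growth_gpath[OF finA finB _ C_nonneg l]

lemma integrable_gpath:
  "integrable (gauss B) (\<lambda>\<xi>. F (gpath B c d \<theta> \<xi>))"
  "a \<in> A \<Longrightarrow> integrable (gauss B) (\<lambda>\<xi>. F1 a (gpath B c d \<theta> \<xi>))"
  "a \<in> A \<Longrightarrow> a' \<in> A \<Longrightarrow> integrable (gauss B) (\<lambda>\<xi>. F2 a a' (gpath B c d \<theta> \<xi>))"
  by (rule integrable_exp_growth[OF finB measurable_gpath_comp(1)[OF meas(1)] growth_gpath[OF growth(1)]]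
      integrable_exp_growth[OF finB measurable_gpath_comp(1)[OF meas(2)] growth_gpath[OF growth(2)]]
      integrable_exp_growth[OF finB measurable_gpath_comp(1)[OF meas(3)] growth_gpath[OF growth(3)]]; assumption)+

lemma integrable_coord_gpath:
  assumes "a \<in> A" "b \<in> B"
  shows "integrable (gauss B) (\<lambda>\<xi>. \<xi> b * F1 a (gpath B c d \<theta> \<xi>))"
proof (rule integrable_exp_growth[OF finB])
  show "\<bar>\<xi> b * F1 a (gpath B c d \<theta> \<xi>)\<bar> \<le> C * exp ((1 + l * coeff_bound A B c d) * (\<Sum>b\<in>B. \<bar>\<xi> b\<bar>))" for \<xi>
    by (rule exp_growth_times_coord[OF finB assms(2) growth_gpath[OF growth(2)[OF assms(1)]]])
  show "(\<lambda>\<xi>. \<xi> b * F1 a (gpath B c d \<theta> \<xi>)) \<in> borel_measurable (gauss B)"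
    by (intro borel_measurable_times borel_measurable_coord assms measurable_gpath_comp(1) meas(2))
qed

text \<open>Integration by parts in \<open>\<xi> b\<close>. Every entry of the path is affine in
  that coordinate, so the chain rule yields the second partial derivatives weighted by the
  coefficients of the path.\<close>

lemma stein_gpath:
  assumes a: "a \<in> A" and b: "b \<in> B"
  shows "(\<integral>\<xi>. \<xi> b * F1 a (gpath B c d \<theta> \<xi>) \<partial>gauss B)
    = (\<Sum>a'\<in>A. (cos \<theta> * c a' b + sin \<theta> * d a' b) * (\<integral>\<xi>. F2 a a' (gpath B c d \<theta> \<xi>) \<partial>gauss B))"
proof -
  define e where "e a' = cos \<theta> * c a' b + sin \<theta> * d a' b" for a'
  define K where "K = coeff_bound A B c d"
  have e: "\<bar>e a'\<bar> \<le> K" if "a' \<in> A" for a'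
    using abs_rotation_le[of \<theta> "c a' b" "d a' b"] coeff_bound_ge[OF finA finB that b, of c d]
    unfolding e_def K_def by linarith
  have K: "K \<ge> 0" unfolding K_def by (rule coeff_bound_nonneg)
  have "(\<integral>\<xi>. \<xi> b * F1 a (gpath B c d \<theta> \<xi>) \<partial>gauss B)
      = (\<integral>\<xi>. (\<Sum>a'\<in>A. F2 a a' (gpath B c d \<theta> \<xi>) * e a') \<partial>gauss B)"
  proof (rule gauss_stein[OF finB b, where C="C + real (card A) * (C * K)" and c="l * K"])
    show "(\<lambda>\<xi>. F1 a (gpath B c d \<theta> \<xi>)) \<in> borel_measurable (gauss B)"
      by (rule measurable_gpath_comp(1)[OF meas(2)[OF a]])
    show "(\<lambda>\<xi>. \<Sum>a'\<in>A. F2 a a' (gpath B c d \<theta> \<xi>) * e a') \<in> borel_measurable (gauss B)"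
      by (intro borel_measurable_sum borel_measurable_times measurable_gpath_comp(1)[OF meas(3)[OF a]] borel_measurable_const)
    fix \<xi> :: "'b \<Rightarrow> real"
    have "\<bar>F1 a (gpath B c d \<theta> \<xi>)\<bar> \<le> C * exp (l * K * (\<Sum>b\<in>B. \<bar>\<xi> b\<bar>))"
      unfolding K_def by (rule growth_gpath[OF growth(2)[OF a]])
    also have "\<dots> \<le> (C + real (card A) * (C * K)) * exp (l * K * (\<Sum>b\<in>B. \<bar>\<xi> b\<bar>))"
      using K C_nonneg by (intro mult_right_mono) auto
    finally show "\<bar>F1 a (gpath B c d \<theta> \<xi>)\<bar> \<le> (C + real (card A) * (C * K)) * exp (l * K * (\<Sum>b\<in>B. \<bar>\<xi> b\<bar>))" .
    have "\<bar>\<Sum>a'\<in>A. F2 a a' (gpath B c d \<theta> \<xi>) * e a'\<bar> \<le> (\<Sum>a'\<in>A. (C * exp (l * K * (\<Sum>b\<in>B. \<bar>\<xi> b\<bar>))) * K)"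
    proof (intro order_trans[OF sum_abs] sum_mono)
      fix a' assume a': "a' \<in> A"
      show "\<bar>F2 a a' (gpath B c d \<theta> \<xi>) * e a'\<bar> \<le> C * exp (l * K * (\<Sum>b\<in>B. \<bar>\<xi> b\<bar>)) * K"
        unfolding abs_mult using C_nonneg
        by (intro mult_mono e[OF a']) (auto simp: K_def intro!: growth_gpath[OF growth(3)[OF a a']])
    qed
    also have "\<dots> = (real (card A) * (C * K)) * exp (l * K * (\<Sum>b\<in>B. \<bar>\<xi> b\<bar>))" by simp
    also have "\<dots> \<le> (C + real (card A) * (C * K)) * exp (l * K * (\<Sum>b\<in>B. \<bar>\<xi> b\<bar>))"
      using K C_nonneg by (intro mult_right_mono) auto
    finally show "\<bar>\<Sum>a'\<in>A. F2 a a' (gpath B c d \<theta> \<xi>) * e a'\<bar> \<le> (C + real (card A) * (C * K)) * exp (l * K * (\<Sum>b\<in>B. \<bar>\<xi> b\<bar>))" .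
    fix t
    have der: "((\<lambda>t. gpath B c d \<theta> (\<xi>(b := t)) a') has_real_derivative e a') (at t)" for a'
      unfolding e_def by (rule gpath_coord_deriv[OF finB b])
    show "((\<lambda>t. F1 a (gpath B c d \<theta> (\<xi>(b := t)))) has_real_derivative
        (\<Sum>a'\<in>A. F2 a a' (gpath B c d \<theta> (\<xi>(b := t))) * e a')) (at t)"
      using chain_ruleD[OF F2[OF a], of "\<lambda>a t. gpath B c d \<theta> (\<xi>(b := t)) a" e t, OF der] by simp
    show "isCont (\<lambda>t. \<Sum>a'\<in>A. F2 a a' (gpath B c d \<theta> (\<xi>(b := t))) * e a') t"
    proof (intro continuous_intros)
      fix a' assume a': "a' \<in> A"
      show "isCont (\<lambda>t. F2 a a' (gpath B c d \<theta> (\<xi>(b := t)))) t"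
        using continuous_along_curvesD[OF F2_cont[OF a a'],
            where x="\<lambda>a t. gpath B c d \<theta> (\<xi>(b := t)) a" and t=t, OF DERIV_isCont[OF der]] by simp
    qed
  qed
  also have "\<dots> = (\<Sum>a'\<in>A. e a' * (\<integral>\<xi>. F2 a a' (gpath B c d \<theta> \<xi>) \<partial>gauss B))"
    using integrable_gpath(3)[OF a] by (subst Bochner_Integration.integral_sum) (auto simp: mult.commute)
  finally show ?thesis unfolding e_def .
qed

text \<open>After integration by parts the Hessian is contracted with the covariance between the
  path and its derivative. The hypothesis \<open>cross\<close> removes the mixed products, and the
  remaining ones combine to \<open>- (sin \<theta> * cos \<theta>)\<close> times the difference of
  the two covariance matrices.\<close>

lemma integral_gpath_deriv:
  assumes cross: "\<And>a a'. a \<in> A \<Longrightarrow> a' \<in> A \<Longrightarrow> (\<Sum>b\<in>B. c a b * d a' b) = 0"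
  shows "(\<integral>\<xi>. (\<Sum>a\<in>A. F1 a (gpath B c d \<theta> \<xi>) * gpath' B c d \<theta> \<xi> a) \<partial>gauss B)
    = - (sin \<theta> * cos \<theta>) * (\<Sum>a\<in>A. \<Sum>a'\<in>A. ((\<Sum>b\<in>B. c a b * c a' b) - (\<Sum>b\<in>B. d a b * d a' b))
        * (\<integral>\<xi>. F2 a a' (gpath B c d \<theta> \<xi>) \<partial>gauss B))"
proof -
  define e where "e a b = cos \<theta> * c a b + sin \<theta> * d a b" for a b
  define e' where "e' a b = cos \<theta> * d a b - sin \<theta> * c a b" for a b
  define E where "E a a' = (\<integral>\<xi>. F2 a a' (gpath B c d \<theta> \<xi>) \<partial>gauss B)" for a a'
  have "(\<integral>\<xi>. (\<Sum>a\<in>A. F1 a (gpath B c d \<theta> \<xi>) * gpath' B c d \<theta> \<xi> a) \<partial>gauss B)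
      = (\<integral>\<xi>. (\<Sum>a\<in>A. \<Sum>b\<in>B. e' a b * (\<xi> b * F1 a (gpath B c d \<theta> \<xi>))) \<partial>gauss B)"
    by (simp add: gpath'_def sum_distrib_left e'_def mult_ac)
  also have "\<dots> = (\<Sum>a\<in>A. \<Sum>b\<in>B. e' a b * (\<integral>\<xi>. \<xi> b * F1 a (gpath B c d \<theta> \<xi>) \<partial>gauss B))"
    using integrable_coord_gpath
    by (subst Bochner_Integration.integral_sum, fastforce, intro sum.cong refl,
        subst Bochner_Integration.integral_sum) auto
  also have "\<dots> = (\<Sum>a\<in>A. \<Sum>b\<in>B. e' a b * (\<Sum>a'\<in>A. e a' b * E a a'))"
    unfolding e_def E_def by (intro sum.cong refl arg_cong2[where f="(*)"] stein_gpath)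
  also have "\<dots> = (\<Sum>a\<in>A. \<Sum>a'\<in>A. (\<Sum>b\<in>B. e' a b * e a' b) * E a a')"
    by (simp add: sum_distrib_left sum_distrib_right mult.assoc) (rule sum_swap3)
  also have "\<dots> = (\<Sum>a\<in>A. \<Sum>a'\<in>A. - (sin \<theta> * cos \<theta>) * (((\<Sum>b\<in>B. c a b * c a' b) - (\<Sum>b\<in>B. d a b * d a' b)) * E a a'))"
  proof (intro sum.cong refl)
    fix a a' assume a: "a \<in> A" "a' \<in> A"
    have "(\<Sum>b\<in>B. e' a b * e a' b) = (\<Sum>b\<in>B. (sin \<theta> * cos \<theta>) * (d a b * d a' b) - (sin \<theta> * cos \<theta>) * (c a b * c a' b)
        + (cos \<theta>)\<^sup>2 * (c a' b * d a b) - (sin \<theta>)\<^sup>2 * (c a b * d a' b))"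
      by (intro sum.cong refl) (simp add: e_def e'_def algebra_simps power2_eq_square)
    also have "\<dots> = - (sin \<theta> * cos \<theta>) * ((\<Sum>b\<in>B. c a b * c a' b) - (\<Sum>b\<in>B. d a b * d a' b))"
      unfolding sum.distrib sum_subtractf sum_distrib_left[symmetric] cross[OF a] cross[OF a(2,1)]
      by (simp add: algebra_simps)
    finally show "(\<Sum>b\<in>B. e' a b * e a' b) * E a a' = - (sin \<theta> * cos \<theta>) * (((\<Sum>b\<in>B. c a b * c a' b) - (\<Sum>b\<in>B. d a b * d a' b)) * E a a')"
      by simp
  qed
  finally show ?thesis by (simp add: sum_distrib_left E_def)
qed

text \<open>The weight \<open>exp (\<kappa> / 2 * (cos \<theta>)\<^sup>2)\<close> is chosen so that
  its own derivative carries the same factor \<open>- (sin \<theta> * cos \<theta>)\<close> as the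
  Hessian term. The derivative of the weighted expectation is then this factor times the weight and
  the expectation of the expression in \<open>sign\<close>, hence nonnegative on the quarter turn.
  With \<open>\<kappa> = 0\<close> this is a plain Gaussian comparison; other values absorb a
  contraction that is bounded by a multiple of \<open>F\<close>.\<close>

theorem gaussian_comparison:
  assumes cross: "\<And>a a'. a \<in> A \<Longrightarrow> a' \<in> A \<Longrightarrow> (\<Sum>b\<in>B. c a b * d a' b) = 0"
    and sign: "\<And>\<theta> \<xi>. \<kappa> * F (gpath B c d \<theta> \<xi>) + (\<Sum>a\<in>A. \<Sum>a'\<in>A.
        ((\<Sum>b\<in>B. c a b * c a' b) - (\<Sum>b\<in>B. d a b * d a' b)) * F2 a a' (gpath B c d \<theta> \<xi>)) \<le> 0"
  shows "exp (\<kappa> / 2) * (\<integral>\<xi>. F (\<lambda>a. \<Sum>b\<in>B. c a b * \<xi> b) \<partial>gauss B) \<le> (\<integral>\<xi>. F (\<lambda>a. \<Sum>b\<in>B. d a b * \<xi> b) \<partial>gauss B)"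
proof -
  let ?X = "gpath B c d" and ?X' = "gpath' B c d"
  define K where "K = coeff_bound A B c d"
  define H where "H \<theta> \<xi> = exp (\<kappa> / 2 * (cos \<theta>)\<^sup>2) * F (?X \<theta> \<xi>)" for \<theta> \<xi>
  define D where "D \<theta> \<xi> = exp (\<kappa> / 2 * (cos \<theta>)\<^sup>2) *
     ((\<Sum>a\<in>A. F1 a (?X \<theta> \<xi>) * ?X' \<theta> \<xi> a) - \<kappa> * (sin \<theta> * cos \<theta>) * F (?X \<theta> \<xi>))" for \<theta> \<xi>
  have K: "K \<ge> 0" unfolding K_def by (rule coeff_bound_nonneg)
  have DF: "((\<lambda>\<theta>. F (?X \<theta> \<xi>)) has_real_derivative (\<Sum>a\<in>A. F1 a (?X \<theta> \<xi>) * ?X' \<theta> \<xi> a)) (at \<theta>)" for \<theta> \<xi>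
    using chain_ruleD[OF F1, of "\<lambda>a \<theta>. ?X \<theta> \<xi> a", OF gpath_deriv] by simp
  have DF1: "((\<lambda>\<theta>. F1 a (?X \<theta> \<xi>)) has_real_derivative (\<Sum>a'\<in>A. F2 a a' (?X \<theta> \<xi>) * ?X' \<theta> \<xi> a')) (at \<theta>)" if "a \<in> A" for \<theta> \<xi> a
    using chain_ruleD[OF F2[OF that], of "\<lambda>a \<theta>. ?X \<theta> \<xi> a", OF gpath_deriv] by simp
  have HD: "((\<lambda>\<theta>. H \<theta> \<xi>) has_real_derivative D \<theta> \<xi>) (at \<theta>)" for \<theta> \<xi>
    unfolding H_def D_def
    by (auto intro!: derivative_eq_intros DF simp: algebra_simps)
  have "isCont (\<lambda>\<theta>. gpath' B c d \<theta> \<xi> a) \<theta>" for a \<xi> \<theta>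
    unfolding gpath'_def by (intro continuous_intros)
  then have contD: "isCont (\<lambda>\<theta>. D \<theta> \<xi>) \<theta>" for \<theta> \<xi>
    unfolding D_def by (intro continuous_intros DERIV_isCont[OF DF] DERIV_isCont[OF DF1])
  have iH: "integrable (gauss B) (H \<theta>)" for \<theta>
    unfolding H_def by (intro integrable_mult_right integrable_gpath)
  define C' where "C' = exp (\<bar>\<kappa>\<bar> / 2) * (real (card A) * (C * K) + \<bar>\<kappa>\<bar> * C)"
  define s where "s \<xi> = (\<Sum>b\<in>B. \<bar>\<xi> b :: real\<bar>)" for \<xi>
  have bD: "\<bar>D \<theta> \<xi>\<bar> \<le> C' * exp ((1 + l * K) * s \<xi>)" for \<theta> \<xi>
  proof -
    have s: "s \<xi> \<ge> 0" "s \<xi> \<le> exp (s \<xi>)"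
      subgoal by (simp add: s_def sum_nonneg)
      subgoal using exp_ge_add_one_self[of "s \<xi>"] by linarith
      done
    have "(cos \<theta>)\<^sup>2 \<le> 1" by (simp add: abs_square_le_1)
    then have "\<kappa> * (cos \<theta>)\<^sup>2 \<le> \<bar>\<kappa>\<bar> * 1" by (intro mult_mono) auto
    then have ek: "exp (\<kappa> / 2 * (cos \<theta>)\<^sup>2) \<le> exp (\<bar>\<kappa>\<bar> / 2)" by simp
    have "\<bar>\<Sum>a\<in>A. F1 a (?X \<theta> \<xi>) * ?X' \<theta> \<xi> a\<bar> \<le> (\<Sum>a\<in>A. (C * exp (l * K * s \<xi>)) * (K * exp (s \<xi>)))"
    proof (intro order_trans[OF sum_abs] sum_mono)
      fix a assume a: "a \<in> A"
      have "\<bar>?X' \<theta> \<xi> a\<bar> \<le> (\<Sum>a\<in>A. \<bar>?X' \<theta> \<xi> a\<bar>)" using a finA by (intro member_le_sum) auto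
      also have "\<dots> \<le> K * s \<xi>" unfolding K_def s_def by (rule sum_abs_gpath_le[OF finA finB])
      also have "\<dots> \<le> K * exp (s \<xi>)" using K s by (intro mult_left_mono) auto
      finally show "\<bar>F1 a (?X \<theta> \<xi>) * ?X' \<theta> \<xi> a\<bar> \<le> (C * exp (l * K * s \<xi>)) * (K * exp (s \<xi>))"
        unfolding abs_mult using C_nonneg
        by (intro mult_mono) (auto simp: K_def s_def intro!: growth_gpath[OF growth(2)[OF a]])
    qed
    also have "\<dots> = real (card A) * (C * K) * exp ((1 + l * K) * s \<xi>)"
      by (simp add: exp_add[symmetric] algebra_simps)
    finally have 1: "\<bar>\<Sum>a\<in>A. F1 a (?X \<theta> \<xi>) * ?X' \<theta> \<xi> a\<bar> \<le> real (card A) * (C * K) * exp ((1 + l * K) * s \<xi>)" .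
    have "\<bar>F (?X \<theta> \<xi>)\<bar> \<le> C * exp (l * K * s \<xi>)"
      unfolding K_def s_def by (rule growth_gpath[OF growth(1)])
    also have "\<dots> \<le> C * exp ((1 + l * K) * s \<xi>)"
      using s C_nonneg by (intro mult_left_mono) (auto simp: distrib_right)
    finally have F: "\<bar>F (?X \<theta> \<xi>)\<bar> \<le> C * exp ((1 + l * K) * s \<xi>)" .
    have "\<bar>sin \<theta>\<bar> * \<bar>cos \<theta>\<bar> \<le> 1 * 1" by (intro mult_mono) auto
    then have "\<bar>\<kappa> * (sin \<theta> * cos \<theta>) * F (?X \<theta> \<xi>)\<bar> \<le> \<bar>\<kappa>\<bar> * 1 * (C * exp ((1 + l * K) * s \<xi>))"
      unfolding abs_mult by (intro mult_mono F order_refl) auto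
    with 1 have "\<bar>(\<Sum>a\<in>A. F1 a (?X \<theta> \<xi>) * ?X' \<theta> \<xi> a) - \<kappa> * (sin \<theta> * cos \<theta>) * F (?X \<theta> \<xi>)\<bar>
        \<le> (real (card A) * (C * K) + \<bar>\<kappa>\<bar> * C) * exp ((1 + l * K) * s \<xi>)"
      by (simp add: distrib_right)
    then have "\<bar>D \<theta> \<xi>\<bar> \<le> exp (\<bar>\<kappa>\<bar> / 2) * ((real (card A) * (C * K) + \<bar>\<kappa>\<bar> * C) * exp ((1 + l * K) * s \<xi>))"
      unfolding D_def abs_mult[of "exp _"] using ek by (intro mult_mono) auto
    then show ?thesis by (simp add: C'_def mult.assoc)
  qed
  \<comment> \<open>Joint integrability for Fubini. The fundamental theorem of calculus is applied
    for each fixed \<open>\<xi>\<close> and the integrals are swapped, which replaces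
    differentiation under the expectation.\<close>
  have iD: "integrable (lborel \<Otimes>\<^sub>M gauss B) (\<lambda>(\<theta>, \<xi>). D \<theta> \<xi> * indicator {0..pi / 2} \<theta>)"
  proof (rule Bochner_Integration.integrable_bound)
    interpret pair_sigma_finite lborel "gauss B" ..
    have sm: "s \<in> borel_measurable (gauss B)" unfolding s_def[abs_def]
      by (intro borel_measurable_sum borel_measurable_abs borel_measurable_coord)
    have ie: "integrable (gauss B) (\<lambda>\<xi>. exp ((1 + l * K) * s \<xi>))"
      unfolding s_def by (rule integrable_exp_sum_abs[OF finB])
    show "integrable (lborel \<Otimes>\<^sub>M gauss B) (\<lambda>(\<theta>, \<xi>). (C' * indicator {0..pi / 2} \<theta>) * exp ((1 + l * K) * s \<xi>))"
    proof (rule Fubini_integrable)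
      show "(\<lambda>(\<theta>, \<xi>). C' * indicat_real {0..pi / 2} \<theta> * exp ((1 + l * K) * s \<xi>)) \<in> borel_measurable (lborel \<Otimes>\<^sub>M gauss B)"
        using sm by measurable
      have "integrable lborel (\<lambda>\<theta>. \<bar>C'\<bar> * indicat_real {0..pi / 2} \<theta> * (\<integral>\<xi>. exp ((1 + l * K) * s \<xi>) \<partial>gauss B))"
        by (intro integrable_mult_left integrable_mult_right) (simp add: integrable_indicator_iff)
      then show "integrable lborel (\<lambda>\<theta>. LINT \<xi>|gauss B. norm (case (\<theta>, \<xi>) of (\<theta>, \<xi>) \<Rightarrow> C' * indicat_real {0..pi / 2} \<theta> * exp ((1 + l * K) * s \<xi>)))"
        by (simp add: abs_mult)
      show "AE \<theta> in lborel. integrable (gauss B) (\<lambda>\<xi>. case (\<theta>, \<xi>) of (\<theta>, \<xi>) \<Rightarrow> C' * indicat_real {0..pi / 2} \<theta> * exp ((1 + l * K) * s \<xi>))"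
        using ie by (auto intro!: AE_I2)
    qed
    have F1m: "(\<lambda>x. F1 a (gpath B c d (fst x) (snd x))) \<in> borel_measurable (lborel \<Otimes>\<^sub>M gauss B)" if "a \<in> A" for a
      by (rule measurable_gpath_comp(2)[OF meas(2)[OF that], unfolded case_prod_beta])
    have Xm: "(\<lambda>x. gpath' B c d (fst x) (snd x) a) \<in> borel_measurable (lborel \<Otimes>\<^sub>M gauss B)" for a
      by (rule gpath_measurable_pair(2)[unfolded case_prod_beta])
    define S where "S x = (\<Sum>a\<in>A. F1 a (gpath B c d (fst x) (snd x)) * gpath' B c d (fst x) (snd x) a)" for x
    define Z where "Z x = F (gpath B c d (fst x) (snd x))" for x
    have SZ: "S \<in> borel_measurable (lborel \<Otimes>\<^sub>M gauss B)" "Z \<in> borel_measurable (lborel \<Otimes>\<^sub>M gauss B)"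
      unfolding S_def[abs_def] Z_def[abs_def]
      by (intro borel_measurable_sum borel_measurable_times F1m Xm)
        (assumption, rule measurable_gpath_comp(2)[OF meas(1), unfolded case_prod_beta])
    define u where "u \<theta> = exp (\<kappa> / 2 * (cos \<theta>)\<^sup>2) * indicat_real {0..pi / 2} \<theta>" for \<theta>
    define v where "v \<theta> = \<kappa> * (sin \<theta> * cos \<theta>)" for \<theta>
    have "u \<in> borel_measurable borel" "v \<in> borel_measurable borel"
      unfolding u_def[abs_def] v_def[abs_def]
      by (intro borel_measurable_times borel_measurable_indicator borel_measurable_continuous_onI continuous_intros; simp)+
    then have uv: "u \<in> borel_measurable lborel" "v \<in> borel_measurable lborel"
      by (simp_all only: measurable_lborel2)
    have "(\<lambda>x. u (fst x) * (S x - v (fst x) * Z x)) \<in> borel_measurable (lborel \<Otimes>\<^sub>M gauss B)"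
      by (rule borel_measurable_times[OF measurable_compose[OF measurable_fst uv(1)]
          borel_measurable_diff[OF SZ(1) borel_measurable_times[OF measurable_compose[OF measurable_fst uv(2)] SZ(2)]]])
    then show "(\<lambda>(\<theta>, \<xi>). D \<theta> \<xi> * indicator {0..pi / 2} \<theta>) \<in> borel_measurable (lborel \<Otimes>\<^sub>M gauss B)"
      unfolding D_def case_prod_beta S_def Z_def u_def v_def by (simp only: mult.assoc mult.commute mult.left_commute)
    show "AE x in lborel \<Otimes>\<^sub>M gauss B. norm (case x of (\<theta>, \<xi>) \<Rightarrow> D \<theta> \<xi> * indicator {0..pi / 2} \<theta>)
        \<le> norm (case x of (\<theta>, \<xi>) \<Rightarrow> (C' * indicator {0..pi / 2} \<theta>) * exp ((1 + l * K) * s \<xi>))"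
      using order_trans[OF bD abs_ge_self]
      by (intro AE_I2) (auto simp: indicator_def split: prod.splits)
  qed
  have ED: "(\<integral>\<xi>. D \<theta> \<xi> \<partial>gauss B) \<ge> 0" if "\<theta> \<in> {0..pi / 2}" for \<theta>
  proof -
    have iF1: "integrable (gauss B) (\<lambda>\<xi>. \<Sum>a\<in>A. F1 a (?X \<theta> \<xi>) * ?X' \<theta> \<xi> a)"
    proof -
      have "integrable (gauss B) (\<lambda>\<xi>. \<Sum>a\<in>A. \<Sum>b\<in>B. (cos \<theta> * d a b - sin \<theta> * c a b) * (\<xi> b * F1 a (?X \<theta> \<xi>)))"
        by (intro Bochner_Integration.integrable_sum integrable_mult_right integrable_coord_gpath)
      then show ?thesis by (simp add: gpath'_def sum_distrib_left mult_ac)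
    qed
    let ?G = "\<lambda>a a'. (\<Sum>b\<in>B. c a b * c a' b) - (\<Sum>b\<in>B. d a b * d a' b)"
    have "(\<integral>\<xi>. \<kappa> * F (?X \<theta> \<xi>) + (\<Sum>a\<in>A. \<Sum>a'\<in>A. ?G a a' * F2 a a' (?X \<theta> \<xi>)) \<partial>gauss B) \<le> 0"
      using sign by (rule integral_nonpos)
    also have "(\<integral>\<xi>. \<kappa> * F (?X \<theta> \<xi>) + (\<Sum>a\<in>A. \<Sum>a'\<in>A. ?G a a' * F2 a a' (?X \<theta> \<xi>)) \<partial>gauss B)
        = \<kappa> * (\<integral>\<xi>. F (?X \<theta> \<xi>) \<partial>gauss B) + (\<Sum>a\<in>A. \<Sum>a'\<in>A. ?G a a' * (\<integral>\<xi>. F2 a a' (?X \<theta> \<xi>) \<partial>gauss B))"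
      using integrable_gpath(3)[of _ _ \<theta>] integrable_gpath(1)[of \<theta>]
      by (simp add: Bochner_Integration.integral_sum integral_add)
    finally have "0 \<le> (sin \<theta> * cos \<theta>) * - (\<kappa> * (\<integral>\<xi>. F (?X \<theta> \<xi>) \<partial>gauss B) + (\<Sum>a\<in>A. \<Sum>a'\<in>A. ?G a a' * (\<integral>\<xi>. F2 a a' (?X \<theta> \<xi>) \<partial>gauss B)))"
      using that by (intro mult_nonneg_nonneg) (auto intro!: sin_ge_zero cos_ge_zero)
    also have "\<dots> = (\<integral>\<xi>. (\<Sum>a\<in>A. F1 a (?X \<theta> \<xi>) * ?X' \<theta> \<xi> a) \<partial>gauss B) - \<kappa> * (sin \<theta> * cos \<theta>) * (\<integral>\<xi>. F (?X \<theta> \<xi>) \<partial>gauss B)"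
    proof -
      define W where "W = (\<Sum>a\<in>A. \<Sum>a'\<in>A. ?G a a' * (\<integral>\<xi>. F2 a a' (?X \<theta> \<xi>) \<partial>gauss B))"
      have "(\<integral>\<xi>. (\<Sum>a\<in>A. F1 a (?X \<theta> \<xi>) * ?X' \<theta> \<xi> a) \<partial>gauss B) = - (sin \<theta> * cos \<theta>) * W"
        unfolding W_def using cross by (rule integral_gpath_deriv)
      then show ?thesis unfolding W_def[symmetric] by (simp add: algebra_simps)
    qed
    also have "\<dots> = (\<integral>\<xi>. (\<Sum>a\<in>A. F1 a (?X \<theta> \<xi>) * ?X' \<theta> \<xi> a) - \<kappa> * (sin \<theta> * cos \<theta>) * F (?X \<theta> \<xi>) \<partial>gauss B)"
      using iF1 integrable_gpath(1)[of \<theta>] by (subst Bochner_Integration.integral_diff) auto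
    finally show ?thesis unfolding D_def by simp
  qed
  have "(\<integral>\<xi>. H (pi / 2) \<xi> - H 0 \<xi> \<partial>gauss B) = (\<integral>\<xi>. (\<integral>\<theta>. D \<theta> \<xi> * indicator {0..pi / 2} \<theta> \<partial>lborel) \<partial>gauss B)"
    by (intro Bochner_Integration.integral_cong refl integral_FTC_Icc_real[symmetric] HD contD) auto
  also have "\<dots> = (\<integral>\<theta>. (\<integral>\<xi>. D \<theta> \<xi> * indicator {0..pi / 2} \<theta> \<partial>gauss B) \<partial>lborel)"
  proof -
    interpret pair_sigma_finite lborel "gauss B" ..
    show ?thesis by (rule Fubini_integral[OF iD])
  qed
  also have "\<dots> \<ge> 0"
  proof (rule Bochner_Integration.integral_nonneg)
    show "0 \<le> (\<integral>\<xi>. D \<theta> \<xi> * indicator {0..pi / 2} \<theta> \<partial>gauss B)" for \<theta>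
      using ED[of \<theta>] by (cases "\<theta> \<in> {0..pi / 2}") auto
  qed
  finally have "(\<integral>\<xi>. H 0 \<xi> \<partial>gauss B) \<le> (\<integral>\<xi>. H (pi / 2) \<xi> \<partial>gauss B)"
    using iH by (subst (asm) Bochner_Integration.integral_diff) auto
  then show ?thesis by (simp add: H_def gpath_def[abs_def])
qed

end

section \<open>A smooth substitute for the min-max functional\<close>

text \<open>With \<open>\<beta> \<rightarrow> \<infinity>\<close> and \<open>p = \<lambda> / \<beta>\<close>, \<open>softF\<close> is a smooth substitute for \<open>exp (- \<lambda> * (MIN i. MAX j. x (i, j)))\<close>.\<close>
definition softS :: "'j set \<Rightarrow> real \<Rightarrow> ('i \<times> 'j \<Rightarrow> real) \<Rightarrow> 'i \<Rightarrow> real" where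
  "softS J \<beta> x i = (\<Sum>j\<in>J. exp (\<beta> * x (i, j)))"

definition softU :: "'i set \<Rightarrow> 'j set \<Rightarrow> real \<Rightarrow> ('i \<times> 'j \<Rightarrow> real) \<Rightarrow> real" where
  "softU I J \<beta> x = (\<Sum>i\<in>I. 1 / softS J \<beta> x i)"

definition softF :: "'i set \<Rightarrow> 'j set \<Rightarrow> real \<Rightarrow> real \<Rightarrow> ('i \<times> 'j \<Rightarrow> real) \<Rightarrow> real" where
  "softF I J \<beta> p x = softU I J \<beta> x powr p"

text \<open>Softmax weights inside one row; for large \<open>\<beta>\<close> they concentrate on the
  maximising columns.\<close>

definition softP :: "'j set \<Rightarrow> real \<Rightarrow> ('i \<times> 'j \<Rightarrow> real) \<Rightarrow> 'i \<times> 'j \<Rightarrow> real" where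
  "softP J \<beta> x a = exp (\<beta> * x a) / softS J \<beta> x (fst a)"

text \<open>A probability weight on the whole array: rows are chosen in proportion to
  \<open>1 / softS\<close>, a soft minimum, and then a column by \<open>softP\<close>. The
  logarithmic gradient of \<open>softU\<close> is \<open>- \<beta>\<close> times this
  weight.\<close>

definition softW :: "'i set \<Rightarrow> 'j set \<Rightarrow> real \<Rightarrow> ('i \<times> 'j \<Rightarrow> real) \<Rightarrow> 'i \<times> 'j \<Rightarrow> real" where
  "softW I J \<beta> x a = softP J \<beta> x a / softS J \<beta> x (fst a) / softU I J \<beta> x"

definition softF1 :: "'i set \<Rightarrow> 'j set \<Rightarrow> real \<Rightarrow> real \<Rightarrow> 'i \<times> 'j \<Rightarrow> ('i \<times> 'j \<Rightarrow> real) \<Rightarrow> real" where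
  "softF1 I J \<beta> p a x = - (p * \<beta>) * softF I J \<beta> p x * softW I J \<beta> x a"

text \<open>The partial derivatives of \<open>softF1\<close>. Only the first summand links different
  rows, and for positive \<open>p\<close> and \<open>\<beta>\<close> its coefficient
  \<open>p * \<beta>\<^sup>2 * (p - 1)\<close> is nonpositive exactly when
  \<open>p \<le> 1\<close>.\<close>

definition softF2 :: "'i set \<Rightarrow> 'j set \<Rightarrow> real \<Rightarrow> real \<Rightarrow> 'i \<times> 'j \<Rightarrow> 'i \<times> 'j \<Rightarrow> ('i \<times> 'j \<Rightarrow> real) \<Rightarrow> real" where
  "softF2 I J \<beta> p a a' x = softF I J \<beta> p x * (((p * \<beta>)\<^sup>2 - p * \<beta>\<^sup>2) * (softW I J \<beta> x a * softW I J \<beta> x a')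
     - (if a' = a then p * \<beta>\<^sup>2 * softW I J \<beta> x a else 0)
     + (if fst a' = fst a then 2 * p * \<beta>\<^sup>2 * (softW I J \<beta> x a * softP J \<beta> x a') else 0))"

lemma sum_same_row:
  assumes "finite I" "finite J" "fst a \<in> I"
  shows "(\<Sum>a'\<in>I \<times> J. if fst a' = fst a then f a' else (0::real)) = (\<Sum>l\<in>J. f (fst a, l))"
proof -
  have "(\<Sum>a'\<in>I \<times> J. if fst a' = fst a then f a' else 0) = (\<Sum>i\<in>I. \<Sum>l\<in>J. if i = fst a then f (i, l) else 0)"
    unfolding sum.cartesian_product by (intro sum.cong) auto
  also have "\<dots> = (\<Sum>i\<in>I. if i = fst a then \<Sum>l\<in>J. f (i, l) else 0)"
    by (intro sum.cong refl) auto
  finally show ?thesis using assms by simp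
qed

lemma isCont_const_if: "isCont f t \<Longrightarrow> isCont (\<lambda>s. if b then f s else (0::real)) t"
  by (cases b) simp_all

lemma borel_measurable_const_if:
  "f \<in> borel_measurable M \<Longrightarrow> (\<lambda>x. if b then f x else (0::real)) \<in> borel_measurable M"
  by (cases b) simp_all

section \<open>Calculus of the smooth functional: weights, derivatives, growth, contraction of the
  Hessian\<close>

context
  fixes I :: "'i set" and J :: "'j set" and \<beta> p :: real
  assumes I: "finite I" "I \<noteq> {}" and J: "finite J" "J \<noteq> {}" and \<beta>: "\<beta> > 0" and p: "p > 0"
begin


lemma softS_pos: "softS J \<beta> (x :: 'i \<times> 'j \<Rightarrow> real) i > 0"
  unfolding softS_def using J by (intro sum_pos) auto

lemma softS_nz: "softS J \<beta> (x :: 'i \<times> 'j \<Rightarrow> real) i \<noteq> 0"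
  using softS_pos[of x i] by simp

lemma softU_pos: "softU I J \<beta> x > 0"
  unfolding softU_def using I by (intro sum_pos) (auto simp: softS_pos)

lemma softF_pos: "softF I J \<beta> p x > 0"
  unfolding softF_def using softU_pos[of x] by simp

lemma softP_nonneg: "0 \<le> softP J \<beta> (x :: 'i \<times> 'j \<Rightarrow> real) a"
  unfolding softP_def using softS_pos[of x] by (simp add: less_imp_le)

lemma softW_nonneg: "0 \<le> softW I J \<beta> x a"
  unfolding softW_def using softS_pos[of x] softU_pos[of x] softP_nonneg[of x a] by (simp add: less_imp_le)

lemma softP_sum: "(\<Sum>j\<in>J. softP J \<beta> (x :: 'i \<times> 'j \<Rightarrow> real) (i, j)) = 1"
  unfolding softP_def fst_conv sum_divide_distrib[symmetric] softS_def[symmetric]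
  using softS_pos[of x i] by simp

lemma softW_row_sum: "(\<Sum>j\<in>J. softW I J \<beta> x (i, j)) = 1 / softS J \<beta> x i / softU I J \<beta> x"
proof -
  have "(\<Sum>j\<in>J. softW I J \<beta> x (i, j)) = (\<Sum>j\<in>J. softP J \<beta> x (i, j)) / softS J \<beta> x i / softU I J \<beta> x"
    unfolding softW_def fst_conv sum_divide_distrib[symmetric] ..
  then show ?thesis by (simp add: softP_sum)
qed

lemma softW_sum: "(\<Sum>a\<in>I \<times> J. softW I J \<beta> x a) = 1"
proof -
  have "(\<Sum>a\<in>I \<times> J. softW I J \<beta> x a) = (\<Sum>i\<in>I. \<Sum>j\<in>J. softW I J \<beta> x (i, j))"
    by (simp add: sum.cartesian_product case_prod_beta)
  also have "\<dots> = softU I J \<beta> x / softU I J \<beta> x"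
    unfolding softW_row_sum sum_divide_distrib[symmetric] by (simp add: softU_def)
  finally show ?thesis using softU_pos[of x] by simp
qed

lemma softW_le_1: "a \<in> I \<times> J \<Longrightarrow> softW I J \<beta> x a \<le> 1"
  using member_le_sum[of a "I \<times> J" "softW I J \<beta> x"] I J softW_nonneg softW_sum[of x] by auto

lemma softP_le_1:
  fixes x :: "'i \<times> 'j \<Rightarrow> real"
  assumes "snd a \<in> J"
  shows "softP J \<beta> x a \<le> 1"
proof -
  have "softP J \<beta> x (fst a, snd a) \<le> (\<Sum>j\<in>J. softP J \<beta> x (fst a, j))"
    by (rule member_le_sum[OF assms softP_nonneg J(1)])
  then show ?thesis by (simp add: softP_sum)
qed

context
  fixes x :: "'i \<times> 'j \<Rightarrow> real \<Rightarrow> real" and x' t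
  assumes x: "\<And>a. a \<in> I \<times> J \<Longrightarrow> (x a has_real_derivative x' a) (at t)"
begin


lemma softS_deriv:
  assumes "i \<in> I"
  shows "((\<lambda>s. softS J \<beta> (\<lambda>a. x a s) i) has_real_derivative softS J \<beta> (\<lambda>a. x a t) i * (\<beta> * (\<Sum>l\<in>J. softP J \<beta> (\<lambda>a. x a t) (i, l) * x' (i, l)))) (at t)"
proof -
  have "((\<lambda>s. softS J \<beta> (\<lambda>a. x a s) i) has_real_derivative (\<Sum>l\<in>J. exp (\<beta> * x (i, l) t) * (\<beta> * x' (i, l)))) (at t)"
    unfolding softS_def using assms x
    by (intro DERIV_sum) (auto intro!: derivative_eq_intros)
  moreover have "(\<Sum>l\<in>J. exp (\<beta> * x (i, l) t) * (\<beta> * x' (i, l))) = softS J \<beta> (\<lambda>a. x a t) i * (\<beta> * (\<Sum>l\<in>J. softP J \<beta> (\<lambda>a. x a t) (i, l) * x' (i, l)))"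
    using softS_pos[of "\<lambda>a. x a t" i] by (simp add: softP_def sum_distrib_left mult_ac)
  ultimately show ?thesis by simp
qed

lemma softU_deriv:
  "((\<lambda>s. softU I J \<beta> (\<lambda>a. x a s)) has_real_derivative - \<beta> * softU I J \<beta> (\<lambda>a. x a t) * (\<Sum>a\<in>I \<times> J. softW I J \<beta> (\<lambda>a. x a t) a * x' a)) (at t)"
proof -
  have "((\<lambda>s. softU I J \<beta> (\<lambda>a. x a s)) has_real_derivative (\<Sum>i\<in>I. - (\<beta> * (\<Sum>l\<in>J. softP J \<beta> (\<lambda>a. x a t) (i, l) * x' (i, l))) / softS J \<beta> (\<lambda>a. x a t) i)) (at t)"
    unfolding softU_def
    by (intro DERIV_sum) (auto intro!: derivative_eq_intros softS_deriv simp: field_simps softS_nz)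
  moreover have "(\<Sum>i\<in>I. - (\<beta> * (\<Sum>l\<in>J. softP J \<beta> (\<lambda>a. x a t) (i, l) * x' (i, l))) / softS J \<beta> (\<lambda>a. x a t) i)
      = - \<beta> * (softU I J \<beta> (\<lambda>a. x a t) * (\<Sum>i\<in>I. \<Sum>l\<in>J. softW I J \<beta> (\<lambda>a. x a t) (i, l) * x' (i, l)))"
    using softU_pos[of "\<lambda>a. x a t"]
    by (simp add: softW_def sum_distrib_left sum_divide_distrib sum_negf mult_ac)
  ultimately show ?thesis by (simp add: sum.cartesian_product case_prod_beta mult.assoc)
qed

lemma softF_deriv:
  "((\<lambda>s. softF I J \<beta> p (\<lambda>a. x a s)) has_real_derivative - (p * \<beta>) * softF I J \<beta> p (\<lambda>a. x a t) * (\<Sum>a\<in>I \<times> J. softW I J \<beta> (\<lambda>a. x a t) a * x' a)) (at t)"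
proof -
  define R where "R = softU I J \<beta> (\<lambda>a. x a t) powr (p - of_nat 1)"
  define Q where "Q = (\<Sum>a\<in>I \<times> J. softW I J \<beta> (\<lambda>a. x a t) a * x' a)"
  have "((\<lambda>s. softU I J \<beta> (\<lambda>a. x a s) powr p) has_real_derivative p * R * (- \<beta> * softU I J \<beta> (\<lambda>a. x a t) * Q)) (at t)"
    unfolding R_def Q_def by (rule DERIV_fun_powr[OF softU_deriv softU_pos])
  moreover
  have "R * softU I J \<beta> (\<lambda>a. x a t) = softF I J \<beta> p (\<lambda>a. x a t)"
    using softU_pos[of "\<lambda>a. x a t"] by (simp add: powr_diff R_def softF_def)
  then have "p * R * (- \<beta> * softU I J \<beta> (\<lambda>a. x a t) * Q) = - (p * \<beta>) * softF I J \<beta> p (\<lambda>a. x a t) * Q"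
    by (simp add: mult_ac)
  ultimately have "((\<lambda>s. softU I J \<beta> (\<lambda>a. x a s) powr p) has_real_derivative - (p * \<beta>) * softF I J \<beta> p (\<lambda>a. x a t) * Q) (at t)"
    by (simp only:)
  then show ?thesis unfolding softF_def Q_def .
qed

text \<open>The weight is an exponential divided by the square of a row sum and by
  \<open>softU\<close>. The exponents 1, -2 and -1 of these factors give the three terms of its
  logarithmic derivative.\<close>

lemma softW_deriv:
  assumes a: "a \<in> I \<times> J"
  shows "((\<lambda>s. softW I J \<beta> (\<lambda>a. x a s) a) has_real_derivative
    \<beta> * softW I J \<beta> (\<lambda>a. x a t) a * (x' a - 2 * (\<Sum>l\<in>J. softP J \<beta> (\<lambda>a. x a t) (fst a, l) * x' (fst a, l)) + (\<Sum>a\<in>I \<times> J. softW I J \<beta> (\<lambda>a. x a t) a * x' a))) (at t)"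
proof -
  have ai: "fst a \<in> I" using a by auto
  define P where "P = (\<Sum>l\<in>J. softP J \<beta> (\<lambda>a. x a t) (fst a, l) * x' (fst a, l))"
  define Q where "Q = (\<Sum>a\<in>I \<times> J. softW I J \<beta> (\<lambda>a. x a t) a * x' a)"
  note dS = softS_deriv[OF ai, folded P_def] and dU = softU_deriv[folded Q_def]
  have [simp]: "softS J \<beta> (\<lambda>a. x a s) i \<noteq> 0" "softU I J \<beta> (\<lambda>a. x a s) \<noteq> 0" for s i
    using softS_pos[of "\<lambda>a. x a s" i] softU_pos[of "\<lambda>a. x a s"] by auto
  have "((\<lambda>s. exp (\<beta> * x a s) / softS J \<beta> (\<lambda>a. x a s) (fst a) / softS J \<beta> (\<lambda>a. x a s) (fst a) / softU I J \<beta> (\<lambda>a. x a s)) has_real_derivative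
    \<beta> * (exp (\<beta> * x a t) / softS J \<beta> (\<lambda>a. x a t) (fst a) / softS J \<beta> (\<lambda>a. x a t) (fst a) / softU I J \<beta> (\<lambda>a. x a t)) * (x' a - 2 * P + Q)) (at t)"
    by (rule derivative_eq_intros x[OF a] dS dU refl | simp)+ (simp add: field_simps)
  then show ?thesis by (simp add: softW_def softP_def P_def Q_def)
qed

end

lemma softF_chain: "chain_rule (I \<times> J) (softF I J \<beta> p) (softF1 I J \<beta> p)"
  unfolding chain_rule_def
proof (intro allI impI)
  fix x :: "'i \<times> 'j \<Rightarrow> real \<Rightarrow> real" and x' t
  assume "\<forall>a\<in>I \<times> J. (x a has_real_derivative x' a) (at t)"
  from softF_deriv[of x x' t] this
  show "((\<lambda>s. softF I J \<beta> p (\<lambda>a. x a s)) has_real_derivative (\<Sum>a\<in>I \<times> J. softF1 I J \<beta> p a (\<lambda>a. x a t) * x' a)) (at t)"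
    by (simp add: softF1_def sum_distrib_left sum_negf mult_ac)
qed

lemma softF1_chain:
  assumes a: "a \<in> I \<times> J"
  shows "chain_rule (I \<times> J) (softF1 I J \<beta> p a) (softF2 I J \<beta> p a)"
  unfolding chain_rule_def
proof (intro allI impI)
  fix x :: "'i \<times> 'j \<Rightarrow> real \<Rightarrow> real" and x' t
  assume x: "\<forall>a\<in>I \<times> J. (x a has_real_derivative x' a) (at t)"
  let ?y = "\<lambda>a. x a t"
  define P where "P = (\<Sum>l\<in>J. softP J \<beta> ?y (fst a, l) * x' (fst a, l))"
  define Q where "Q = (\<Sum>a\<in>I \<times> J. softW I J \<beta> ?y a * x' a)"
  have dF: "((\<lambda>s. softF I J \<beta> p (\<lambda>a. x a s)) has_real_derivative - (p * \<beta>) * softF I J \<beta> p ?y * Q) (at t)"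
    unfolding Q_def using x by (intro softF_deriv) auto
  have dW: "((\<lambda>s. softW I J \<beta> (\<lambda>a. x a s) a) has_real_derivative \<beta> * softW I J \<beta> ?y a * (x' a - 2 * P + Q)) (at t)"
    unfolding P_def Q_def using x by (intro softW_deriv a) auto
  have "((\<lambda>s. softF1 I J \<beta> p a (\<lambda>a. x a s)) has_real_derivative
      softF I J \<beta> p ?y * (((p * \<beta>)\<^sup>2 - p * \<beta>\<^sup>2) * (softW I J \<beta> ?y a * Q) - p * \<beta>\<^sup>2 * softW I J \<beta> ?y a * x' a + 2 * p * \<beta>\<^sup>2 * (softW I J \<beta> ?y a * P))) (at t)"
    unfolding softF1_def
    by (rule derivative_eq_intros dF dW refl | simp)+ (simp add: algebra_simps power2_eq_square)
  moreover have "(\<Sum>a'\<in>I \<times> J. softF2 I J \<beta> p a a' ?y * x' a')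
    = (\<Sum>a'\<in>I \<times> J. softF I J \<beta> p ?y * (((p * \<beta>)\<^sup>2 - p * \<beta>\<^sup>2) * (softW I J \<beta> ?y a * (softW I J \<beta> ?y a' * x' a'))
       - (if a' = a then p * \<beta>\<^sup>2 * softW I J \<beta> ?y a * x' a' else 0)
       + (if fst a' = fst a then 2 * p * \<beta>\<^sup>2 * (softW I J \<beta> ?y a * (softP J \<beta> ?y a' * x' a')) else 0)))"
    by (intro sum.cong refl) (auto simp: softF2_def algebra_simps)
  moreover have "\<dots> = softF I J \<beta> p ?y * (((p * \<beta>)\<^sup>2 - p * \<beta>\<^sup>2) * (softW I J \<beta> ?y a * Q) - p * \<beta>\<^sup>2 * softW I J \<beta> ?y a * x' a + 2 * p * \<beta>\<^sup>2 * (softW I J \<beta> ?y a * P))"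
  proof -
    have "(\<Sum>a'\<in>I \<times> J. if a' = a then p * \<beta>\<^sup>2 * softW I J \<beta> ?y a * x' a' else 0) = p * \<beta>\<^sup>2 * softW I J \<beta> ?y a * x' a"
      using a I J by (subst sum.delta) auto
    moreover have "(\<Sum>a'\<in>I \<times> J. if fst a' = fst a then 2 * p * \<beta>\<^sup>2 * (softW I J \<beta> ?y a * (softP J \<beta> ?y a' * x' a')) else 0)
        = 2 * p * \<beta>\<^sup>2 * (softW I J \<beta> ?y a * P)"
      using a I J by (subst sum_same_row) (auto simp: P_def sum_distrib_left)
    ultimately show ?thesis
      unfolding sum_distrib_left[symmetric] sum.distrib sum_subtractf Q_def by simp
  qed
  ultimately show "((\<lambda>s. softF1 I J \<beta> p a (\<lambda>a. x a s)) has_real_derivative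
      (\<Sum>a'\<in>I \<times> J. softF2 I J \<beta> p a a' ?y * x' a')) (at t)" by simp
qed

lemma soft_isCont:
  assumes x: "\<And>a. a \<in> I \<times> J \<Longrightarrow> isCont (x a) (t::real)" and a: "a \<in> I \<times> J"
  shows "isCont (\<lambda>s. softF I J \<beta> p (\<lambda>a. x a s)) t" "isCont (\<lambda>s. softW I J \<beta> (\<lambda>a. x a s) a) t" "isCont (\<lambda>s. softP J \<beta> (\<lambda>a. x a s) a) t"
proof -
  have S: "isCont (\<lambda>s. softS J \<beta> (\<lambda>a. x a s) i) t" if "i \<in> I" for i
    unfolding softS_def using that by (intro continuous_intros x) auto
  have nz: "softS J \<beta> y i \<noteq> 0" "softU I J \<beta> y \<noteq> 0" "softU I J \<beta> y > 0" for y i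
    using softS_pos[of y i] softU_pos[of y] by auto
  have U: "isCont (\<lambda>s. softU I J \<beta> (\<lambda>a. x a s)) t"
    unfolding softU_def by (intro continuous_intros S nz)
  show "isCont (\<lambda>s. softF I J \<beta> p (\<lambda>a. x a s)) t"
    unfolding softF_def using nz(3) U by (intro continuous_at_within_powr continuous_intros) (auto simp: less_imp_neq[symmetric])
  have ai: "fst a \<in> I" using a by auto
  show P: "isCont (\<lambda>s. softP J \<beta> (\<lambda>a. x a s) a) t"
    unfolding softP_def by (intro continuous_intros S[OF ai] nz x a)
  show "isCont (\<lambda>s. softW I J \<beta> (\<lambda>a. x a s) a) t"
    unfolding softW_def by (intro continuous_intros P S[OF ai] U nz)
qed

lemma softF2_continuous:
  assumes a: "a \<in> I \<times> J" "a' \<in> I \<times> J"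
  shows "continuous_along_curves (I \<times> J) (softF2 I J \<beta> p a a')"
  unfolding continuous_along_curves_def
proof (intro allI impI)
  fix x :: "'i \<times> 'j \<Rightarrow> real \<Rightarrow> real" and t assume "\<forall>a\<in>I \<times> J. isCont (x a) t"
  then have x: "\<And>a. a \<in> I \<times> J \<Longrightarrow> isCont (x a) t" by blast
  have c: "isCont (\<lambda>s. softF I J \<beta> p (\<lambda>a. x a s)) t" "isCont (\<lambda>s. softW I J \<beta> (\<lambda>a. x a s) a) t"
      "isCont (\<lambda>s. softW I J \<beta> (\<lambda>a. x a s) a') t" "isCont (\<lambda>s. softP J \<beta> (\<lambda>a. x a s) a') t"
    using x a by (blast intro: soft_isCont)+
  show "isCont (\<lambda>s. softF2 I J \<beta> p a a' (\<lambda>a. x a s)) t"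
    unfolding softF2_def
    by (intro isCont_mult isCont_add isCont_diff isCont_const_if continuous_const c)
qed

text \<open>A row sum is at least any one of its summands, which bounds its reciprocal by an
  exponential of the l1 norm.\<close>

lemma softF_growth:
  "softF I J \<beta> p x \<le> real (card I) powr p * exp (p * \<beta> * (\<Sum>a\<in>I \<times> J. \<bar>x a\<bar>))"
proof -
  let ?s = "\<Sum>a\<in>I \<times> J. \<bar>x a\<bar>"
  have "1 / softS J \<beta> x i \<le> exp (\<beta> * ?s)" if i: "i \<in> I" for i
  proof -
    obtain j where j: "j \<in> J" using J by auto
    have "\<bar>x (i, j)\<bar> \<le> ?s" using i j I J by (intro member_le_sum) auto
    then have "- (\<beta> * ?s) \<le> \<beta> * x (i, j)" using \<beta>
      by (metis abs_le_D2 minus_le_iff mult_le_cancel_left_pos mult_minus_right)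
    then have "exp (- (\<beta> * ?s)) \<le> exp (\<beta> * x (i, j))" by simp
    also have "\<dots> \<le> softS J \<beta> x i" unfolding softS_def using j J by (intro member_le_sum) auto
    finally show ?thesis using softS_pos[of x i]
      by (simp add: exp_minus field_simps)
  qed
  then have "softU I J \<beta> x \<le> (\<Sum>i\<in>I. exp (\<beta> * ?s))" unfolding softU_def by (intro sum_mono)
  then have "softF I J \<beta> p x \<le> (real (card I) * exp (\<beta> * ?s)) powr p"
    unfolding softF_def using softU_pos[of x] p by (intro powr_mono2) auto
  also have "\<dots> = real (card I) powr p * exp (p * \<beta> * ?s)"
    by (simp add: powr_mult exp_powr_real mult_ac)
  finally show ?thesis .
qed

text \<open>One constant for \<open>softF\<close> and its first and second derivatives: all weights
  lie in [0, 1], so the bracket dominates every polynomial in them that occurs.\<close>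

definition "softC \<equiv> real (card I) powr p * (1 + p * \<beta> + (p * \<beta>)\<^sup>2 + 4 * p * \<beta>\<^sup>2)"

lemma growth_scale:
  assumes "\<bar>z\<bar> \<le> softF I J \<beta> p x * q" "0 \<le> q" "q \<le> 1 + p * \<beta> + (p * \<beta>)\<^sup>2 + 4 * p * \<beta>\<^sup>2"
  shows "\<bar>z\<bar> \<le> softC * exp (p * \<beta> * (\<Sum>a\<in>I \<times> J. \<bar>x a\<bar>))"
proof -
  have "softF I J \<beta> p x * q \<le> (real (card I) powr p * exp (p * \<beta> * (\<Sum>a\<in>I \<times> J. \<bar>x a\<bar>))) * (1 + p * \<beta> + (p * \<beta>)\<^sup>2 + 4 * p * \<beta>\<^sup>2)"
    using assms softF_growth[of x] by (intro mult_mono) auto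
  with assms(1) show ?thesis unfolding softC_def by (simp add: mult_ac)
qed

lemma soft_exp_growth:
  "exp_growth (I \<times> J) softC (p * \<beta>) (softF I J \<beta> p)"
  "a \<in> I \<times> J \<Longrightarrow> exp_growth (I \<times> J) softC (p * \<beta>) (softF1 I J \<beta> p a)"
  "a \<in> I \<times> J \<Longrightarrow> a' \<in> I \<times> J \<Longrightarrow> exp_growth (I \<times> J) softC (p * \<beta>) (softF2 I J \<beta> p a a')"
proof -
  have F: "softF I J \<beta> p x \<ge> 0" for x using softF_pos[of x] by simp
  have pb: "p * \<beta> > 0" "p * \<beta>\<^sup>2 > 0" using p \<beta> by auto
  show "exp_growth (I \<times> J) softC (p * \<beta>) (softF I J \<beta> p)"
    unfolding exp_growth_def using pb F by (intro allI growth_scale[where q=1]) auto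
  show "exp_growth (I \<times> J) softC (p * \<beta>) (softF1 I J \<beta> p a)" if a: "a \<in> I \<times> J"
    unfolding exp_growth_def
  proof (intro allI growth_scale[where q="p * \<beta>"])
    fix x
    have "softF I J \<beta> p x * (p * \<beta>) * softW I J \<beta> x a \<le> softF I J \<beta> p x * (p * \<beta>) * 1"
      using pb F softW_le_1[OF a] by (intro mult_left_mono) auto
    then show "\<bar>softF1 I J \<beta> p a x\<bar> \<le> softF I J \<beta> p x * (p * \<beta>)"
      unfolding softF1_def using F[of x] softW_nonneg[of x a] p \<beta> by (simp add: abs_mult mult_ac)
  qed (use pb in auto)
  show "exp_growth (I \<times> J) softC (p * \<beta>) (softF2 I J \<beta> p a a')" if a: "a \<in> I \<times> J" "a' \<in> I \<times> J"
    unfolding exp_growth_def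
  proof (intro allI growth_scale[where q="(p * \<beta>)\<^sup>2 + 4 * p * \<beta>\<^sup>2"])
    fix x
    have w: "0 \<le> softW I J \<beta> x a" "softW I J \<beta> x a \<le> 1" and w': "0 \<le> softW I J \<beta> x a'" "softW I J \<beta> x a' \<le> 1" and \<pi>': "0 \<le> softP J \<beta> x a'" "softP J \<beta> x a' \<le> 1"
      using softW_nonneg softP_nonneg softW_le_1 softP_le_1 a by auto
    have ww: "0 \<le> softW I J \<beta> x a * softW I J \<beta> x a'" "softW I J \<beta> x a * softW I J \<beta> x a' \<le> 1" "0 \<le> softW I J \<beta> x a * softP J \<beta> x a'" "softW I J \<beta> x a * softP J \<beta> x a' \<le> 1"
      using w w' \<pi>' by (auto intro: mult_le_one)
    have "\<bar>((p * \<beta>)\<^sup>2 - p * \<beta>\<^sup>2) * (softW I J \<beta> x a * softW I J \<beta> x a')\<bar> \<le> ((p * \<beta>)\<^sup>2 + p * \<beta>\<^sup>2) * 1"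
      unfolding abs_mult using ww pb by (intro mult_mono) (auto simp: abs_if)
    moreover have "\<bar>if a' = a then p * \<beta>\<^sup>2 * softW I J \<beta> x a else 0\<bar> \<le> p * \<beta>\<^sup>2 * 1"
      using w pb mult_left_mono[of "softW I J \<beta> x a" 1 "p * \<beta>\<^sup>2"] by (auto simp: abs_mult)
    moreover have "\<bar>if fst a' = fst a then 2 * p * \<beta>\<^sup>2 * (softW I J \<beta> x a * softP J \<beta> x a') else 0\<bar> \<le> 2 * p * \<beta>\<^sup>2 * 1"
      using ww pb p mult_left_mono[of "softW I J \<beta> x a * softP J \<beta> x a'" 1 "2 * p * \<beta>\<^sup>2"] by (auto simp: abs_mult)
    ultimately have "\<bar>((p * \<beta>)\<^sup>2 - p * \<beta>\<^sup>2) * (softW I J \<beta> x a * softW I J \<beta> x a') - (if a' = a then p * \<beta>\<^sup>2 * softW I J \<beta> x a else 0)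
      + (if fst a' = fst a then 2 * p * \<beta>\<^sup>2 * (softW I J \<beta> x a * softP J \<beta> x a') else 0)\<bar>
      \<le> ((p * \<beta>)\<^sup>2 + p * \<beta>\<^sup>2) * 1 + p * \<beta>\<^sup>2 * 1 + 2 * p * \<beta>\<^sup>2 * 1"
      by (intro order_trans[OF abs_triangle_ineq] order_trans[OF abs_triangle_ineq4] add_mono)
    also have "\<dots> = (p * \<beta>)\<^sup>2 + 4 * p * \<beta>\<^sup>2" by simp
    finally have "\<bar>((p * \<beta>)\<^sup>2 - p * \<beta>\<^sup>2) * (softW I J \<beta> x a * softW I J \<beta> x a') - (if a' = a then p * \<beta>\<^sup>2 * softW I J \<beta> x a else 0)
      + (if fst a' = fst a then 2 * p * \<beta>\<^sup>2 * (softW I J \<beta> x a * softP J \<beta> x a') else 0)\<bar> \<le> (p * \<beta>)\<^sup>2 + 4 * p * \<beta>\<^sup>2" .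
    then show "\<bar>softF2 I J \<beta> p a a' x\<bar> \<le> softF I J \<beta> p x * ((p * \<beta>)\<^sup>2 + 4 * p * \<beta>\<^sup>2)"
      unfolding softF2_def abs_mult[of "softF I J \<beta> p x"] using F[of x] by (intro mult_mono) auto
  qed (use pb p in auto)
qed

lemma soft_measurable:
  "softF I J \<beta> p \<in> borel_measurable (PiM UNIV (\<lambda>_. borel))"
  "softF1 I J \<beta> p a \<in> borel_measurable (PiM UNIV (\<lambda>_. borel))"
  "softF2 I J \<beta> p a a' \<in> borel_measurable (PiM UNIV (\<lambda>_. borel))"
proof -
  have c: "(\<lambda>x. x a) \<in> borel_measurable (PiM UNIV (\<lambda>_. borel))" for a :: "'i \<times> 'j"
    by (rule measurable_component_singleton) simp
  have e: "(\<lambda>x. exp (\<beta> * x a)) \<in> borel_measurable (PiM UNIV (\<lambda>_. borel))" for a :: "'i \<times> 'j"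
    by (intro borel_measurable_exp[THEN measurable_compose[rotated]] borel_measurable_times borel_measurable_const c)
  have S: "(\<lambda>x :: 'i \<times> 'j \<Rightarrow> real. softS J \<beta> x i) \<in> borel_measurable (PiM UNIV (\<lambda>_. borel))" for i
    unfolding softS_def by (intro borel_measurable_sum e)
  have U: "(\<lambda>x. softU I J \<beta> x) \<in> borel_measurable (PiM UNIV (\<lambda>_. borel))"
    unfolding softU_def by (intro borel_measurable_sum borel_measurable_divide borel_measurable_const S)
  have F: "(\<lambda>x. softF I J \<beta> p x) \<in> borel_measurable (PiM UNIV (\<lambda>_. borel))"
    unfolding softF_def by (rule powr_real_measurable[OF U borel_measurable_const])
  then show "softF I J \<beta> p \<in> borel_measurable (PiM UNIV (\<lambda>_. borel))" .
  have P: "(\<lambda>x. softP J \<beta> x a) \<in> borel_measurable (PiM UNIV (\<lambda>_. borel))" for a :: "'i \<times> 'j"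
    unfolding softP_def by (intro borel_measurable_divide e S)
  have W: "(\<lambda>x. softW I J \<beta> x a) \<in> borel_measurable (PiM UNIV (\<lambda>_. borel))" for a
    unfolding softW_def by (intro borel_measurable_divide P S U)
  show "softF1 I J \<beta> p a \<in> borel_measurable (PiM UNIV (\<lambda>_. borel))"
    unfolding softF1_def[abs_def] by (intro borel_measurable_times borel_measurable_const F W)
  show "softF2 I J \<beta> p a a' \<in> borel_measurable (PiM UNIV (\<lambda>_. borel))"
    unfolding softF2_def[abs_def]
    by (intro borel_measurable_add borel_measurable_diff borel_measurable_times borel_measurable_const_if
        borel_measurable_const F W P)
qed

text \<open>The form in which the sign condition of the comparison is checked. The three sums
  average \<open>D\<close> over two independent entries, over one entry paired with itself, and over
  one entry paired with a fresh column of its own row.\<close>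

lemma softF2_quadratic_form:
  "(\<Sum>a\<in>I \<times> J. \<Sum>a'\<in>I \<times> J. D a a' * softF2 I J \<beta> p a a' x)
   = softF I J \<beta> p x * (((p * \<beta>)\<^sup>2 - p * \<beta>\<^sup>2) * (\<Sum>a\<in>I \<times> J. \<Sum>a'\<in>I \<times> J. D a a' * (softW I J \<beta> x a * softW I J \<beta> x a'))
      - p * \<beta>\<^sup>2 * (\<Sum>a\<in>I \<times> J. D a a * softW I J \<beta> x a)
      + 2 * p * \<beta>\<^sup>2 * (\<Sum>a\<in>I \<times> J. \<Sum>l\<in>J. D a (fst a, l) * (softW I J \<beta> x a * softP J \<beta> x (fst a, l))))"
proof -
  have "(\<Sum>a'\<in>I \<times> J. D a a' * softF2 I J \<beta> p a a' x)
      = softF I J \<beta> p x * (((p * \<beta>)\<^sup>2 - p * \<beta>\<^sup>2) * (\<Sum>a'\<in>I \<times> J. D a a' * (softW I J \<beta> x a * softW I J \<beta> x a')) - p * \<beta>\<^sup>2 * (D a a * softW I J \<beta> x a)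
        + 2 * p * \<beta>\<^sup>2 * (\<Sum>l\<in>J. D a (fst a, l) * (softW I J \<beta> x a * softP J \<beta> x (fst a, l))))" if a: "a \<in> I \<times> J" for a
  proof -
    have "(\<Sum>a'\<in>I \<times> J. D a a' * softF2 I J \<beta> p a a' x)
       = (\<Sum>a'\<in>I \<times> J. softF I J \<beta> p x * (((p * \<beta>)\<^sup>2 - p * \<beta>\<^sup>2) * (D a a' * (softW I J \<beta> x a * softW I J \<beta> x a'))
       - (if a' = a then p * \<beta>\<^sup>2 * (D a a' * softW I J \<beta> x a) else 0)
       + (if fst a' = fst a then 2 * p * \<beta>\<^sup>2 * (D a a' * (softW I J \<beta> x a * softP J \<beta> x a')) else 0)))"
      by (intro sum.cong refl) (auto simp: softF2_def algebra_simps)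
    moreover have "(\<Sum>a'\<in>I \<times> J. if a' = a then p * \<beta>\<^sup>2 * (D a a' * softW I J \<beta> x a) else 0) = p * \<beta>\<^sup>2 * (D a a * softW I J \<beta> x a)"
      using a I J by (subst sum.delta) auto
    moreover have "(\<Sum>a'\<in>I \<times> J. if fst a' = fst a then 2 * p * \<beta>\<^sup>2 * (D a a' * (softW I J \<beta> x a * softP J \<beta> x a')) else 0)
        = 2 * p * \<beta>\<^sup>2 * (\<Sum>l\<in>J. D a (fst a, l) * (softW I J \<beta> x a * softP J \<beta> x (fst a, l)))"
      using a I J by (subst sum_same_row) (auto simp: sum_distrib_left)
    ultimately show ?thesis
      unfolding sum_distrib_left[symmetric] sum.distrib sum_subtractf by simp
  qed
  then have "(\<Sum>a\<in>I \<times> J. \<Sum>a'\<in>I \<times> J. D a a' * softF2 I J \<beta> p a a' x)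
      = (\<Sum>a\<in>I \<times> J. softF I J \<beta> p x * (((p * \<beta>)\<^sup>2 - p * \<beta>\<^sup>2) * (\<Sum>a'\<in>I \<times> J. D a a' * (softW I J \<beta> x a * softW I J \<beta> x a')) - p * \<beta>\<^sup>2 * (D a a * softW I J \<beta> x a)
        + 2 * p * \<beta>\<^sup>2 * (\<Sum>l\<in>J. D a (fst a, l) * (softW I J \<beta> x a * softP J \<beta> x (fst a, l)))))"
    by (intro sum.cong refl)
  also have "\<dots> = softF I J \<beta> p x * (((p * \<beta>)\<^sup>2 - p * \<beta>\<^sup>2) * (\<Sum>a\<in>I \<times> J. \<Sum>a'\<in>I \<times> J. D a a' * (softW I J \<beta> x a * softW I J \<beta> x a'))
      - p * \<beta>\<^sup>2 * (\<Sum>a\<in>I \<times> J. D a a * softW I J \<beta> x a)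
      + 2 * p * \<beta>\<^sup>2 * (\<Sum>a\<in>I \<times> J. \<Sum>l\<in>J. D a (fst a, l) * (softW I J \<beta> x a * softP J \<beta> x (fst a, l))))"
    unfolding sum_distrib_left[symmetric] sum.distrib sum_subtractf by simp
  finally show ?thesis .
qed

lemmas soft_comparison = gaussian_comparison[OF finite_cartesian_product[OF I(1) J(1)] _ softF_chain softF1_chain
    softF2_continuous soft_exp_growth soft_measurable mult_nonneg_nonneg[OF less_imp_le[OF p] less_imp_le[OF \<beta>]]]

end

section \<open>Gordon's inequality and concentration, smooth form\<close>

text \<open>The compared processes live on one sum-type index set. This returns an expectation to
  the index set in which it is stated.\<close>

lemma gauss_reindex:
  fixes f :: "('a \<Rightarrow> real) \<Rightarrow> real"
  assumes r: "inj_on r I" "r ` I \<subseteq> B" and f: "f \<in> borel_measurable (gauss I)"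
  shows "(\<integral>\<xi>. f (\<lambda>i\<in>I. \<xi> (r i)) \<partial>gauss B) = (\<integral>\<xi>. f \<xi> \<partial>gauss I)"
    and "integrable (gauss B) (\<lambda>\<xi>. f (\<lambda>i\<in>I. \<xi> (r i))) \<longleftrightarrow> integrable (gauss I) f"
proof -
  have d: "distr (gauss B) (gauss I) (\<lambda>\<xi>. \<lambda>i\<in>I. \<xi> (r i)) = gauss I"
    using r by (intro distr_PiM_reindex prob_space_std_normal) auto
  have m: "(\<lambda>\<xi>. \<lambda>i\<in>I. \<xi> (r i)) \<in> gauss B \<rightarrow>\<^sub>M gauss I"
    using r by (intro measurable_restrict measurable_component_singleton) auto
  show "(\<integral>\<xi>. f (\<lambda>i\<in>I. \<xi> (r i)) \<partial>gauss B) = (\<integral>\<xi>. f \<xi> \<partial>gauss I)"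
    using integral_distr[OF m f] d by simp
  show "integrable (gauss B) (\<lambda>\<xi>. f (\<lambda>i\<in>I. \<xi> (r i))) \<longleftrightarrow> integrable (gauss I) f"
    using integrable_distr_eq[OF m f] d by simp
qed

text \<open>The disjoint ranges of \<open>r\<close> and \<open>s\<close> make the two factors
  independent, so Fubini splits the integral.\<close>

lemma gauss_product:
  fixes f :: "('a \<Rightarrow> real) \<Rightarrow> real" and g :: "('c \<Rightarrow> real) \<Rightarrow> real" and B :: "'b set"
  assumes r: "inj_on r I" "inj_on s J" "r ` I \<subseteq> B" "s ` J \<subseteq> B" "r ` I \<inter> s ` J = {}"
    and fin: "finite I" "finite J"
    and f: "f \<in> borel_measurable (gauss I)" and g: "g \<in> borel_measurable (gauss J)"
    and int: "integrable (gauss B) (\<lambda>\<xi>. f (\<lambda>i\<in>I. \<xi> (r i)) * g (\<lambda>i\<in>J. \<xi> (s i)))"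
  shows "(\<integral>\<xi>. f (\<lambda>i\<in>I. \<xi> (r i)) * g (\<lambda>i\<in>J. \<xi> (s i)) \<partial>gauss B)
    = (\<integral>\<xi>. f \<xi> \<partial>gauss I) * (\<integral>\<xi>. g \<xi> \<partial>gauss J)"
proof -
  let ?K = "r ` I" and ?L = "s ` J"
  define h where "h \<xi> = f (\<lambda>i\<in>I. \<xi> (r i)) * g (\<lambda>i\<in>J. \<xi> (s i))" for \<xi> :: "'b \<Rightarrow> real"
  have h: "h \<in> borel_measurable (gauss (?K \<union> ?L))"
    unfolding h_def
    by (intro borel_measurable_times measurable_compose[OF _ f] measurable_compose[OF _ g]
        measurable_restrict measurable_component_singleton) auto
  have hr: "h (\<lambda>i\<in>?K \<union> ?L. \<xi> i) = f (\<lambda>i\<in>I. \<xi> (r i)) * g (\<lambda>i\<in>J. \<xi> (s i))" for \<xi>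
    unfolding h_def by (intro arg_cong2[where f="(*)"] arg_cong[where f=f] arg_cong[where f=g]) (auto simp: restrict_def)
  note re = gauss_reindex[where r="\<lambda>i. i" and I="?K \<union> ?L" and B=B, OF _ _ h, unfolded hr]
  have ih: "integrable (gauss (?K \<union> ?L)) h"
    using re(2) int r by auto
  have hm: "h (merge ?K ?L (x, y)) = f (\<lambda>i\<in>I. x (r i)) * g (\<lambda>i\<in>J. y (s i))" for x y
  proof -
    have "s j \<notin> ?K" if "j \<in> J" for j using r(5) that by auto
    then have "(\<lambda>i\<in>I. merge ?K ?L (x, y) (r i)) = (\<lambda>i\<in>I. x (r i))" "(\<lambda>i\<in>J. merge ?K ?L (x, y) (s i)) = (\<lambda>i\<in>J. y (s i))"
      by (auto simp: restrict_def merge_def)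
    then show ?thesis unfolding h_def by simp
  qed
  have "(\<integral>\<xi>. f (\<lambda>i\<in>I. \<xi> (r i)) * g (\<lambda>i\<in>J. \<xi> (s i)) \<partial>gauss B) = (\<integral>\<xi>. h \<xi> \<partial>gauss (?K \<union> ?L))"
    using re(1) r by auto
  also have "\<dots> = (\<integral>x. (\<integral>y. h (merge ?K ?L (x, y)) \<partial>gauss ?L) \<partial>gauss ?K)"
    using fin by (intro product_sigma_finite.product_integral_fold[OF product_sigma_finite_std_normal r(5)] ih) auto
  also have "\<dots> = (\<integral>x. f (\<lambda>i\<in>I. x (r i)) \<partial>gauss ?K) * (\<integral>y. g (\<lambda>i\<in>J. y (s i)) \<partial>gauss ?L)"
    unfolding hm by simp
  also have "\<dots> = (\<integral>\<xi>. f \<xi> \<partial>gauss I) * (\<integral>\<xi>. g \<xi> \<partial>gauss J)"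
    using gauss_reindex(1)[OF r(1) order_refl f] gauss_reindex(1)[OF r(2) order_refl g] by simp
  finally show ?thesis .
qed

section \<open>Decoupled arrays: factorisation of the smooth functional\<close>

definition lin :: "nat \<Rightarrow> ('v \<Rightarrow> nat \<Rightarrow> real) \<Rightarrow> 'v \<Rightarrow> (nat \<Rightarrow> real) \<Rightarrow> real" where
  "lin n \<mu> v \<xi> = (\<Sum>k<n. \<mu> v k * \<xi> k)"

text \<open>A partition function: for finite nonempty \<open>V\<close>, its logarithm divided by
  \<open>\<beta>\<close> tends to the maximum of \<open>y\<close> over \<open>V\<close>.\<close>

definition expsum :: "'v set \<Rightarrow> real \<Rightarrow> ('v \<Rightarrow> real) \<Rightarrow> real" where
  "expsum V \<beta> y = (\<Sum>v\<in>V. exp (\<beta> * y v))"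

lemma expsum_pos: "finite V \<Longrightarrow> V \<noteq> {} \<Longrightarrow> expsum V \<beta> y > 0"
  unfolding expsum_def by (intro sum_pos) auto

lemma borel_measurable_lin: "(\<lambda>\<xi>. lin n \<mu> v \<xi>) \<in> borel_measurable (gauss {..<n})"
  unfolding lin_def by (intro borel_measurable_sum borel_measurable_times borel_measurable_const borel_measurable_coord)

lemma borel_measurable_expsum:
  "(\<lambda>\<xi>. expsum V \<beta> (\<lambda>v. lin n \<mu> v \<xi>)) \<in> borel_measurable (gauss {..<n})"
  unfolding expsum_def
  by (intro borel_measurable_sum measurable_compose[OF _ borel_measurable_exp] borel_measurable_times
      borel_measurable_const borel_measurable_lin)

lemma borel_measurable_expsum_powr:
  "(\<lambda>\<xi>. expsum V \<beta> (\<lambda>v. lin n \<mu> v \<xi>) powr r) \<in> borel_measurable (gauss {..<n})"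
  by (rule powr_real_measurable[OF borel_measurable_expsum borel_measurable_const])

text \<open>For entries \<open>y j - z i\<close> the min-max is the maximum of \<open>y\<close>
  minus the maximum of \<open>z\<close>. The following identities are the smooth version of this
  splitting; in particular the weights become products.\<close>

lemma softS_difference: "softS J \<beta> (\<lambda>(i, j). y j - z i) i = expsum J \<beta> y / exp (\<beta> * z i)"
  by (simp add: softS_def expsum_def right_diff_distrib exp_diff sum_divide_distrib)

lemma softU_difference: "softU I J \<beta> (\<lambda>(i, j). y j - z i) = expsum I \<beta> z / expsum J \<beta> y"
  unfolding softU_def softS_difference by (simp add: expsum_def[of I] sum_divide_distrib)

lemma softF_difference:
  assumes "finite J" "finite I"
  shows "softF I J \<beta> r (\<lambda>(i, j). y j - z i) = expsum I \<beta> z powr r * expsum J \<beta> y powr (- r)"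
proof -
  have "expsum I \<beta> z \<ge> 0" "expsum J \<beta> y \<ge> 0" unfolding expsum_def by (intro sum_nonneg; simp)+
  then show ?thesis
    unfolding softF_def softU_difference by (simp add: powr_divide powr_minus field_simps)
qed

lemma softP_difference: "softP J \<beta> (\<lambda>(i, j). y j - z i) (i, j) = exp (\<beta> * y j) / expsum J \<beta> y"
  unfolding softP_def fst_conv softS_difference by (simp add: right_diff_distrib exp_diff)

lemma softW_difference:
  "softW I J \<beta> (\<lambda>(i, j). y j - z i) (i, j) = exp (\<beta> * z i) / expsum I \<beta> z * (exp (\<beta> * y j) / expsum J \<beta> y)"
  if "finite J" "J \<noteq> {}"
  unfolding softW_def softP_difference softU_difference fst_conv softS_difference
  using expsum_pos[OF that, of \<beta> y] by (simp add: mult.commute)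

lemma softF_cong:
  "(\<And>i j. i \<in> I \<Longrightarrow> j \<in> J \<Longrightarrow> x (i, j) = x' (i, j)) \<Longrightarrow> softF I J \<beta> r x = softF I J \<beta> r x'"
  unfolding softF_def softU_def softS_def by simp

lemma integrable_softF:
  assumes "finite I" "I \<noteq> {}" "finite J" "J \<noteq> {}" "\<beta> > 0" "r > 0" "finite B"
  shows "integrable (gauss B) (\<lambda>\<xi>. softF I J \<beta> r (\<lambda>a. \<Sum>b\<in>B. c a b * \<xi> b))"
proof -
  note g = softF_chain[OF assms(1-6)] softF1_chain[OF assms(1-6)] softF2_continuous[OF assms(1-6)]
    soft_exp_growth[OF assms(1-6)] soft_measurable[OF assms(1-6)]
  have "integrable (gauss B) (\<lambda>\<xi>. softF I J \<beta> r (gpath B c c 0 \<xi>))"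
    by (rule integrable_gpath(1)[OF finite_cartesian_product[OF assms(1,3)] assms(7) g])
      (use assms in auto)
  then show ?thesis by (simp add: gpath_def[abs_def])
qed

text \<open>The form has covariance P Q and the decoupled process P + Q, with difference (1 - P) (1
  - Q) - 1. The product vanishes inside a row, where P = 1, and across rows it is nonnegative and
  meets a nonpositive second derivative. The constant -1 contributes exactly
  \<open>- (r * \<beta>)\<^sup>2\<close> times the functional, which fixes
  \<open>\<kappa> = (r * \<beta>)\<^sup>2\<close>.\<close>

lemma gordon_soft:
  fixes c :: "'i \<times> 'j \<Rightarrow> 'b \<Rightarrow> real"
  assumes I: "finite I" "I \<noteq> {}" and J: "finite J" "J \<noteq> {}" and \<beta>: "\<beta> > 0" and r: "0 < r" "r \<le> 1"
    and B: "finite B"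
    and \<mu>: "\<And>i. i \<in> I \<Longrightarrow> (\<Sum>k<n. \<mu> i k * \<mu> i k) = 1" and \<nu>: "\<And>j. j \<in> J \<Longrightarrow> (\<Sum>k<m. \<nu> j k * \<nu> j k) = 1"
    and c: "\<And>i j i' j'. i \<in> I \<Longrightarrow> j \<in> J \<Longrightarrow> i' \<in> I \<Longrightarrow> j' \<in> J \<Longrightarrow>
      (\<Sum>b\<in>B. c (i, j) b * c (i', j') b) = (\<Sum>k<n. \<mu> i k * \<mu> i' k) * (\<Sum>k<m. \<nu> j k * \<nu> j' k)"
  shows "exp ((r * \<beta>)\<^sup>2 / 2) * (\<integral>\<xi>. softF I J \<beta> r (\<lambda>a. \<Sum>b\<in>B. c a b * \<xi> b) \<partial>gauss B)
    \<le> (\<integral>\<xi>. expsum I \<beta> (\<lambda>i. lin n \<mu> i \<xi>) powr r \<partial>gauss {..<n})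
      * (\<integral>\<xi>. expsum J \<beta> (\<lambda>j. lin m \<nu> j \<xi>) powr (- r) \<partial>gauss {..<m})"
proof -
  \<comment> \<open>Separate coordinates for the form, for the vector in dimension n and for the
    vector in dimension m; this is what makes the mixed covariances vanish.\<close>
  define B' where "B' = B <+> ({..<n} <+> {..<m})"
  define c' where "c' a = case_sum (c a) (\<lambda>_::nat + nat. 0)" for a
  define d' where "d' a = case_sum (\<lambda>_::'b. 0) (case_sum (\<lambda>k. - \<mu> (fst a) k) (\<lambda>k. \<nu> (snd a) k))" for a
  have finB': "finite B'" unfolding B'_def using B by simp
  have sumB': "(\<Sum>b\<in>B'. h b) = (\<Sum>b\<in>B. h (Inl b)) + ((\<Sum>k<n. h (Inr (Inl k))) + (\<Sum>k<m. h (Inr (Inr k))))" for h :: "_ \<Rightarrow> real"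
    unfolding B'_def using B by (simp add: sum.Plus comp_def)
  let ?P = "\<lambda>i i'. \<Sum>k<n. \<mu> i k * \<mu> i' k" and ?Q = "\<lambda>j j'. \<Sum>k<m. \<nu> j k * \<nu> j' k"
  have P1: "?P i i' \<le> 1" if "i \<in> I" "i' \<in> I" for i i'
  proof -
    have "0 \<le> (\<Sum>k<n. (\<mu> i k - \<mu> i' k)\<^sup>2)" by (intro sum_nonneg) auto
    also have "\<dots> = ?P i i + ?P i' i' - 2 * ?P i i'"
      by (simp add: power2_eq_square algebra_simps sum.distrib sum_subtractf sum_distrib_left)
    finally show ?thesis using \<mu> that by simp
  qed
  have Q1: "?Q j j' \<le> 1" if "j \<in> J" "j' \<in> J" for j j'
  proof -
    have "0 \<le> (\<Sum>k<m. (\<nu> j k - \<nu> j' k)\<^sup>2)" by (intro sum_nonneg) auto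
    also have "\<dots> = ?Q j j + ?Q j' j' - 2 * ?Q j j'"
      by (simp add: power2_eq_square algebra_simps sum.distrib sum_subtractf sum_distrib_left)
    finally show ?thesis using \<nu> that by simp
  qed
  have G: "(\<Sum>b\<in>B'. c' a b * c' a' b) - (\<Sum>b\<in>B'. d' a b * d' a' b)
     = (1 - ?P (fst a) (fst a')) * (1 - ?Q (snd a) (snd a')) - 1" if "a \<in> I \<times> J" "a' \<in> I \<times> J" for a a'
    using that c[of "fst a" "snd a" "fst a'" "snd a'"]
    unfolding sumB' c'_def d'_def by (auto simp: algebra_simps)
  have "exp ((r * \<beta>)\<^sup>2 / 2) * (\<integral>\<xi>. softF I J \<beta> r (\<lambda>a. \<Sum>b\<in>B'. c' a b * \<xi> b) \<partial>gauss B')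
      \<le> (\<integral>\<xi>. softF I J \<beta> r (\<lambda>a. \<Sum>b\<in>B'. d' a b * \<xi> b) \<partial>gauss B')"
  proof (rule soft_comparison[OF I J \<beta> r(1) finB'])
    fix \<theta> \<xi>
    let ?x = "gpath B' c' d' \<theta> \<xi>"
    let ?D = "\<lambda>a a'. (1 - ?P (fst a) (fst a')) * (1 - ?Q (snd a) (snd a'))"
    have D0: "?D a a' = 0" if "fst a' = fst a" "a \<in> I \<times> J" for a a'
      using that \<mu> by auto
    have D: "?D a a' \<ge> 0" if "a \<in> I \<times> J" "a' \<in> I \<times> J" for a a'
      using that P1 Q1 by (intro mult_nonneg_nonneg) auto
    have "(\<Sum>a\<in>I \<times> J. \<Sum>a'\<in>I \<times> J. ((\<Sum>b\<in>B'. c' a b * c' a' b) - (\<Sum>b\<in>B'. d' a b * d' a' b)) * softF2 I J \<beta> r a a' ?x)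
      = (\<Sum>a\<in>I \<times> J. \<Sum>a'\<in>I \<times> J. ?D a a' * softF2 I J \<beta> r a a' ?x - 1 * softF2 I J \<beta> r a a' ?x)"
      using G by (intro sum.cong refl) (simp add: left_diff_distrib)
    also have "\<dots> = (\<Sum>a\<in>I \<times> J. \<Sum>a'\<in>I \<times> J. ?D a a' * softF2 I J \<beta> r a a' ?x)
        - (\<Sum>a\<in>I \<times> J. \<Sum>a'\<in>I \<times> J. 1 * softF2 I J \<beta> r a a' ?x)"
      by (simp add: sum_subtractf)
    also have "(\<Sum>a\<in>I \<times> J. \<Sum>a'\<in>I \<times> J. 1 * softF2 I J \<beta> r a a' ?x) = (r * \<beta>)\<^sup>2 * softF I J \<beta> r ?x"
    proof -
      have "(\<Sum>a\<in>I \<times> J. \<Sum>a'\<in>I \<times> J. softW I J \<beta> ?x a * softW I J \<beta> ?x a') = 1"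
        unfolding sum_distrib_left[symmetric] softW_sum[OF I J \<beta> r(1)] by (simp add: softW_sum[OF I J \<beta> r(1)])
      moreover have "(\<Sum>a\<in>I \<times> J. \<Sum>l\<in>J. softW I J \<beta> ?x a * softP J \<beta> ?x (fst a, l)) = 1"
        unfolding sum_distrib_left[symmetric] softP_sum[OF I J \<beta> r(1)] by (simp add: softW_sum[OF I J \<beta> r(1)])
      ultimately show ?thesis
        unfolding softF2_quadratic_form[OF I J \<beta> r(1), of "\<lambda>_ _. 1"]
        by (simp add: softW_sum[OF I J \<beta> r(1)] algebra_simps)
    qed
    also have "(\<Sum>a\<in>I \<times> J. \<Sum>a'\<in>I \<times> J. ?D a a' * softF2 I J \<beta> r a a' ?x) \<le> 0"
    proof (intro sum_nonpos)
      fix a a' assume a: "a \<in> I \<times> J" "a' \<in> I \<times> J"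
      show "?D a a' * softF2 I J \<beta> r a a' ?x \<le> 0"
      proof (cases "fst a' = fst a")
        case False
        \<comment> \<open>The hypothesis \<open>r \<le> 1\<close> enters here: across rows only this
          coefficient survives.\<close>
        have "(r * \<beta>)\<^sup>2 - r * \<beta>\<^sup>2 = r * \<beta>\<^sup>2 * (r - 1)" by (simp add: power2_eq_square algebra_simps)
        also have "\<dots> \<le> 0" using r \<beta> by (intro mult_nonneg_nonpos) auto
        finally have "(r * \<beta>)\<^sup>2 - r * \<beta>\<^sup>2 \<le> 0" .
        then have "softF2 I J \<beta> r a a' ?x \<le> 0"
        proof -
          assume n: "(r * \<beta>)\<^sup>2 - r * \<beta>\<^sup>2 \<le> 0"
          have "a' \<noteq> a" using False by auto
          then have "softF2 I J \<beta> r a a' ?x = softF I J \<beta> r ?x * (((r * \<beta>)\<^sup>2 - r * \<beta>\<^sup>2) * (softW I J \<beta> ?x a * softW I J \<beta> ?x a'))"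
            using False by (simp add: softF2_def)
          also have "\<dots> \<le> 0"
            by (intro mult_nonneg_nonpos mult_nonpos_nonneg mult_nonneg_nonneg n softW_nonneg[OF I J \<beta> r(1)]
                less_imp_le[OF softF_pos[OF I J \<beta> r(1)]])
          finally show ?thesis .
        qed
        then show ?thesis using D[OF a] by (intro mult_nonneg_nonpos)
      next
        case True
        have "?D a a' = 0" by (rule D0[OF True a(1)])
        then show ?thesis by (simp only: mult_zero_left order_refl)
      qed
    qed
    finally show "(r * \<beta>)\<^sup>2 * softF I J \<beta> r ?x + (\<Sum>a\<in>I \<times> J. \<Sum>a'\<in>I \<times> J.
        ((\<Sum>b\<in>B'. c' a b * c' a' b) - (\<Sum>b\<in>B'. d' a b * d' a' b)) * softF2 I J \<beta> r a a' ?x) \<le> 0"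
      by simp
  qed (auto simp: sumB' c'_def d'_def)
  moreover have "(\<integral>\<xi>. softF I J \<beta> r (\<lambda>a. \<Sum>b\<in>B'. c' a b * \<xi> b) \<partial>gauss B')
      = (\<integral>\<xi>. softF I J \<beta> r (\<lambda>a. \<Sum>b\<in>B. c a b * \<xi> b) \<partial>gauss B)"
  proof -
    have "softF I J \<beta> r (\<lambda>a. \<Sum>b\<in>B'. c' a b * \<xi> b) = softF I J \<beta> r (\<lambda>a. \<Sum>b\<in>B. c a b * (\<lambda>b\<in>B. \<xi> (Inl b)) b)" for \<xi>
      by (simp add: sumB' c'_def)
    then show ?thesis
      using gauss_reindex(1)[of Inl B B' "\<lambda>\<xi>. softF I J \<beta> r (\<lambda>a. \<Sum>b\<in>B. c a b * \<xi> b)"]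
        borel_measurable_integrable[OF integrable_softF[OF I J \<beta> r(1) B]]
      by (auto simp: B'_def)
  qed
  moreover have "(\<integral>\<xi>. softF I J \<beta> r (\<lambda>a. \<Sum>b\<in>B'. d' a b * \<xi> b) \<partial>gauss B')
      = (\<integral>\<xi>. expsum I \<beta> (\<lambda>i. lin n \<mu> i \<xi>) powr r \<partial>gauss {..<n})
      * (\<integral>\<xi>. expsum J \<beta> (\<lambda>j. lin m \<nu> j \<xi>) powr (- r) \<partial>gauss {..<m})"
  proof -
    have eq: "softF I J \<beta> r (\<lambda>a. \<Sum>b\<in>B'. d' a b * \<xi> b)
       = expsum I \<beta> (\<lambda>i. lin n \<mu> i (\<lambda>k\<in>{..<n}. \<xi> (Inr (Inl k)))) powr r
         * expsum J \<beta> (\<lambda>j. lin m \<nu> j (\<lambda>k\<in>{..<m}. \<xi> (Inr (Inr k)))) powr (- r)" for \<xi>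
      unfolding softF_difference[OF J(1) I(1), symmetric]
      by (rule softF_cong) (simp add: sumB' d'_def lin_def sum_negf)
    have int: "integrable (gauss B') (\<lambda>\<xi>. expsum I \<beta> (\<lambda>i. lin n \<mu> i (\<lambda>k\<in>{..<n}. \<xi> (Inr (Inl k)))) powr r
         * expsum J \<beta> (\<lambda>j. lin m \<nu> j (\<lambda>k\<in>{..<m}. \<xi> (Inr (Inr k)))) powr (- r))"
      using integrable_softF[OF I J \<beta> r(1) finB', of d'] unfolding eq .
    show ?thesis unfolding eq
      by (rule gauss_product[OF _ _ _ _ _ _ _ borel_measurable_expsum_powr borel_measurable_expsum_powr int])
        (auto simp: B'_def inj_on_def)
  qed
  ultimately show ?thesis by simp
qed

lemma sum_product_weights:
  fixes R P :: "'v \<Rightarrow> real"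
  assumes "(\<Sum>k\<in>V. R k) = 1" "(\<Sum>l\<in>V. P l) = 1"
  shows "(\<Sum>k\<in>V. \<Sum>l\<in>V. (f k + g l) * (c * (R k * P l))) = c * ((\<Sum>k\<in>V. R k * f k) + (\<Sum>l\<in>V. P l * g l))"
proof -
  have "(\<Sum>l\<in>V. (f k + g l) * (c * (R k * P l))) = c * (R k * f k) * (\<Sum>l\<in>V. P l) + R k * (c * (\<Sum>l\<in>V. P l * g l))" for k
    unfolding sum_distrib_left sum.distrib[symmetric] by (intro sum.cong refl) (simp add: algebra_simps)
  then have "(\<Sum>k\<in>V. \<Sum>l\<in>V. (f k + g l) * (c * (R k * P l)))
      = (\<Sum>k\<in>V. c * (R k * f k)) + (\<Sum>k\<in>V. R k) * (c * (\<Sum>l\<in>V. P l * g l))"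
    by (simp add: assms(2) sum.distrib sum_distrib_right[symmetric])
  then show ?thesis by (simp add: assms sum_distrib_left distrib_left)
qed

text \<open>Both processes are indexed by pairs of vectors: \<open><v', h> - <v, g>\<close> with
  independent g and h, and the same expression with g = h. The first gives the product of the two
  expectations, the second the constant 1. All three averages in
  \<open>softF2_quadratic_form\<close> equal 2 N for a mean inner product N of unit vectors, so the
  contraction is \<open>2 * (r * \<beta>)\<^sup>2 * N\<close> times the functional, and N at most 1
  allows \<open>\<kappa> = - 2 * (r * \<beta>)\<^sup>2\<close>.\<close>

lemma concentration_soft:
  assumes V: "finite V" "V \<noteq> {}" and \<beta>: "\<beta> > 0" and r: "0 < r"
    and \<mu>: "\<And>v. v \<in> V \<Longrightarrow> (\<Sum>k<n. \<mu> v k * \<mu> v k) = 1"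
  shows "(\<integral>\<xi>. expsum V \<beta> (\<lambda>v. lin n \<mu> v \<xi>) powr r \<partial>gauss {..<n})
      * (\<integral>\<xi>. expsum V \<beta> (\<lambda>v. lin n \<mu> v \<xi>) powr (- r) \<partial>gauss {..<n}) \<le> exp ((r * \<beta>)\<^sup>2)"
proof -
  define B where "B = {..<n} <+> ({..<n} <+> {..<n})"
  define c where "c a = case_sum (\<lambda>k. - \<mu> (fst a) k) (case_sum (\<lambda>k. \<mu> (snd a) k) (\<lambda>_::nat. 0))" for a
  define d where "d a = case_sum (\<lambda>_::nat. 0) (case_sum (\<lambda>_::nat. 0) (\<lambda>k. \<mu> (snd a) k - \<mu> (fst a) k))" for a
  have finB: "finite B" unfolding B_def by simp
  have sumB: "(\<Sum>b\<in>B. h b) = (\<Sum>k<n. h (Inl k)) + ((\<Sum>k<n. h (Inr (Inl k))) + (\<Sum>k<n. h (Inr (Inr k))))" for h :: "_ \<Rightarrow> real"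
    unfolding B_def by (simp add: sum.Plus comp_def)
  define M where "M v v' = (\<Sum>k<n. \<mu> v k * \<mu> v' k)" for v v'
  have Msym: "M v v' = M v' v" for v v' unfolding M_def by (simp add: mult.commute)
  have M1: "M v v' \<le> 1" if "v \<in> V" "v' \<in> V" for v v'
  proof -
    have "0 \<le> (\<Sum>k<n. (\<mu> v k - \<mu> v' k)\<^sup>2)" by (intro sum_nonneg) auto
    also have "\<dots> = M v v + M v' v' - 2 * M v v'"
      unfolding M_def by (simp add: power2_eq_square algebra_simps sum.distrib sum_subtractf sum_distrib_left)
    finally show ?thesis using \<mu> that unfolding M_def by simp
  qed
  define D where "D a a' = M (snd a) (fst a') + M (fst a) (snd a')" for a a' :: "'a \<times> 'a"
  have G: "(\<Sum>b\<in>B. c a b * c a' b) - (\<Sum>b\<in>B. d a b * d a' b) = D a a'" for a a'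
    unfolding sumB c_def d_def D_def M_def
    by (simp add: algebra_simps sum.distrib sum_subtractf sum_distrib_left)
  have "exp (- 2 * (r * \<beta>)\<^sup>2 / 2) * (\<integral>\<xi>. softF V V \<beta> r (\<lambda>a. \<Sum>b\<in>B. c a b * \<xi> b) \<partial>gauss B)
      \<le> (\<integral>\<xi>. softF V V \<beta> r (\<lambda>a. \<Sum>b\<in>B. d a b * \<xi> b) \<partial>gauss B)"
  proof (rule soft_comparison[OF V V \<beta> r finB])
    fix \<theta> \<xi>
    let ?x = "gpath B c d \<theta> \<xi>"
    define y where "y v = (\<Sum>k<n. (cos \<theta> * \<xi> (Inr (Inl k)) + sin \<theta> * \<xi> (Inr (Inr k))) * \<mu> v k)" for v
    define z where "z v = (\<Sum>k<n. (cos \<theta> * \<xi> (Inl k) + sin \<theta> * \<xi> (Inr (Inr k))) * \<mu> v k)" for v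
    \<comment> \<open>The array stays decoupled along the entire path, so the weights are products
      \<open>R i * P j\<close> at every angle.\<close>
    have x: "?x = (\<lambda>(i, j). y j - z i)"
    proof (rule ext)
      fix a :: "'a \<times> 'a"
      show "?x a = (case a of (i, j) \<Rightarrow> y j - z i)"
        unfolding gpath_def sumB c_def d_def y_def z_def
        by (cases a) (simp add: algebra_simps sum.distrib sum_subtractf sum_negf)
    qed
    define R where "R i = exp (\<beta> * z i) / expsum V \<beta> z" for i
    define P where "P j = exp (\<beta> * y j) / expsum V \<beta> y" for j
    have w: "softW V V \<beta> ?x (i, j) = R i * P j" for i j
      unfolding x softW_difference[OF V] R_def P_def ..
    have \<pi>: "softP V \<beta> ?x (i, j) = P j" for i j
      unfolding x softP_difference P_def ..
    have R: "(\<Sum>i\<in>V. R i) = 1" "\<And>i. R i \<ge> 0" and P: "(\<Sum>i\<in>V. P i) = 1" "\<And>i. P i \<ge> 0"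
      unfolding R_def P_def sum_divide_distrib[symmetric]
      using expsum_pos[OF V, of \<beta> y] expsum_pos[OF V, of \<beta> z] by (auto simp: expsum_def)
    \<comment> \<open>The mean inner product of two vectors drawn independently with weights
      \<open>R\<close> and \<open>P\<close>.\<close>
    define N where "N = (\<Sum>i\<in>V. \<Sum>j\<in>V. R i * P j * M i j)"
    have "N \<le> (\<Sum>i\<in>V. \<Sum>j\<in>V. R i * P j * 1)"
      unfolding N_def using R P M1 by (intro sum_mono mult_left_mono) auto
    also have "\<dots> = 1" using R P by (simp add: sum_distrib_left[symmetric])
    finally have N: "N \<le> 1" .
    have N': "(\<Sum>i\<in>V. R i * (\<Sum>l\<in>V. P l * M i l)) = N"
      unfolding N_def by (simp add: sum_distrib_left mult.assoc)
    have N'': "(\<Sum>j\<in>V. P j * (\<Sum>k\<in>V. R k * M j k)) = N"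
      unfolding N_def sum_distrib_left by (subst sum.swap) (simp add: mult_ac Msym)
    have s1: "(\<Sum>a\<in>V \<times> V. \<Sum>a'\<in>V \<times> V. D a a' * (softW V V \<beta> ?x a * softW V V \<beta> ?x a')) = 2 * N"
    proof -
      have "(\<Sum>a\<in>V \<times> V. \<Sum>a'\<in>V \<times> V. D a a' * (softW V V \<beta> ?x a * softW V V \<beta> ?x a'))
        = (\<Sum>i\<in>V. \<Sum>j\<in>V. \<Sum>k\<in>V. \<Sum>l\<in>V. (M j k + M i l) * (R i * P j * (R k * P l)))"
        unfolding sum.cartesian_product' w D_def by simp
      also have "\<dots> = (\<Sum>i\<in>V. \<Sum>j\<in>V. R i * P j * ((\<Sum>k\<in>V. R k * M j k) + (\<Sum>l\<in>V. P l * M i l)))"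
        unfolding sum_product_weights[OF R(1) P(1)] ..
      also have "\<dots> = (\<Sum>i\<in>V. \<Sum>j\<in>V. ((\<Sum>l\<in>V. P l * M i l) + (\<Sum>k\<in>V. R k * M j k)) * (1 * (R i * P j)))"
        by (intro sum.cong refl) (simp add: mult_ac add.commute)
      also have "\<dots> = 2 * N"
        unfolding sum_product_weights[OF R(1) P(1)] N' N'' by simp
      finally show ?thesis .
    qed
    have s2: "(\<Sum>a\<in>V \<times> V. D a a * softW V V \<beta> ?x a) = 2 * N"
      unfolding sum.cartesian_product' w D_def N_def sum_distrib_left fst_conv snd_conv
      by (intro sum.cong refl) (simp add: Msym algebra_simps)
    have s3: "(\<Sum>a\<in>V \<times> V. \<Sum>l\<in>V. D a (fst a, l) * (softW V V \<beta> ?x a * softP V \<beta> ?x (fst a, l))) = 2 * N"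
    proof -
      have "(\<Sum>l\<in>V. (M j i + M i l) * (R i * P j * P l)) = R i * P j * M i j + P j * (R i * (\<Sum>l\<in>V. P l * M i l))" for i j
      proof -
        have "(\<Sum>l\<in>V. (M j i + M i l) * (R i * P j * P l)) = R i * P j * M i j * (\<Sum>l\<in>V. P l) + P j * (R i * (\<Sum>l\<in>V. P l * M i l))"
          unfolding sum_distrib_left sum.distrib[symmetric] by (intro sum.cong refl) (simp add: Msym[of j i] algebra_simps)
        then show ?thesis by (simp add: P)
      qed
      then have "(\<Sum>a\<in>V \<times> V. \<Sum>l\<in>V. D a (fst a, l) * (softW V V \<beta> ?x a * softP V \<beta> ?x (fst a, l)))
        = (\<Sum>i\<in>V. \<Sum>j\<in>V. R i * P j * M i j + P j * (R i * (\<Sum>l\<in>V. P l * M i l)))"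
        unfolding sum.cartesian_product' fst_conv snd_conv w \<pi> D_def by simp
      also have "\<dots> = N + N"
        unfolding sum.distrib sum_distrib_right[symmetric] P(1) mult_1 N' N_def[symmetric] ..
      finally show ?thesis by simp
    qed
    have "- 2 * (r * \<beta>)\<^sup>2 * softF V V \<beta> r ?x + (\<Sum>a\<in>V \<times> V. \<Sum>a'\<in>V \<times> V. D a a' * softF2 V V \<beta> r a a' ?x)
      = 2 * (r * \<beta>)\<^sup>2 * softF V V \<beta> r ?x * (N - 1)"
      unfolding softF2_quadratic_form[OF V V \<beta> r] s1 s2 s3
      by (simp add: algebra_simps)
    also have "\<dots> \<le> 0" using N softF_pos[OF V V \<beta> r, of ?x] by (intro mult_nonneg_nonpos) auto
    finally show "- 2 * (r * \<beta>)\<^sup>2 * softF V V \<beta> r ?x + (\<Sum>a\<in>V \<times> V. \<Sum>a'\<in>V \<times> V.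
        ((\<Sum>b\<in>B. c a b * c a' b) - (\<Sum>b\<in>B. d a b * d a' b)) * softF2 V V \<beta> r a a' ?x) \<le> 0"
      unfolding G .
  qed (auto simp: sumB c_def d_def)
  moreover have "(\<integral>\<xi>. softF V V \<beta> r (\<lambda>a. \<Sum>b\<in>B. d a b * \<xi> b) \<partial>gauss B) = 1"
  proof -
    \<comment> \<open>With one shared copy, numerator and denominator in
      \<open>softU_difference\<close> coincide.\<close>
    have "softF V V \<beta> r (\<lambda>a. \<Sum>b\<in>B. d a b * \<xi> b) = 1" for \<xi>
    proof -
      let ?y = "\<lambda>v. \<Sum>k<n. \<mu> v k * \<xi> (Inr (Inr k))"
      have "softF V V \<beta> r (\<lambda>a. \<Sum>b\<in>B. d a b * \<xi> b) = softF V V \<beta> r (\<lambda>(i, j). ?y j - ?y i)"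
        by (rule softF_cong) (simp add: sumB d_def sum_subtractf left_diff_distrib)
      also have "\<dots> = 1"
        unfolding softF_def softU_difference using expsum_pos[OF V, of \<beta> ?y] by simp
      finally show ?thesis .
    qed
    then show ?thesis by (simp add: gauss.P.prob_space)
  qed
  moreover have "(\<integral>\<xi>. softF V V \<beta> r (\<lambda>a. \<Sum>b\<in>B. c a b * \<xi> b) \<partial>gauss B)
      = (\<integral>\<xi>. expsum V \<beta> (\<lambda>v. lin n \<mu> v \<xi>) powr r \<partial>gauss {..<n})
      * (\<integral>\<xi>. expsum V \<beta> (\<lambda>v. lin n \<mu> v \<xi>) powr (- r) \<partial>gauss {..<n})"
  proof -
    have eq: "softF V V \<beta> r (\<lambda>a. \<Sum>b\<in>B. c a b * \<xi> b)
       = expsum V \<beta> (\<lambda>i. lin n \<mu> i (\<lambda>k\<in>{..<n}. \<xi> (Inl k))) powr r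
         * expsum V \<beta> (\<lambda>j. lin n \<mu> j (\<lambda>k\<in>{..<n}. \<xi> (Inr (Inl k)))) powr (- r)" for \<xi>
      unfolding softF_difference[OF V(1) V(1), symmetric]
      by (rule softF_cong) (simp add: sumB c_def lin_def sum_negf)
    have int: "integrable (gauss B) (\<lambda>\<xi>. expsum V \<beta> (\<lambda>i. lin n \<mu> i (\<lambda>k\<in>{..<n}. \<xi> (Inl k))) powr r
         * expsum V \<beta> (\<lambda>j. lin n \<mu> j (\<lambda>k\<in>{..<n}. \<xi> (Inr (Inl k)))) powr (- r))"
      using integrable_softF[OF V V \<beta> r finB, of c] unfolding eq .
    show ?thesis unfolding eq
      by (rule gauss_product[OF _ _ _ _ _ _ _ borel_measurable_expsum_powr borel_measurable_expsum_powr int])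
        (auto simp: B_def inj_on_def)
  qed
  ultimately show ?thesis by (simp add: exp_minus field_simps)
qed

section \<open>Finite sets of unit vectors\<close>

definition ip :: "nat \<Rightarrow> (nat \<Rightarrow> real) \<Rightarrow> (nat \<Rightarrow> real) \<Rightarrow> real" where
  "ip n x y = (\<Sum>k<n. x k * y k)"

definition gmax :: "nat \<Rightarrow> (nat \<Rightarrow> real) set \<Rightarrow> (nat \<Rightarrow> real) \<Rightarrow> real" where
  "gmax n V x = Max ((\<lambda>v. ip n v x) ` V)"

lemma ip_self: "ip n x x = sqnorm n x"
  by (simp add: ip_def sqnorm_def power2_eq_square)

lemma sum_abs_le_exp: "(\<Sum>b\<in>B. \<bar>\<xi> b :: real\<bar>) \<le> exp (\<Sum>b\<in>B. \<bar>\<xi> b\<bar>)"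
  using exp_ge_add_one_self[of "\<Sum>b\<in>B. \<bar>\<xi> b\<bar>"] by linarith

section \<open>First and second moments of Gaussian linear forms\<close>

lemma abs_linear_form_le:
  assumes "finite B"
  shows "\<bar>\<Sum>b\<in>B. v b * \<xi> b\<bar> \<le> (\<Sum>b\<in>B. \<bar>v b\<bar>) * (\<Sum>b\<in>B. \<bar>\<xi> b :: real\<bar>)"
proof -
  have "\<bar>\<Sum>b\<in>B. v b * \<xi> b\<bar> \<le> (\<Sum>b\<in>B. \<bar>v b\<bar> * (\<Sum>b\<in>B. \<bar>\<xi> b\<bar>))"
    unfolding abs_mult[symmetric]
  proof (intro order_trans[OF sum_abs] sum_mono)
    fix b assume "b \<in> B"
    then have "\<bar>\<xi> b\<bar> \<le> (\<Sum>b\<in>B. \<bar>\<xi> b\<bar>)" using assms by (intro member_le_sum) auto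
    then show "\<bar>v b * \<xi> b\<bar> \<le> \<bar>v b\<bar> * (\<Sum>b\<in>B. \<bar>\<xi> b\<bar>)"
      unfolding abs_mult by (intro mult_left_mono) auto
  qed
  then show ?thesis by (simp add: sum_distrib_right)
qed

lemma linear_form_growth:
  assumes "finite B"
  shows "\<bar>\<Sum>b\<in>B. v b * \<xi> b\<bar> \<le> (\<Sum>b\<in>B. \<bar>v b\<bar>) * exp (1 * (\<Sum>b\<in>B. \<bar>\<xi> b :: real\<bar>))"
  using mult_left_mono[OF sum_abs_le_exp[of \<xi> B], of "\<Sum>b\<in>B. \<bar>v b\<bar>"]
    order_trans[OF abs_linear_form_le[OF assms, of v \<xi>]] by (simp add: sum_nonneg)

lemma borel_measurable_linear_form: "(\<lambda>\<xi>. \<Sum>b\<in>B. v b * \<xi> b) \<in> borel_measurable (gauss B)"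
  by (intro borel_measurable_sum borel_measurable_times borel_measurable_const borel_measurable_coord)

lemma integrable_linear_form:
  assumes "finite B"
  shows "integrable (gauss B) (\<lambda>\<xi>. \<Sum>b\<in>B. v b * \<xi> b)"
  by (rule integrable_exp_growth[OF assms borel_measurable_linear_form linear_form_growth[OF assms]])

lemma integrable_coord_linear_form:
  assumes "finite B" "b \<in> B"
  shows "integrable (gauss B) (\<lambda>\<xi>. \<xi> b * (\<Sum>b\<in>B. v b * \<xi> b))"
  by (rule integrable_exp_growth[OF assms(1) _ exp_growth_times_coord[OF assms linear_form_growth[OF assms(1)]]])
    (intro borel_measurable_times borel_measurable_coord assms borel_measurable_linear_form)

lemma gauss_coord_mean:
  assumes "finite B" "b \<in> B"
  shows "(\<integral>\<xi>. \<xi> b \<partial>gauss B) = 0"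
  using gauss_stein[OF assms, of "\<lambda>_. 1" "\<lambda>_. 0" 1 0] by simp

lemma gauss_linear_form_mean:
  assumes "finite B"
  shows "(\<integral>\<xi>. (\<Sum>b\<in>B. v b * \<xi> b) \<partial>gauss B) = 0"
proof -
  have "integrable (gauss B) (\<lambda>\<xi>. \<xi> b)" if "b \<in> B" for b
  proof -
    have "(\<Sum>b'\<in>B. (if b' = b then 1 else 0) * \<xi> b') = \<xi> b" for \<xi> :: "'a \<Rightarrow> real"
      using assms that by (simp add: if_distrib[of "\<lambda>z. z * _"] sum.delta cong: if_cong)
    then show ?thesis using integrable_linear_form[OF assms, of "\<lambda>b'. if b' = b then 1 else 0"] by simp
  qed
  then show ?thesis using assms gauss_coord_mean[OF assms]
    by (subst Bochner_Integration.integral_sum) auto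
qed

lemma gauss_coord_linear_form:
  fixes v :: "'b \<Rightarrow> real"
  assumes "finite B" "b \<in> B"
  shows "(\<integral>\<xi>. \<xi> b * (\<Sum>b\<in>B. v b * \<xi> b) \<partial>gauss B) = v b"
proof -
  have "(\<integral>\<xi>. \<xi> b * (\<Sum>b\<in>B. v b * \<xi> b) \<partial>gauss B) = (\<integral>\<xi>. v b \<partial>gauss B)"
  proof (rule gauss_stein[OF assms, where C="\<Sum>b\<in>B. \<bar>v b\<bar>" and c=1])
    fix \<xi> :: "'b \<Rightarrow> real" and t
    have "(\<Sum>b'\<in>B. v b' * (\<xi>(b := t)) b') = v b * t + (\<Sum>b'\<in>B - {b}. v b' * \<xi> b')" for t
      using assms by (subst sum.remove[of B b]) (auto intro!: sum.cong)
    then show "((\<lambda>t. \<Sum>b'\<in>B. v b' * (\<xi>(b := t)) b') has_real_derivative v b) (at t)"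
      by (auto intro!: derivative_eq_intros)
    show "\<bar>\<Sum>b\<in>B. v b * \<xi> b\<bar> \<le> (\<Sum>b\<in>B. \<bar>v b\<bar>) * exp (1 * (\<Sum>b\<in>B. \<bar>\<xi> b\<bar>))"
      by (rule linear_form_growth[OF assms(1)])
    have "\<bar>v b\<bar> \<le> (\<Sum>b\<in>B. \<bar>v b\<bar>) * 1" using assms member_le_sum[of b B "\<lambda>b. \<bar>v b\<bar>"] by simp
    also have "\<dots> \<le> (\<Sum>b\<in>B. \<bar>v b\<bar>) * exp (1 * (\<Sum>b\<in>B. \<bar>\<xi> b\<bar>))"
      by (intro mult_left_mono) (auto simp: sum_nonneg)
    finally show "\<bar>v b\<bar> \<le> (\<Sum>b\<in>B. \<bar>v b\<bar>) * exp (1 * (\<Sum>b\<in>B. \<bar>\<xi> b\<bar>))" .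
  qed (auto intro: borel_measurable_linear_form)
  then show ?thesis by (simp add: gauss.P.prob_space)
qed

lemma gauss_linear_form_square:
  assumes "finite B"
  shows "integrable (gauss B) (\<lambda>\<xi>. (\<Sum>b\<in>B. v b * \<xi> b)\<^sup>2)"
    and "(\<integral>\<xi>. (\<Sum>b\<in>B. v b * \<xi> b)\<^sup>2 \<partial>gauss B) = (\<Sum>b\<in>B. (v b)\<^sup>2)"
proof -
  have eq: "(\<Sum>b\<in>B. v b * \<xi> b)\<^sup>2 = (\<Sum>b\<in>B. v b * (\<xi> b * (\<Sum>b\<in>B. v b * \<xi> b)))" for \<xi>
    by (simp add: power2_eq_square sum_distrib_right mult.assoc)
  show "integrable (gauss B) (\<lambda>\<xi>. (\<Sum>b\<in>B. v b * \<xi> b)\<^sup>2)"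
    unfolding eq by (intro Bochner_Integration.integrable_sum integrable_mult_right integrable_coord_linear_form assms)
  show "(\<integral>\<xi>. (\<Sum>b\<in>B. v b * \<xi> b)\<^sup>2 \<partial>gauss B) = (\<Sum>b\<in>B. (v b)\<^sup>2)"
    unfolding eq using integrable_coord_linear_form[OF assms] gauss_coord_linear_form[OF assms]
    by (subst Bochner_Integration.integral_sum) (auto simp: power2_eq_square)
qed

lemma gauss_coord_square:
  assumes "finite B" "b \<in> B"
  shows "integrable (gauss B) (\<lambda>\<xi>. (\<xi> b)\<^sup>2)" and "(\<integral>\<xi>. (\<xi> b)\<^sup>2 \<partial>gauss B) = 1"
proof -
  let ?v = "\<lambda>b'. if b' = b then 1 else (0::real)"
  have eq: "(\<Sum>b'\<in>B. ?v b' * \<xi> b') = \<xi> b" for \<xi> :: "'a \<Rightarrow> real"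
    using assms by (simp add: if_distrib[of "\<lambda>z. z * _"] sum.delta cong: if_cong)
  have "(\<Sum>b'\<in>B. (?v b')\<^sup>2) = 1"
    using assms by (simp add: if_distrib[of "\<lambda>z. z\<^sup>2"] sum.delta cong: if_cong)
  then show "integrable (gauss B) (\<lambda>\<xi>. (\<xi> b)\<^sup>2)" "(\<integral>\<xi>. (\<xi> b)\<^sup>2 \<partial>gauss B) = 1"
    using gauss_linear_form_square[OF assms(1), of ?v] unfolding eq by auto
qed

lemma gauss_sum_squares:
  assumes "finite B"
  shows "integrable (gauss B) (\<lambda>\<xi>. \<Sum>b\<in>B. (\<xi> b)\<^sup>2)"
    and "(\<integral>\<xi>. (\<Sum>b\<in>B. (\<xi> b)\<^sup>2) \<partial>gauss B) = real (card B)"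
  using gauss_coord_square[OF assms]
  by (auto simp: Bochner_Integration.integral_sum)

text \<open>Turns the exponential moments at 1 and -1 into a variance bound in
  \<open>gmax_variance\<close>. For y nonnegative, \<open>exp y\<close> is bounded below to second
  order and \<open>exp (- y)\<close> to first order; the right-hand side is even.\<close>

lemma square_le_exp: "y\<^sup>2 \<le> 2 * (exp y + exp (- y) - 2)" for y :: real
proof -
  have *: "z\<^sup>2 \<le> 2 * (exp z + exp (- z) - 2)" if "z \<ge> 0" for z :: real
    using exp_lower_Taylor_quadratic[OF that] exp_ge_add_one_self[of "- z"] by argo
  show ?thesis using *[of y] *[of "- y"] by (cases "y \<ge> 0") (auto simp: add.commute)
qed

text \<open>Jensen's inequality, from the tangent of exp at the mean.\<close>

lemma (in prob_space) exp_expectation_le: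
  assumes "integrable M X" "integrable M (\<lambda>x. exp (X x :: real))"
  shows "exp (expectation X) \<le> expectation (\<lambda>x. exp (X x))"
proof -
  let ?a = "expectation X"
  have "expectation (\<lambda>x. exp ?a * (1 + (X x - ?a))) \<le> expectation (\<lambda>x. exp (X x))"
  proof (rule integral_mono[OF _ assms(2)])
    show "integrable M (\<lambda>x. exp ?a * (1 + (X x - ?a)))" using assms by auto
    show "exp ?a * (1 + (X x - ?a)) \<le> exp (X x)" for x
      using mult_left_mono[OF exp_ge_add_one_self[of "X x - ?a"], of "exp ?a"]
      by (simp add: exp_diff)
  qed
  moreover have "expectation (\<lambda>x. exp ?a * (1 + (X x - ?a))) = exp ?a"
    using assms by (simp add: prob_space)
  ultimately show ?thesis by simp
qed

text \<open>Removes the cardinality factors lost when maxima are replaced by exponential sums: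
  \<open>r = 1 / real (Suc N)\<close> tends to 0 while \<open>r * \<beta>\<close> is kept
  fixed.\<close>

lemma powr_inverse_tendsto_1:
  assumes "x > 0"
  shows "(\<lambda>N. x powr (1 / real (Suc N))) \<longlonglongrightarrow> 1"
proof -
  have "(\<lambda>N. x powr (1 / real (Suc N))) \<longlonglongrightarrow> x powr 0"
    using assms by (intro tendsto_powr tendsto_const LIMSEQ_Suc[OF lim_1_over_n]) auto
  then show ?thesis using assms by simp
qed

section \<open>The maximum of finitely many Gaussian forms: concentration, variance, mean\<close>

context
  fixes n :: nat and V :: "(nat \<Rightarrow> real) set"
  assumes V: "finite V" "V \<noteq> {}" and unit: "\<And>v. v \<in> V \<Longrightarrow> sqnorm n v = 1"
begin

lemma gmax_ge: "v \<in> V \<Longrightarrow> ip n v x \<le> gmax n V x"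
  unfolding gmax_def using V by (intro Max_ge) auto

lemma gmax_attained: "\<exists>v\<in>V. gmax n V x = ip n v x"
proof -
  have "gmax n V x \<in> (\<lambda>v. ip n v x) ` V" unfolding gmax_def using V by (intro Max_in) auto
  then show ?thesis by auto
qed

lemma borel_measurable_gmax: "gmax n V \<in> borel_measurable (gauss {..<n})"
  unfolding gmax_def[abs_def] ip_def
  using V by (induction rule: finite_ne_induct)
    (auto intro!: borel_measurable_linear_form borel_measurable_max)

lemma abs_gmax_le: "\<bar>gmax n V x\<bar> \<le> (\<Sum>k<n. \<bar>x k\<bar>)"
proof -
  obtain v where v: "v \<in> V" "gmax n V x = ip n v x" using gmax_attained by blast
  have "\<bar>v k\<bar> \<le> 1" if "k < n" for k
  proof -
    have "(v k)\<^sup>2 \<le> sqnorm n v" unfolding sqnorm_def using that by (intro member_le_sum) auto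
    then show ?thesis using unit[OF v(1)] by (simp add: abs_square_le_1)
  qed
  then have "\<bar>ip n v x\<bar> \<le> (\<Sum>k<n. 1 * \<bar>x k\<bar>)"
    unfolding ip_def by (intro order_trans[OF sum_abs] sum_mono, unfold abs_mult) (intro mult_right_mono; simp)
  then show ?thesis using v by simp
qed

lemma integrable_exp_gmax: "integrable (gauss {..<n}) (\<lambda>\<xi>. exp (l * gmax n V \<xi>))"
proof (rule integrable_exp_growth)
  show "(\<lambda>\<xi>. exp (l * gmax n V \<xi>)) \<in> borel_measurable (gauss {..<n})"
    by (intro measurable_compose[OF _ borel_measurable_exp] borel_measurable_times borel_measurable_const borel_measurable_gmax)
  fix \<xi>
  have "l * gmax n V \<xi> \<le> \<bar>l\<bar> * \<bar>gmax n V \<xi>\<bar>" by (simp add: abs_mult[symmetric])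
  also have "\<dots> \<le> \<bar>l\<bar> * (\<Sum>k<n. \<bar>\<xi> k\<bar>)" by (intro mult_left_mono abs_gmax_le) auto
  finally show "\<bar>exp (l * gmax n V \<xi>)\<bar> \<le> 1 * exp (\<bar>l\<bar> * (\<Sum>k<n. \<bar>\<xi> k\<bar>))" by simp
qed simp

lemma integrable_gmax: "integrable (gauss {..<n}) (gmax n V)"
proof (rule integrable_exp_growth[OF _ borel_measurable_gmax])
  show "\<bar>gmax n V \<xi>\<bar> \<le> 1 * exp (1 * (\<Sum>k<n. \<bar>\<xi> k\<bar>))" for \<xi>
    using order_trans[OF abs_gmax_le sum_abs_le_exp] by simp
qed simp

lemma integrable_gmax_square: "integrable (gauss {..<n}) (\<lambda>\<xi>. (gmax n V \<xi> - a)\<^sup>2)"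
proof (rule Bochner_Integration.integrable_bound)
  show "integrable (gauss {..<n}) (\<lambda>\<xi>. 2 * (exp (1 * gmax n V \<xi>) * exp (- a) + exp ((- 1) * gmax n V \<xi>) * exp a))"
    by (intro integrable_mult_right Bochner_Integration.integrable_add integrable_mult_left integrable_exp_gmax)
  show "(\<lambda>\<xi>. (gmax n V \<xi> - a)\<^sup>2) \<in> borel_measurable (gauss {..<n})"
    by (intro borel_measurable_power borel_measurable_diff borel_measurable_gmax borel_measurable_const)
  have "(gmax n V \<xi> - a)\<^sup>2 \<le> 2 * (exp (1 * gmax n V \<xi>) * exp (- a) + exp ((- 1) * gmax n V \<xi>) * exp a)" for \<xi>
    using square_le_exp[of "gmax n V \<xi> - a"] by (simp add: exp_add[symmetric])
  then show "AE \<xi> in gauss {..<n}. norm ((gmax n V \<xi> - a)\<^sup>2)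
      \<le> norm (2 * (exp (1 * gmax n V \<xi>) * exp (- a) + exp ((- 1) * gmax n V \<xi>) * exp a))"
    by (intro AE_I2) (simp add: order_trans[OF _ abs_ge_self])
qed

text \<open>The maximum dominates a single form, which has mean 0. The sign is used in
  \<open>gmax_mean_close\<close> to multiply an inequality by this mean.\<close>

lemma gmax_mean_nonneg: "0 \<le> (\<integral>\<xi>. gmax n V \<xi> \<partial>gauss {..<n})"
proof -
  obtain v where v: "v \<in> V" using V by auto
  have "0 = (\<integral>\<xi>. ip n v \<xi> \<partial>gauss {..<n})"
    unfolding ip_def using gauss_linear_form_mean[of "{..<n}" v] by simp
  also have "\<dots> \<le> (\<integral>\<xi>. gmax n V \<xi> \<partial>gauss {..<n})"
    using gmax_ge[OF v] integrable_linear_form[of "{..<n}" v] unfolding ip_def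
    by (intro integral_mono integrable_gmax) auto
  finally show ?thesis .
qed

lemma lin_id: "lin n (\<lambda>v. v) v \<xi> = ip n v \<xi>"
  by (simp add: lin_def ip_def)

lemma expsum_bounds:
  assumes "\<beta> > 0"
  shows "exp (\<beta> * gmax n V \<xi>) \<le> expsum V \<beta> (\<lambda>v. lin n (\<lambda>v. v) v \<xi>)"
    and "expsum V \<beta> (\<lambda>v. lin n (\<lambda>v. v) v \<xi>) \<le> real (card V) * exp (\<beta> * gmax n V \<xi>)"
proof -
  obtain v where v: "v \<in> V" "gmax n V \<xi> = ip n v \<xi>" using gmax_attained by blast
  show "exp (\<beta> * gmax n V \<xi>) \<le> expsum V \<beta> (\<lambda>v. lin n (\<lambda>v. v) v \<xi>)"
    unfolding expsum_def lin_id v(2) using v V by (intro member_le_sum[of v V "\<lambda>v. exp (\<beta> * ip n v \<xi>)"]) auto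
  have "expsum V \<beta> (\<lambda>v. lin n (\<lambda>v. v) v \<xi>) \<le> (\<Sum>v\<in>V. exp (\<beta> * gmax n V \<xi>))"
    unfolding expsum_def lin_id using assms gmax_ge by (intro sum_mono) auto
  then show "expsum V \<beta> (\<lambda>v. lin n (\<lambda>v. v) v \<xi>) \<le> real (card V) * exp (\<beta> * gmax n V \<xi>)" by simp
qed

lemma expsum_powr_bounds:
  assumes "\<beta> > 0" "r > 0"
  shows "exp ((r * \<beta>) * gmax n V \<xi>) \<le> expsum V \<beta> (\<lambda>v. lin n (\<lambda>v. v) v \<xi>) powr r"
    and "expsum V \<beta> (\<lambda>v. lin n (\<lambda>v. v) v \<xi>) powr r \<le> real (card V) powr r * exp ((r * \<beta>) * gmax n V \<xi>)"
    and "expsum V \<beta> (\<lambda>v. lin n (\<lambda>v. v) v \<xi>) powr (- r) \<le> exp (- (r * \<beta>) * gmax n V \<xi>)"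
    and "exp (- (r * \<beta>) * gmax n V \<xi>) \<le> real (card V) powr r * expsum V \<beta> (\<lambda>v. lin n (\<lambda>v. v) v \<xi>) powr (- r)"
proof -
  let ?E = "expsum V \<beta> (\<lambda>v. lin n (\<lambda>v. v) v \<xi>)"
  have pos: "?E > 0" by (rule expsum_pos[OF V])
  have e: "exp (\<beta> * gmax n V \<xi>) powr r = exp ((r * \<beta>) * gmax n V \<xi>)"
    by (simp add: exp_powr_real mult_ac)
  show 1: "exp ((r * \<beta>) * gmax n V \<xi>) \<le> ?E powr r"
    unfolding e[symmetric] using assms expsum_bounds(1) by (intro powr_mono2) auto
  have "?E powr r \<le> (real (card V) * exp (\<beta> * gmax n V \<xi>)) powr r"
    using assms expsum_bounds(2) pos by (intro powr_mono2) auto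
  then show 2: "?E powr r \<le> real (card V) powr r * exp ((r * \<beta>) * gmax n V \<xi>)"
    by (simp add: powr_mult e)
  have p: "?E powr r > 0" using pos by simp
  show "?E powr (- r) \<le> exp (- (r * \<beta>) * gmax n V \<xi>)"
    using 1 p by (simp add: powr_minus exp_minus field_simps)
  show "exp (- (r * \<beta>) * gmax n V \<xi>) \<le> real (card V) powr r * ?E powr (- r)"
    using 2 p by (simp add: powr_minus exp_minus field_simps)
qed

lemma integrable_expsum_powr:
  assumes "\<beta> > 0" "r > 0"
  shows "integrable (gauss {..<n}) (\<lambda>\<xi>. expsum V \<beta> (\<lambda>v. lin n (\<lambda>v. v) v \<xi>) powr r)"
    and "integrable (gauss {..<n}) (\<lambda>\<xi>. expsum V \<beta> (\<lambda>v. lin n (\<lambda>v. v) v \<xi>) powr (- r))"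
proof -
  show "integrable (gauss {..<n}) (\<lambda>\<xi>. expsum V \<beta> (\<lambda>v. lin n (\<lambda>v. v) v \<xi>) powr r)"
    by (rule Bochner_Integration.integrable_bound[OF integrable_mult_right[OF integrable_exp_gmax[of "r * \<beta>"], of "real (card V) powr r"]
          borel_measurable_expsum_powr])
      (use expsum_powr_bounds(2)[OF assms] in \<open>auto intro!: AE_I2\<close>)
  show "integrable (gauss {..<n}) (\<lambda>\<xi>. expsum V \<beta> (\<lambda>v. lin n (\<lambda>v. v) v \<xi>) powr (- r))"
    by (rule Bochner_Integration.integrable_bound[OF integrable_exp_gmax[of "- (r * \<beta>)"] borel_measurable_expsum_powr])
      (use expsum_powr_bounds(3)[OF assms] in \<open>auto intro!: AE_I2\<close>)
qed

text \<open>The limit of \<open>concentration_soft\<close> with \<open>r * \<beta> = l\<close> and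
  \<open>r\<close> tending to 0.\<close>

lemma gmax_concentration:
  assumes l: "l > 0"
  shows "(\<integral>\<xi>. exp (l * gmax n V \<xi>) \<partial>gauss {..<n}) * (\<integral>\<xi>. exp (- l * gmax n V \<xi>) \<partial>gauss {..<n}) \<le> exp (l\<^sup>2)"
proof -
  let ?L = "(\<integral>\<xi>. exp (l * gmax n V \<xi>) \<partial>gauss {..<n}) * (\<integral>\<xi>. exp (- l * gmax n V \<xi>) \<partial>gauss {..<n})"
  have card: "real (card V) > 0" using V by (simp add: card_gt_0_iff)
  have "?L \<le> real (card V) powr (1 / real (Suc N)) * exp (l\<^sup>2)" for N
  proof -
    define r where "r = 1 / real (Suc N)"
    define \<beta> where "\<beta> = l * real (Suc N)"
    have r: "r > 0" and \<beta>: "\<beta> > 0" and rb: "r * \<beta> = l" using l by (auto simp: r_def \<beta>_def)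
    let ?E = "\<lambda>\<xi>. expsum V \<beta> (\<lambda>v. lin n (\<lambda>v. v) v \<xi>)"
    have "(\<integral>\<xi>. exp (l * gmax n V \<xi>) \<partial>gauss {..<n}) \<le> (\<integral>\<xi>. ?E \<xi> powr r \<partial>gauss {..<n})"
      using expsum_powr_bounds(1)[OF \<beta> r] unfolding rb
      by (intro integral_mono integrable_exp_gmax integrable_expsum_powr \<beta> r)
    moreover have "(\<integral>\<xi>. exp (- l * gmax n V \<xi>) \<partial>gauss {..<n}) \<le> (\<integral>\<xi>. real (card V) powr r * ?E \<xi> powr (- r) \<partial>gauss {..<n})"
      using expsum_powr_bounds(4)[OF \<beta> r] unfolding rb
      by (intro integral_mono integrable_exp_gmax integrable_mult_right integrable_expsum_powr \<beta> r)
    ultimately have "?L \<le> (\<integral>\<xi>. ?E \<xi> powr r \<partial>gauss {..<n}) * (\<integral>\<xi>. real (card V) powr r * ?E \<xi> powr (- r) \<partial>gauss {..<n})"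
      by (intro mult_mono) (auto intro!: integral_nonneg_AE)
    also have "\<dots> = real (card V) powr r * ((\<integral>\<xi>. ?E \<xi> powr r \<partial>gauss {..<n}) * (\<integral>\<xi>. ?E \<xi> powr (- r) \<partial>gauss {..<n}))"
      by simp
    also have "\<dots> \<le> real (card V) powr r * exp ((r * \<beta>)\<^sup>2)"
      using unit by (intro mult_left_mono concentration_soft[OF V \<beta> r]) (auto simp: ip_self[unfolded ip_def])
    finally show ?thesis unfolding rb by (simp add: r_def)
  qed
  then have "\<forall>\<^sub>F N in sequentially. ?L \<le> real (card V) powr (1 / real (Suc N)) * exp (l\<^sup>2)" by simp
  moreover have "(\<lambda>N. real (card V) powr (1 / real (Suc N)) * exp (l\<^sup>2)) \<longlonglongrightarrow> 1 * exp (l\<^sup>2)"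
    by (intro tendsto_mult tendsto_const powr_inverse_tendsto_1 card)
  ultimately show ?thesis
    using tendsto_lowerbound[of "\<lambda>N. real (card V) powr (1 / real (Suc N)) * exp (l\<^sup>2)" "1 * exp (l\<^sup>2)" sequentially ?L] by simp
qed

text \<open>Jensen bounds the opposite exponential moment from below, and dividing
  \<open>gmax_concentration\<close> by it leaves this bound, for either sign of
  \<open>l\<close>.\<close>

lemma gmax_exp_upper:
  assumes l: "l \<noteq> 0"
  shows "(\<integral>\<xi>. exp (l * gmax n V \<xi>) \<partial>gauss {..<n}) \<le> exp (l\<^sup>2 + l * (\<integral>\<xi>. gmax n V \<xi> \<partial>gauss {..<n}))"
proof -
  define X where "X s = (\<integral>\<xi>. exp (s * gmax n V \<xi>) \<partial>gauss {..<n})" for s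
  let ?a = "\<integral>\<xi>. gmax n V \<xi> \<partial>gauss {..<n}"
  have "X \<bar>l\<bar> * X (- \<bar>l\<bar>) \<le> exp (\<bar>l\<bar>\<^sup>2)"
    unfolding X_def using gmax_concentration[of "\<bar>l\<bar>"] l by simp
  then have "X l * X (- l) \<le> exp (l\<^sup>2)"
    by (cases "l > 0") (auto simp: mult.commute abs_if split: if_splits)
  moreover have "exp (- l * ?a) \<le> X (- l)"
    unfolding X_def using gauss.P.exp_expectation_le[of "{..<n}" "\<lambda>\<xi>. - l * gmax n V \<xi>"]
      integrable_gmax integrable_exp_gmax[of "- l"] by simp
  moreover have "X l \<ge> 0" unfolding X_def by (intro Bochner_Integration.integral_nonneg) auto
  ultimately have "X l * exp (- l * ?a) \<le> exp (l\<^sup>2)"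
    using mult_left_mono[of "exp (- l * ?a)" "X (- l)" "X l"] by linarith
  then show ?thesis unfolding X_def by (simp add: exp_add exp_minus field_simps)
qed

text \<open>Apply \<open>square_le_exp\<close> to the centred maximum. Its exponential moments at 1
  and -1 are at most e, which gives 4 (e - 1), and e is at most 3.\<close>

lemma gmax_variance:
  "(\<integral>\<xi>. (gmax n V \<xi> - (\<integral>\<xi>. gmax n V \<xi> \<partial>gauss {..<n}))\<^sup>2 \<partial>gauss {..<n}) \<le> 8"
proof -
  define a where "a = (\<integral>\<xi>. gmax n V \<xi> \<partial>gauss {..<n})"
  have "(\<integral>\<xi>. (gmax n V \<xi> - a)\<^sup>2 \<partial>gauss {..<n})
     \<le> (\<integral>\<xi>. 2 * (exp (- a) * exp (1 * gmax n V \<xi>) + exp a * exp ((- 1) * gmax n V \<xi>) - 2) \<partial>gauss {..<n})"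
  proof (rule integral_mono[OF integrable_gmax_square])
    show "integrable (gauss {..<n}) (\<lambda>\<xi>. 2 * (exp (- a) * exp (1 * gmax n V \<xi>) + exp a * exp ((- 1) * gmax n V \<xi>) - 2))"
      by (intro integrable_mult_right Bochner_Integration.integrable_add Bochner_Integration.integrable_diff integrable_exp_gmax) simp
    show "(gmax n V \<xi> - a)\<^sup>2 \<le> 2 * (exp (- a) * exp (1 * gmax n V \<xi>) + exp a * exp ((- 1) * gmax n V \<xi>) - 2)" for \<xi>
      using square_le_exp[of "gmax n V \<xi> - a"] by (simp add: exp_add[symmetric] algebra_simps)
  qed
  also have "\<dots> = 2 * (exp (- a) * (\<integral>\<xi>. exp (1 * gmax n V \<xi>) \<partial>gauss {..<n}) + exp a * (\<integral>\<xi>. exp ((- 1) * gmax n V \<xi>) \<partial>gauss {..<n}) - 2)"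
    using integrable_exp_gmax[of 1] integrable_exp_gmax[of "- 1"] by (simp add: gauss.P.prob_space)
  also have "\<dots> \<le> 2 * (exp (- a) * exp (1\<^sup>2 + 1 * a) + exp a * exp ((- 1)\<^sup>2 + (- 1) * a) - 2)"
    unfolding a_def by (intro mult_left_mono diff_mono add_mono order_refl gmax_exp_upper) auto
  also have "\<dots> = 2 * (2 * exp 1 - 2)" by (simp add: exp_add[symmetric])
  also have "\<dots> \<le> 8" using exp_le by simp
  finally show ?thesis unfolding a_def .
qed

text \<open>The statistical dimension enters only through this comparison: \<open>F\<close> is the norm of the metric
  projection onto a cone and \<open>V\<close> a finite net of (part of) its unit vectors.\<close>
lemma gmax_mean_close:
  assumes F: "F \<in> borel_measurable (gauss {..<n})" and a0: "sqnorm n a0 = 1" and \<epsilon>: "\<epsilon>\<^sup>2 * real n \<le> 1"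
    and close: "\<And>\<xi>. \<bar>F \<xi> - gmax n V \<xi>\<bar> \<le> \<epsilon> * sqrt (sqnorm n \<xi>) + 2 * \<bar>ip n a0 \<xi>\<bar>"
  shows "\<bar>sqrt (\<integral>\<xi>. (F \<xi>)\<^sup>2 \<partial>gauss {..<n}) - (\<integral>\<xi>. gmax n V \<xi> \<partial>gauss {..<n})\<bar> \<le> 6"
proof -
  define a where "a = (\<integral>\<xi>. gmax n V \<xi> \<partial>gauss {..<n})"
  let ?G = "gauss {..<n}"
  let ?h = "\<lambda>\<xi>. 2 * (gmax n V \<xi> - a)\<^sup>2 + 2 * (2 * \<epsilon>\<^sup>2 * (\<Sum>k<n. (\<xi> k)\<^sup>2) + 8 * (\<Sum>k<n. a0 k * \<xi> k)\<^sup>2)"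
  have tri: "(x + y)\<^sup>2 \<le> 2 * x\<^sup>2 + 2 * y\<^sup>2" for x y :: real
    using zero_le_power2[of "x - y"] by (simp add: power2_eq_square algebra_simps)
  have pw: "(F \<xi> - a)\<^sup>2 \<le> ?h \<xi>" for \<xi>
  proof -
    have sn: "sqnorm n \<xi> \<ge> 0" unfolding sqnorm_def by (intro sum_nonneg) auto
    have "(F \<xi> - a)\<^sup>2 \<le> 2 * (gmax n V \<xi> - a)\<^sup>2 + 2 * (F \<xi> - gmax n V \<xi>)\<^sup>2"
      using tri[of "gmax n V \<xi> - a" "F \<xi> - gmax n V \<xi>"] by simp
    also have "(F \<xi> - gmax n V \<xi>)\<^sup>2 \<le> (\<epsilon> * sqrt (sqnorm n \<xi>) + 2 * \<bar>ip n a0 \<xi>\<bar>)\<^sup>2"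
      using power_mono[OF close[of \<xi>], of 2] by simp
    also have "\<dots> \<le> 2 * (\<epsilon> * sqrt (sqnorm n \<xi>))\<^sup>2 + 2 * (2 * \<bar>ip n a0 \<xi>\<bar>)\<^sup>2" by (rule tri)
    also have "\<dots> = 2 * \<epsilon>\<^sup>2 * (\<Sum>k<n. (\<xi> k)\<^sup>2) + 8 * (\<Sum>k<n. a0 k * \<xi> k)\<^sup>2"
      using sn by (simp add: power_mult_distrib sqnorm_def ip_def)
    finally show ?thesis by simp
  qed
  have ih: "integrable ?G ?h"
    by (intro Bochner_Integration.integrable_add integrable_mult_right integrable_gmax_square
        gauss_sum_squares(1) gauss_linear_form_square(1)) auto
  have iFa: "integrable ?G (\<lambda>\<xi>. (F \<xi> - a)\<^sup>2)"
  proof (rule Bochner_Integration.integrable_bound[OF ih])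
    show "(\<lambda>\<xi>. (F \<xi> - a)\<^sup>2) \<in> borel_measurable ?G"
      by (intro borel_measurable_power borel_measurable_diff F borel_measurable_const)
    have "norm ((F \<xi> - a)\<^sup>2) \<le> norm (?h \<xi>)" for \<xi>
      using order_trans[OF pw[of \<xi>] abs_ge_self] unfolding real_norm_def abs_power2 .
    then show "AE \<xi> in ?G. norm ((F \<xi> - a)\<^sup>2) \<le> norm (?h \<xi>)" by (intro AE_I2)
  qed
  have iF: "integrable ?G F"
  proof (rule Bochner_Integration.integrable_bound[OF Bochner_Integration.integrable_add[OF iFa, of "\<lambda>_. 1 + \<bar>a\<bar>"] F])
    have "\<bar>F \<xi>\<bar> \<le> (F \<xi> - a)\<^sup>2 + (1 + \<bar>a\<bar>)" for \<xi>
    proof -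
      have "\<bar>F \<xi> - a\<bar> \<le> (F \<xi> - a)\<^sup>2 + 1"
        using zero_le_power2[of "\<bar>F \<xi> - a\<bar> - 1/2"] by (simp add: power2_eq_square algebra_simps)
      then show ?thesis by linarith
    qed
    then show "AE \<xi> in ?G. norm (F \<xi>) \<le> norm ((F \<xi> - a)\<^sup>2 + (1 + \<bar>a\<bar>))"
      by (intro AE_I2) (simp add: order_trans[OF _ abs_ge_self])
  qed simp
  have sqF: "(F \<xi>)\<^sup>2 = (F \<xi> - a)\<^sup>2 + (2 * a * F \<xi> - a\<^sup>2)" for \<xi>
    by (simp add: power2_eq_square algebra_simps)
  have iF2: "integrable ?G (\<lambda>\<xi>. (F \<xi>)\<^sup>2)"
    unfolding sqF using iFa iF by simp
  define \<delta> where "\<delta> = (\<integral>\<xi>. (F \<xi>)\<^sup>2 \<partial>?G)"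
  have \<delta>0: "\<delta> \<ge> 0" unfolding \<delta>_def by (intro Bochner_Integration.integral_nonneg) auto
  define f where "f = (\<integral>\<xi>. F \<xi> \<partial>?G)"
  have a0': "a \<ge> 0" unfolding a_def by (rule gmax_mean_nonneg)
  have "(\<integral>\<xi>. (F \<xi> - f)\<^sup>2 \<partial>?G) \<ge> 0" by (intro Bochner_Integration.integral_nonneg) auto
  also have "(\<integral>\<xi>. (F \<xi> - f)\<^sup>2 \<partial>?G) = (\<integral>\<xi>. (F \<xi>)\<^sup>2 - 2 * f * F \<xi> + f\<^sup>2 \<partial>?G)"
    by (intro Bochner_Integration.integral_cong refl) (simp add: power2_eq_square algebra_simps)
  also have "\<dots> = \<delta> - 2 * f * f + f\<^sup>2" using iF iF2 by (simp add: \<delta>_def f_def gauss.P.prob_space)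
  finally have "f\<^sup>2 \<le> \<delta>" by (simp add: power2_eq_square)
  then have f: "f \<le> sqrt \<delta>" by (rule real_le_rsqrt)
  have "(\<integral>\<xi>. (F \<xi> - a)\<^sup>2 \<partial>?G) \<le> (\<integral>\<xi>. ?h \<xi> \<partial>?G)"
    by (rule integral_mono[OF iFa ih pw])
  also have "\<dots> = 2 * (\<integral>\<xi>. (gmax n V \<xi> - a)\<^sup>2 \<partial>?G) + 2 * (2 * \<epsilon>\<^sup>2 * real n + 8 * 1)"
    using integrable_gmax_square[of a] gauss_sum_squares[of "{..<n}"] gauss_linear_form_square[of "{..<n}" a0] a0
    by (simp add: sqnorm_def)
  \<comment> \<open>The variance is at most 8, the net error contributes at most 1 by the choice of
    \<open>\<epsilon>\<close>, and the form of the unit vector \<open>a0\<close> has second moment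
    1. The total is 36, whence the 6.\<close>
  also have "\<dots> \<le> 2 * 8 + 2 * (2 * 1 + 8 * 1)"
    using gmax_variance \<epsilon> unfolding a_def by (intro add_mono mult_left_mono) auto
  finally have "(\<integral>\<xi>. (F \<xi> - a)\<^sup>2 \<partial>?G) \<le> 36" by simp
  moreover have "(\<integral>\<xi>. (F \<xi> - a)\<^sup>2 \<partial>?G) = \<delta> - 2 * a * f + a\<^sup>2"
  proof -
    have "(\<integral>\<xi>. (F \<xi> - a)\<^sup>2 \<partial>?G) = (\<integral>\<xi>. (F \<xi>)\<^sup>2 - 2 * a * F \<xi> + a\<^sup>2 \<partial>?G)"
      by (intro Bochner_Integration.integral_cong refl) (simp add: power2_eq_square algebra_simps)
    then show ?thesis using iF iF2 by (simp add: \<delta>_def f_def gauss.P.prob_space)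
  qed
  \<comment> \<open>Since \<open>a\<close> is nonnegative and the mean \<open>f\<close> is at most
    \<open>sqrt \<delta>\<close>, the square of \<open>sqrt \<delta> - a\<close> is at most the
    second moment of \<open>F - a\<close>.\<close>
  moreover have "2 * a * f \<le> 2 * a * sqrt \<delta>" using f a0' by (intro mult_left_mono) auto
  ultimately have "\<delta> - 2 * a * sqrt \<delta> + a\<^sup>2 \<le> 36" by linarith
  then have "(sqrt \<delta> - a)\<^sup>2 \<le> 6\<^sup>2" using \<delta>0 by (simp add: power2_diff algebra_simps)
  then have "\<bar>sqrt \<delta> - a\<bar> \<le> 6" using abs_le_square_iff[of "sqrt \<delta> - a" 6] by simp
  then show ?thesis unfolding \<delta>_def a_def .
qed

end

text \<open>An exponential Markov bound for the smooth functional, followed by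
  \<open>gordon_soft\<close>, the limit of small \<open>r\<close>, and \<open>gmax_exp_upper\<close>
  for both maxima. The 3/2 is 1 + 1 from these two bounds minus the 1/2 from
  \<open>gordon_soft\<close>. The slack \<open>\<epsilon>\<close> leaves room for the later
  approximation by nets.\<close>

lemma gordon_probability:
  fixes c :: "(nat \<Rightarrow> real) \<times> (nat \<Rightarrow> real) \<Rightarrow> 'b \<Rightarrow> real"
  assumes T: "finite T" "T \<noteq> {}" "\<And>v. v \<in> T \<Longrightarrow> sqnorm n v = 1"
    and U: "finite U" "U \<noteq> {}" "\<And>v. v \<in> U \<Longrightarrow> sqnorm m v = 1"
    and B: "finite B" and l: "l > 0"
    and c: "\<And>x y x' y'. x \<in> T \<Longrightarrow> y \<in> U \<Longrightarrow> x' \<in> T \<Longrightarrow> y' \<in> U \<Longrightarrow>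
      (\<Sum>b\<in>B. c (x, y) b * c (x', y') b) = ip n x x' * ip m y y'"
  shows "measure (gauss B) {\<xi> \<in> space (gauss B). \<exists>x\<in>T. \<forall>y\<in>U. (\<Sum>b\<in>B. c (x, y) b * \<xi> b) \<le> \<epsilon>}
    \<le> exp (l * \<epsilon> + 3 / 2 * l\<^sup>2 + l * ((\<integral>\<xi>. gmax n T \<xi> \<partial>gauss {..<n}) - (\<integral>\<xi>. gmax m U \<xi> \<partial>gauss {..<m})))"
proof -
  let ?A = "{\<xi> \<in> space (gauss B). \<exists>x\<in>T. \<forall>y\<in>U. (\<Sum>b\<in>B. c (x, y) b * \<xi> b) \<le> \<epsilon>}"
  let ?ET = "\<integral>\<xi>. exp (l * gmax n T \<xi>) \<partial>gauss {..<n}" and ?EU = "\<integral>\<xi>. exp (- l * gmax m U \<xi>) \<partial>gauss {..<m}"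
  have A: "?A \<in> sets (gauss B)"
    using T(1) U(1) by (intro sets.sets_Collect_finite_Ex sets.sets_Collect_finite_All borel_measurable_le
      borel_measurable_linear_form borel_measurable_const)
  have cT: "real (card T) > 0" and cU: "real (card U) > 0" using T U by (auto simp: card_gt_0_iff)
  have main: "measure (gauss B) ?A \<le> (real (card U) * real (card T)) powr (1 / real (Suc N)) * (exp (l * \<epsilon> - l\<^sup>2 / 2) * (?ET * ?EU))" for N
  proof -
    define r where "r = 1 / real (Suc N)"
    define \<beta> where "\<beta> = l * real (Suc N)"
    have r: "r > 0" "r \<le> 1" and \<beta>: "\<beta> > 0" and rb: "r * \<beta> = l" using l by (auto simp: r_def \<beta>_def)
    let ?X = "\<lambda>\<xi> a. \<Sum>b\<in>B. c a b * \<xi> b"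
    have iF: "integrable (gauss B) (\<lambda>\<xi>. softF T U \<beta> r (?X \<xi>))"
      by (rule integrable_softF[OF T(1,2) U(1,2) \<beta> r(1) B])
    \<comment> \<open>On the event one row has all its entries at most \<open>\<epsilon>\<close>;
      this single row already bounds \<open>softU\<close> from below.\<close>
    have low: "real (card U) powr (- r) * exp (- l * \<epsilon>) * indicator ?A \<xi> \<le> softF T U \<beta> r (?X \<xi>)" for \<xi>
    proof (cases "\<xi> \<in> ?A")
      case True
      then obtain x where x: "x \<in> T" "\<And>y. y \<in> U \<Longrightarrow> ?X \<xi> (x, y) \<le> \<epsilon>" by auto
      have "softS U \<beta> (?X \<xi>) x \<le> (\<Sum>y\<in>U. exp (\<beta> * \<epsilon>))"
        unfolding softS_def using x \<beta> by (intro sum_mono) auto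
      then have "1 / (real (card U) * exp (\<beta> * \<epsilon>)) \<le> 1 / softS U \<beta> (?X \<xi>) x"
        using softS_pos[OF T(1,2) U(1,2) \<beta> r(1), of "?X \<xi>" x] cU by (intro divide_left_mono) auto
      also have "\<dots> \<le> softU T U \<beta> (?X \<xi>)"
        unfolding softU_def using x T softS_pos[OF T(1,2) U(1,2) \<beta> r(1), of "?X \<xi>"]
        by (intro member_le_sum[of x T "\<lambda>x. 1 / softS U \<beta> (?X \<xi>) x"]) (auto intro: less_imp_le)
      finally have "(1 / (real (card U) * exp (\<beta> * \<epsilon>))) powr r \<le> softF T U \<beta> r (?X \<xi>)"
        unfolding softF_def using cU r by (intro powr_mono2) auto
      moreover have "(1 / (real (card U) * exp (\<beta> * \<epsilon>))) powr r = real (card U) powr (- r) * exp (- l * \<epsilon>)"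
        using rb by (simp add: powr_divide powr_mult powr_minus exp_powr_real exp_minus field_simps)
      ultimately show ?thesis using True by simp
    next
      case False
      then show ?thesis using softF_pos[OF T(1,2) U(1,2) \<beta> r(1), of "?X \<xi>"] by simp
    qed
    have "real (card U) powr (- r) * exp (- l * \<epsilon>) * measure (gauss B) ?A
        = (\<integral>\<xi>. real (card U) powr (- r) * exp (- l * \<epsilon>) * indicator ?A \<xi> \<partial>gauss B)"
      using A by simp
    also have "\<dots> \<le> (\<integral>\<xi>. softF T U \<beta> r (?X \<xi>) \<partial>gauss B)"
      using A by (intro integral_mono[OF _ iF low] integrable_mult_right integrable_real_indicator) (auto simp: gauss.P.emeasure_space_1 less_top[symmetric])
    also have "\<dots> \<le> exp (- (l\<^sup>2 / 2)) * ((\<integral>\<xi>. expsum T \<beta> (\<lambda>v. lin n (\<lambda>v. v) v \<xi>) powr r \<partial>gauss {..<n})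
      * (\<integral>\<xi>. expsum U \<beta> (\<lambda>v. lin m (\<lambda>v. v) v \<xi>) powr (- r) \<partial>gauss {..<m}))"
    proof -
      have "exp ((r * \<beta>)\<^sup>2 / 2) * (\<integral>\<xi>. softF T U \<beta> r (?X \<xi>) \<partial>gauss B)
        \<le> (\<integral>\<xi>. expsum T \<beta> (\<lambda>v. lin n (\<lambda>v. v) v \<xi>) powr r \<partial>gauss {..<n})
        * (\<integral>\<xi>. expsum U \<beta> (\<lambda>v. lin m (\<lambda>v. v) v \<xi>) powr (- r) \<partial>gauss {..<m})"
        using T(3) U(3) c by (intro gordon_soft[OF T(1,2) U(1,2) \<beta> r B]) (auto simp: ip_self[unfolded ip_def] ip_def)
      then show ?thesis unfolding rb by (simp add: exp_minus field_simps)
    qed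
    also have "\<dots> \<le> exp (- (l\<^sup>2 / 2)) * ((real (card T) powr r * ?ET) * ?EU)"
    proof (intro mult_left_mono mult_mono)
      have "(\<integral>\<xi>. expsum T \<beta> (\<lambda>v. lin n (\<lambda>v. v) v \<xi>) powr r \<partial>gauss {..<n})
          \<le> (\<integral>\<xi>. real (card T) powr r * exp (l * gmax n T \<xi>) \<partial>gauss {..<n})"
        using expsum_powr_bounds(2)[OF T \<beta> r(1)] unfolding rb
        by (intro integral_mono integrable_expsum_powr integrable_mult_right integrable_exp_gmax T \<beta> r)
      then show "(\<integral>\<xi>. expsum T \<beta> (\<lambda>v. lin n (\<lambda>v. v) v \<xi>) powr r \<partial>gauss {..<n}) \<le> real (card T) powr r * ?ET" by simp
      show "(\<integral>\<xi>. expsum U \<beta> (\<lambda>v. lin m (\<lambda>v. v) v \<xi>) powr (- r) \<partial>gauss {..<m}) \<le> ?EU"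
        using expsum_powr_bounds(3)[OF U \<beta> r(1)] unfolding rb
        by (intro integral_mono integrable_expsum_powr integrable_exp_gmax U \<beta> r)
    qed (auto intro!: Bochner_Integration.integral_nonneg mult_nonneg_nonneg)
    finally have "measure (gauss B) ?A \<le> real (card U) powr r * exp (l * \<epsilon>) * (exp (- (l\<^sup>2 / 2)) * ((real (card T) powr r * ?ET) * ?EU))"
      using cU by (simp add: powr_minus exp_minus field_simps)
    also have "\<dots> = (real (card U) * real (card T)) powr r * (exp (l * \<epsilon> - l\<^sup>2 / 2) * (?ET * ?EU))"
    proof -
      have "exp (l * \<epsilon> - l\<^sup>2 / 2) = exp (l * \<epsilon>) * exp (- (l\<^sup>2 / 2))" by (simp add: exp_add[symmetric])
      then show ?thesis by (simp add: powr_mult mult_ac)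
    qed
    finally show ?thesis unfolding r_def .
  qed
  have "(\<lambda>N. (real (card U) * real (card T)) powr (1 / real (Suc N)) * (exp (l * \<epsilon> - l\<^sup>2 / 2) * (?ET * ?EU)))
      \<longlonglongrightarrow> 1 * (exp (l * \<epsilon> - l\<^sup>2 / 2) * (?ET * ?EU))"
    using cT cU by (intro tendsto_mult tendsto_const powr_inverse_tendsto_1) auto
  from tendsto_lowerbound[OF this, of "measure (gauss B) ?A"] main
  have "measure (gauss B) ?A \<le> exp (l * \<epsilon> - l\<^sup>2 / 2) * (?ET * ?EU)" by simp
  also have "\<dots> \<le> exp (l * \<epsilon> - l\<^sup>2 / 2) * (exp (l\<^sup>2 + l * (\<integral>\<xi>. gmax n T \<xi> \<partial>gauss {..<n}))
      * exp ((- l)\<^sup>2 + (- l) * (\<integral>\<xi>. gmax m U \<xi> \<partial>gauss {..<m})))"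
    using l by (intro mult_left_mono mult_mono gmax_exp_upper[OF T] gmax_exp_upper[OF U])
      (auto intro!: Bochner_Integration.integral_nonneg)
  also have "\<dots> = exp (l * \<epsilon> + 3 / 2 * l\<^sup>2 + l * ((\<integral>\<xi>. gmax n T \<xi> \<partial>gauss {..<n}) - (\<integral>\<xi>. gmax m U \<xi> \<partial>gauss {..<m})))"
    by (simp add: exp_add[symmetric] algebra_simps)
  finally show ?thesis .
qed

section \<open>Closed convex cones\<close>

definition vscale :: "nat \<Rightarrow> real \<Rightarrow> (nat \<Rightarrow> real) \<Rightarrow> nat \<Rightarrow> real" where
  "vscale n c x = restrict (\<lambda>i. c * x i) {..<n}"

definition vadd :: "nat \<Rightarrow> (nat \<Rightarrow> real) \<Rightarrow> (nat \<Rightarrow> real) \<Rightarrow> nat \<Rightarrow> real" where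
  "vadd n x y = restrict (\<lambda>i. x i + y i) {..<n}"

definition vsub :: "nat \<Rightarrow> (nat \<Rightarrow> real) \<Rightarrow> (nat \<Rightarrow> real) \<Rightarrow> nat \<Rightarrow> real" where
  "vsub n x y = restrict (\<lambda>i. x i - y i) {..<n}"

lemma ip_commute: "ip n x y = ip n y x"
  by (simp add: ip_def mult.commute)

lemma ip_vscale [simp]: "ip n (vscale n c x) y = c * ip n x y" "ip n x (vscale n c y) = c * ip n x y"
  by (simp_all add: ip_def vscale_def sum_distrib_left mult_ac)

lemma ip_vadd [simp]: "ip n (vadd n x x') y = ip n x y + ip n x' y" "ip n x (vadd n y y') = ip n x y + ip n x y'"
  by (simp_all add: ip_def vadd_def sum.distrib algebra_simps)

lemma ip_vsub [simp]: "ip n (vsub n x x') y = ip n x y - ip n x' y" "ip n x (vsub n y y') = ip n x y - ip n x y'"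
  by (simp_all add: ip_def vsub_def sum_subtractf algebra_simps)

lemma ip_zvec [simp]: "ip n (zvec n) y = 0" "ip n y (zvec n) = 0"
  by (simp_all add: ip_def zvec_def)

lemma vec_in_rvec [simp]: "vscale n c x \<in> rvec n" "vadd n x y \<in> rvec n" "vsub n x y \<in> rvec n" "zvec n \<in> rvec n"
  by (auto simp: vscale_def vadd_def vsub_def zvec_def rvec_def)

lemma sqnorm_nonneg [simp]: "0 \<le> sqnorm n x"
  unfolding sqnorm_def by (intro sum_nonneg) auto

lemma sqnorm_vscale [simp]: "sqnorm n (vscale n c x) = c\<^sup>2 * sqnorm n x"
  by (simp add: ip_self[symmetric] power2_eq_square)

lemma sqnorm_zvec [simp]: "sqnorm n (zvec n) = 0"
  by (simp add: ip_self[symmetric])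

lemma sqnorm_vsub: "sqnorm n (vsub n x y) = sqnorm n x - 2 * ip n x y + sqnorm n y"
  by (simp add: ip_self[symmetric] ip_commute[of n y x])

lemma sqnorm_vadd: "sqnorm n (vadd n x y) = sqnorm n x + 2 * ip n x y + sqnorm n y"
  by (simp add: ip_self[symmetric] ip_commute[of n y x])

lemma sqnorm_diff_fun: "sqnorm n (\<lambda>i. x i - y i) = sqnorm n (vsub n x y)"
  by (simp add: sqnorm_def vsub_def)

lemma ext_rvec:
  assumes "x \<in> rvec n" "y \<in> rvec n" "\<And>i. i < n \<Longrightarrow> x i = y i"
  shows "x = y"
  using assms unfolding rvec_def by (intro PiE_ext[of x "{..<n}" "\<lambda>_. UNIV" y]) auto

lemma sqnorm_eq_0_iff:
  assumes "x \<in> rvec n"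
  shows "sqnorm n x = 0 \<longleftrightarrow> x = zvec n"
proof
  assume "sqnorm n x = 0"
  then have "\<forall>i\<in>{..<n}. (x i)\<^sup>2 = 0" unfolding sqnorm_def by (subst (asm) sum_nonneg_eq_0_iff) auto
  then show "x = zvec n" using assms by (intro ext_rvec[of x n] vec_in_rvec) (auto simp: zvec_def)
qed simp

lemma vsub_eq_zvec_iff:
  assumes "x \<in> rvec n" "y \<in> rvec n"
  shows "vsub n x y = zvec n \<longleftrightarrow> x = y"
proof
  assume e: "vsub n x y = zvec n"
  show "x = y"
  proof (rule ext_rvec[OF assms])
    fix i assume "i < n"
    then show "x i = y i" using fun_cong[OF e, of i] by (simp add: vsub_def zvec_def)
  qed
qed (auto simp: vsub_def zvec_def)

lemma sqnorm_pos: "x \<in> rvec n \<Longrightarrow> x \<noteq> zvec n \<Longrightarrow> 0 < sqnorm n x"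
  using sqnorm_eq_0_iff[of x n] sqnorm_nonneg[of n x] by linarith

lemma ip_square_le: "(ip n x y)\<^sup>2 \<le> sqnorm n x * sqnorm n y"
  unfolding ip_def sqnorm_def by (rule Cauchy_Schwarz_ineq_sum)

lemma ip_le: "ip n x y \<le> sqrt (sqnorm n x) * sqrt (sqnorm n y)"
  using real_le_rsqrt[OF ip_square_le[of n x y]] by (simp add: real_sqrt_mult)

definition unitvec :: "nat \<Rightarrow> (nat \<Rightarrow> real) \<Rightarrow> nat \<Rightarrow> real" where
  "unitvec n x = vscale n (1 / sqrt (sqnorm n x)) x"

lemma sqnorm_unitvec:
  assumes "0 < sqnorm n x"
  shows "sqnorm n (unitvec n x) = 1"
  using assms by (simp add: unitvec_def power_divide)

lemma continuous_on_coord: "continuous_on S (\<lambda>x :: 'a \<Rightarrow> real. x i)"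
  by (rule continuous_on_subset[OF continuous_on_product_coordinates]) simp

lemma continuous_on_ip: "continuous_on S (\<lambda>x. ip n x y)"
  unfolding ip_def by (intro continuous_intros continuous_on_coord)

lemma continuous_on_sqnorm: "continuous_on S (\<lambda>x. sqnorm n x)"
  unfolding sqnorm_def by (intro continuous_intros continuous_on_coord)

lemma tendsto_coord: "X \<longlonglongrightarrow> x \<Longrightarrow> (\<lambda>k. X k i) \<longlonglongrightarrow> (x i :: real)" for X :: "nat \<Rightarrow> 'a \<Rightarrow> real"
  using continuous_on_tendsto_compose[OF continuous_on_coord[of UNIV i]] by auto

lemma tendsto_fun:
  assumes "\<And>i. (\<lambda>k. X k i) \<longlonglongrightarrow> (x i :: real)"
  shows "X \<longlonglongrightarrow> x"
  using assms limitin_componentwise[of "\<lambda>_. euclidean" UNIV X x sequentially]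
  by (simp add: euclidean_product_topology)

lemma closed_rvec: "closed (rvec n)"
proof -
  have "rvec n = (\<Inter>i\<in>{n..}. {x. x i = undefined})"
    by (auto simp: rvec_def PiE_def extensional_def)
  moreover have "closed {x :: nat \<Rightarrow> real. x i = undefined}" for i
    by (intro closed_Collect_eq continuous_on_coord continuous_on_const)
  ultimately show ?thesis by auto
qed

text \<open>Coordinates from \<open>n\<close> on are pinned to \<open>undefined\<close>, so the set
  lies in a product of intervals and singletons, which is compact by Tychonoff.\<close>

lemma compact_rvec:
  assumes "closed A" "A \<subseteq> rvec n" "\<And>x. x \<in> A \<Longrightarrow> sqnorm n x \<le> r"
  shows "compact A"
proof -
  define S where "S i = (if i < n then {- sqrt \<bar>r\<bar>..sqrt \<bar>r\<bar>} else {undefined :: real})" for i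
  have "compact (PiE UNIV S)"
    using compactin_PiE[of "\<lambda>_. euclidean" UNIV S] unfolding euclidean_product_topology
    by (auto simp: S_def)
  moreover have "A \<subseteq> PiE UNIV S"
  proof
    fix x assume x: "x \<in> A"
    have "x i \<in> S i" for i
    proof (cases "i < n")
      case True
      have "(x i)\<^sup>2 \<le> sqnorm n x" unfolding sqnorm_def using True by (intro member_le_sum) auto
      also have "\<dots> \<le> \<bar>r\<bar>" using assms(3)[OF x] by simp
      finally have "\<bar>x i\<bar> \<le> sqrt \<bar>r\<bar>" using real_le_rsqrt[of "\<bar>x i\<bar>" "\<bar>r\<bar>"] by simp
      then show ?thesis using True by (auto simp: S_def abs_le_iff)
    next
      case False
      then show ?thesis using x assms(2) by (auto simp: S_def rvec_def PiE_def extensional_def)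
    qed
    then show "x \<in> PiE UNIV S" by auto
  qed
  ultimately show ?thesis using assms(1) by (metis compact_Int_closed inf.absorb_iff2)
qed

lemma finite_net:
  assumes "compact A" "\<epsilon> > 0"
  obtains V where "finite V" "V \<subseteq> A" "\<And>x. x \<in> A \<Longrightarrow> \<exists>v\<in>V. sqnorm n (vsub n x v) \<le> \<epsilon>\<^sup>2"
proof -
  have "open {y. sqnorm n (\<lambda>i. y i - x i) < \<epsilon>\<^sup>2}" for x
    unfolding sqnorm_def by (intro open_Collect_less continuous_intros continuous_on_coord)
  moreover have "A \<subseteq> (\<Union>x\<in>A. {y. sqnorm n (\<lambda>i. y i - x i) < \<epsilon>\<^sup>2})"
    using assms(2) by (auto simp: sqnorm_def)
  ultimately obtain V where V: "V \<subseteq> A" "finite V" "A \<subseteq> (\<Union>x\<in>V. {y. sqnorm n (\<lambda>i. y i - x i) < \<epsilon>\<^sup>2})"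
    by (rule compactE_image[OF assms(1)])
  show ?thesis
  proof (rule that[OF V(2,1)])
    fix x assume "x \<in> A"
    then obtain v where "v \<in> V" "sqnorm n (\<lambda>i. x i - v i) < \<epsilon>\<^sup>2" using V(3) by blast
    then show "\<exists>v\<in>V. sqnorm n (vsub n x v) \<le> \<epsilon>\<^sup>2" by (intro bexI[of _ v]) (auto simp: sqnorm_diff_fun)
  qed
qed

definition usphere :: "nat \<Rightarrow> (nat \<Rightarrow> real) set \<Rightarrow> (nat \<Rightarrow> real) set" where
  "usphere n K = {x \<in> K. sqnorm n x = 1}"

lemma compact_usphere:
  assumes "closed K" "K \<subseteq> rvec n"
  shows "compact (usphere n K)"
proof (rule compact_rvec[of _ n 1])
  have "usphere n K = K \<inter> {x. sqnorm n x = 1}" by (auto simp: usphere_def)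
  then show "closed (usphere n K)"
    using assms(1) by (auto intro!: closed_Int closed_Collect_eq continuous_on_sqnorm continuous_on_const)
qed (use assms in \<open>auto simp: usphere_def\<close>)

definition polar :: "nat \<Rightarrow> (nat \<Rightarrow> real) set \<Rightarrow> (nat \<Rightarrow> real) set" where
  "polar n K = {v \<in> rvec n. \<forall>l\<in>K. ip n v l \<le> 0}"

section \<open>Metric projection onto a cone, and its polar\<close>

context
  fixes n :: nat and K :: "(nat \<Rightarrow> real) set"
  assumes K: "closed_convex_cone n K"
begin

lemma cone_subset: "K \<subseteq> rvec n" and cone_zvec: "zvec n \<in> K" and cone_closed: "closed K"
  using K by (auto simp: closed_convex_cone_def)

lemma cone_vscale: "x \<in> K \<Longrightarrow> 0 \<le> c \<Longrightarrow> vscale n c x \<in> K"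
  using K by (auto simp: closed_convex_cone_def vscale_def)

text \<open>A sum is twice a midpoint; the definition of a cone supplies convex combinations and
  scalings.\<close>

lemma cone_vadd:
  assumes "x \<in> K" "y \<in> K"
  shows "vadd n x y \<in> K"
proof -
  have "restrict (\<lambda>i. 1/2 * x i + (1 - 1/2) * y i) {..<n} \<in> K"
  proof -
    have "restrict (\<lambda>i. u * x i + (1 - u) * y i) {..<n} \<in> K" if "0 \<le> u" "u \<le> 1" for u
      using K assms that unfolding closed_convex_cone_def by blast
    from this[of "1/2"] show ?thesis by simp
  qed
  then have "vscale n 2 (restrict (\<lambda>i. 1/2 * x i + (1 - 1/2) * y i) {..<n}) \<in> K" by (rule cone_vscale) simp
  also have "vscale n 2 (restrict (\<lambda>i. 1/2 * x i + (1 - 1/2) * y i) {..<n}) = vadd n x y"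
    by (rule ext) (auto simp: vscale_def vadd_def restrict_def)
  finally show ?thesis .
qed

lemma cone_unitvec:
  assumes "x \<in> K" "x \<noteq> zvec n"
  shows "unitvec n x \<in> usphere n K"
  using assms cone_subset sqnorm_unitvec[OF sqnorm_pos[of x n]]
  by (auto simp: usphere_def unitvec_def intro!: cone_vscale)

text \<open>The zero vector competes, so only the points no farther from \<open>x\<close> than it
  matter. They satisfy |q|^2 <= 2 <x, q>, and |2 x - q|^2 >= 0 then gives |q|^2 <= 4 |x|^2, hence
  compactness.\<close>

lemma minimizer_exists:
  "\<exists>p\<in>K. \<forall>q\<in>K. sqnorm n (\<lambda>i. x i - p i) \<le> sqnorm n (\<lambda>i. x i - q i)"
proof -
  define A where "A = {q \<in> K. sqnorm n (\<lambda>i. x i - q i) \<le> sqnorm n x}"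
  have cont: "continuous_on S (\<lambda>q. sqnorm n (\<lambda>i. x i - q i))" for S
    unfolding sqnorm_def by (intro continuous_intros continuous_on_coord)
  have "compact A"
  proof (rule compact_rvec[of _ n "4 * sqnorm n x"])
    have "A = K \<inter> {q. sqnorm n (\<lambda>i. x i - q i) \<le> sqnorm n x}" by (auto simp: A_def)
    then show "closed A" using cone_closed by (auto intro!: closed_Int closed_Collect_le cont continuous_on_const)
    fix q assume "q \<in> A"
    then have "sqnorm n q - 2 * ip n x q \<le> 0" by (simp add: A_def sqnorm_diff_fun sqnorm_vsub)
    moreover have "2 * (2 * ip n x q) \<le> 4 * sqnorm n x + sqnorm n q"
      using sqnorm_nonneg[of n "vsub n (vscale n 2 x) q"] by (simp add: sqnorm_vsub)
    ultimately show "sqnorm n q \<le> 4 * sqnorm n x" by linarith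
  qed (use cone_subset in \<open>auto simp: A_def\<close>)
  moreover have z: "zvec n \<in> A" by (simp add: A_def cone_zvec sqnorm_diff_fun sqnorm_vsub)
  ultimately obtain p where p: "p \<in> A" "\<forall>q\<in>A. sqnorm n (\<lambda>i. x i - p i) \<le> sqnorm n (\<lambda>i. x i - q i)"
    using continuous_attains_inf[of A "\<lambda>q. sqnorm n (\<lambda>i. x i - q i)"] cont by blast
  have "sqnorm n (\<lambda>i. x i - p i) \<le> sqnorm n (\<lambda>i. x i - q i)" if "q \<in> K" for q
  proof (cases "q \<in> A")
    case False
    then have "sqnorm n x < sqnorm n (\<lambda>i. x i - q i)" using that by (auto simp: A_def)
    then show ?thesis using p(1) by (simp add: A_def)
  qed (use p in auto)
  then show ?thesis using p(1) by (auto simp: A_def)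
qed

text \<open>First variation at \<open>p\<close> in a direction \<open>q\<close> of the cone. For
  steps at most 1 the direction - p is admissible as well, since it only shrinks \<open>p\<close>,
  and this upgrades the inequality at \<open>p\<close> to an equality.\<close>

lemma minimizer_variational:
  assumes p: "p \<in> K" "\<And>q. q \<in> K \<Longrightarrow> sqnorm n (\<lambda>i. x i - p i) \<le> sqnorm n (\<lambda>i. x i - q i)"
  shows "q \<in> K \<Longrightarrow> ip n (vsub n x p) q \<le> 0" and "ip n (vsub n x p) p = 0"
proof -
  define r where "r = vsub n x p"
  have quad: "a \<le> 0" if "\<And>t. 0 < t \<Longrightarrow> t \<le> 1 \<Longrightarrow> 2 * (t * a) \<le> t\<^sup>2 * b" for a b :: real
  proof (rule ccontr)
    assume "\<not> a \<le> 0"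
    then have a: "a > 0" by simp
    define t where "t = min 1 (a / (\<bar>b\<bar> + 1))"
    have t: "0 < t" "t \<le> 1" "t \<le> a / (\<bar>b\<bar> + 1)" using a by (auto simp: t_def)
    have "2 * (t * a) \<le> t * (t * b)" using that[OF t(1,2)] by (simp add: power2_eq_square)
    then have "2 * a \<le> t * b" using t by (simp add: mult.left_commute)
    also have "\<dots> \<le> t * (\<bar>b\<bar> + 1)" using t by (intro mult_left_mono) auto
    also have "\<dots> \<le> a / (\<bar>b\<bar> + 1) * (\<bar>b\<bar> + 1)" using t by (intro mult_right_mono) auto
    also have "\<dots> = a" by simp
    finally show False using a by simp
  qed
  have var: "ip n r q \<le> 0" if "\<And>t. 0 < t \<Longrightarrow> t \<le> 1 \<Longrightarrow> vadd n p (vscale n t q) \<in> K" for q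
  proof (rule quad[of _ "sqnorm n q"])
    fix t :: real assume t: "0 < t" "t \<le> 1"
    have "sqnorm n r \<le> sqnorm n (vsub n x (vadd n p (vscale n t q)))"
      using p(2)[OF that[OF t]] unfolding r_def sqnorm_diff_fun .
    also have "\<dots> = sqnorm n (vsub n r (vscale n t q))"
      unfolding r_def sqnorm_def by (intro sum.cong refl) (auto simp: vsub_def vadd_def vscale_def algebra_simps)
    also have "\<dots> = sqnorm n r - 2 * (t * ip n r q) + t\<^sup>2 * sqnorm n q" by (simp add: sqnorm_vsub)
    finally show "2 * (t * ip n r q) \<le> t\<^sup>2 * sqnorm n q" by simp
  qed
  show 1: "ip n (vsub n x p) q \<le> 0" if "q \<in> K" for q
    unfolding r_def[symmetric] using that p(1) by (intro var cone_vadd cone_vscale) auto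
  have "ip n r (vscale n (- 1) p) \<le> 0"
  proof (rule var)
    fix t :: real assume "0 < t" "t \<le> 1"
    moreover have "vadd n p (vscale n t (vscale n (- 1) p)) = vscale n (1 - t) p"
      by (rule ext) (auto simp: vadd_def vscale_def restrict_def algebra_simps)
    ultimately show "vadd n p (vscale n t (vscale n (- 1) p)) \<in> K"
      using p(1) by (auto intro!: cone_vscale)
  qed
  with 1[OF p(1)] show "ip n (vsub n x p) p = 0" by (simp add: r_def)
qed

text \<open>As \<open>proj\<close> is a definite description, uniqueness is settled first: adding
  the variational inequalities of two minimisers shows that their squared distance is at most
  0.\<close>

lemma proj_properties:
  shows proj_in: "proj n K x \<in> K"
    and proj_polar: "q \<in> K \<Longrightarrow> ip n (vsub n x (proj n K x)) q \<le> 0"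
    and proj_orth: "ip n (vsub n x (proj n K x)) (proj n K x) = 0"
proof -
  let ?P = "\<lambda>p. p \<in> K \<and> (\<forall>q\<in>K. sqnorm n (\<lambda>i. x i - p i) \<le> sqnorm n (\<lambda>i. x i - q i))"
  obtain p where p: "?P p" using minimizer_exists by blast
  have "p' = p" if p': "?P p'" for p'
  proof -
    have "sqnorm n (vsub n p p') = ip n (vsub n x p') p - ip n (vsub n x p') p' + ip n (vsub n x p) p' - ip n (vsub n x p) p"
      by (simp add: ip_self[symmetric] ip_commute[of n p' p])
    also have "\<dots> \<le> 0"
      using minimizer_variational(1)[of p' x p] minimizer_variational(1)[of p x p']
        minimizer_variational(2)[of p x] minimizer_variational(2)[of p' x] p p' by auto
    finally have "sqnorm n (vsub n p p') = 0" using sqnorm_nonneg[of n "vsub n p p'"] by linarith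
    then show ?thesis using p p' cone_subset
      by (simp add: sqnorm_eq_0_iff) (metis subsetD vsub_eq_zvec_iff)
  qed
  with p have "?P (proj n K x)" unfolding proj_def by (rule theI[of ?P])
  then show "proj n K x \<in> K" "q \<in> K \<Longrightarrow> ip n (vsub n x (proj n K x)) q \<le> 0" "ip n (vsub n x (proj n K x)) (proj n K x) = 0"
    using minimizer_variational[of "proj n K x" x] by auto
qed

text \<open>The residual pairs nonpositively with the cone, so only the pairing with the projection
  remains. Together with \<open>proj_support_attained\<close>, a nonzero projection norm is the
  maximum of a linear form over the unit vectors of the cone.\<close>

lemma proj_support:
  assumes "v \<in> usphere n K"
  shows "ip n v x \<le> sqrt (sqnorm n (proj n K x))"
proof -
  let ?p = "proj n K x"
  have "ip n v x = ip n (vsub n x ?p) v + ip n ?p v" by (simp add: ip_commute)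
  also have "\<dots> \<le> 0 + sqrt (sqnorm n ?p) * sqrt (sqnorm n v)"
    using assms by (intro add_mono proj_polar ip_le) (auto simp: usphere_def)
  finally show ?thesis using assms by (simp add: usphere_def)
qed

lemma ip_proj: "ip n (proj n K x) x = sqnorm n (proj n K x)"
  using proj_orth[of x] by (simp add: ip_self ip_commute)

lemma proj_support_attained:
  assumes "proj n K x \<noteq> zvec n"
  shows "\<exists>v\<in>usphere n K. ip n v x = sqrt (sqnorm n (proj n K x))"
proof (rule bexI[OF _ cone_unitvec[OF proj_in assms]])
  have "0 < sqnorm n (proj n K x)" using assms proj_in cone_subset by (intro sqnorm_pos) auto
  then show "ip n (unitvec n (proj n K x)) x = sqrt (sqnorm n (proj n K x))"
    by (simp add: unitvec_def ip_proj real_div_sqrt)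
qed

lemma polar_subset: "polar n K \<subseteq> rvec n" by (auto simp: polar_def)

lemma closed_polar: "closed (polar n K)"
proof -
  have "polar n K = rvec n \<inter> (\<Inter>l\<in>K. {v. ip n v l \<le> 0})" by (auto simp: polar_def)
  moreover have "closed {v. ip n v l \<le> 0}" for l
    by (intro closed_Collect_le continuous_on_ip continuous_on_const)
  ultimately show ?thesis using closed_rvec by (auto intro!: closed_INT)
qed

text \<open>Pythagoras. The residual is the projection onto the polar cone, so the polar projection
  norm can be written through \<open>proj n K\<close> alone.\<close>

lemma sqnorm_residual: "sqnorm n (vsub n x (proj n K x)) = sqnorm n x - sqnorm n (proj n K x)"
  by (simp add: sqnorm_vsub ip_commute[of n x] ip_proj)

lemma polar_support:
  assumes "v \<in> usphere n (polar n K)"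
  shows "ip n v x \<le> sqrt (sqnorm n x - sqnorm n (proj n K x))"
proof -
  let ?p = "proj n K x"
  have "ip n v x = ip n v (vsub n x ?p) + ip n v ?p" by simp
  also have "\<dots> \<le> sqrt (sqnorm n v) * sqrt (sqnorm n (vsub n x ?p)) + 0"
    using assms proj_in by (intro add_mono ip_le) (auto simp: usphere_def polar_def)
  finally show ?thesis using assms by (simp add: usphere_def sqnorm_residual)
qed

lemma polar_support_attained:
  assumes "sqnorm n x - sqnorm n (proj n K x) \<noteq> 0"
  shows "\<exists>v\<in>usphere n (polar n K). ip n v x = sqrt (sqnorm n x - sqnorm n (proj n K x))"
proof
  let ?r = "vsub n x (proj n K x)"
  have pos: "0 < sqnorm n ?r" using assms sqnorm_nonneg[of n ?r] by (simp add: sqnorm_residual)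
  have "ip n (unitvec n ?r) l \<le> 0" if "l \<in> K" for l
    unfolding unitvec_def ip_vscale by (intro mult_nonneg_nonpos proj_polar that) simp
  then show "unitvec n ?r \<in> usphere n (polar n K)"
    using sqnorm_unitvec[OF pos] by (auto simp: usphere_def polar_def unitvec_def)
  have "ip n ?r x = ip n ?r ?r + ip n ?r (proj n K x)" by simp
  also have "\<dots> = sqnorm n ?r" unfolding proj_orth ip_self by simp
  finally have "ip n ?r x = sqnorm n ?r" .
  then show "ip n (unitvec n ?r) x = sqrt (sqnorm n x - sqnorm n (proj n K x))"
    using pos by (simp add: unitvec_def real_div_sqrt sqnorm_residual del: ip_vsub)
qed

end

section \<open>Compact sets of unit vectors\<close>

text \<open>The measure space contains only functions extensional on \<open>B\<close>, whereas
  closedness refers to the product topology over all indices. Filling in \<open>undefined\<close>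
  outside \<open>B\<close> embeds one into the other, and for countably many indices the product and
  Borel sigma-algebras agree.\<close>

lemma closed_Int_space_in_sets:
  fixes C :: "('i :: countable \<Rightarrow> real) set"
  assumes "closed C"
  shows "C \<inter> space (gauss B) \<in> sets (gauss B)"
proof -
  let ?e = "\<lambda>\<omega> i. if i \<in> B then \<omega> i else undefined :: real"
  have "(\<lambda>\<omega>. ?e \<omega> i) \<in> borel_measurable (gauss B)" for i
    by (cases "i \<in> B") (simp_all add: borel_measurable_coord)
  then have e: "?e \<in> gauss B \<rightarrow>\<^sub>M PiM UNIV (\<lambda>_. borel)"
    by (rule measurable_abs_UNIV)
  have "C \<in> sets (PiM UNIV (\<lambda>_. borel))"
    unfolding sets_PiM_equal_borel using assms by (rule borel_closed)
  from measurable_sets[OF e this] have "?e -` C \<inter> space (gauss B) \<in> sets (gauss B)" .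
  moreover have "?e \<omega> = \<omega>" if "\<omega> \<in> space (gauss B)" for \<omega>
    using that by (auto simp: space_PiM PiE_def extensional_def)
  then have "?e -` C \<inter> space (gauss B) = C \<inter> space (gauss B)" by auto
  ultimately show ?thesis by simp
qed

lemma ip_net_le:
  assumes "v' \<in> V" "finite V" "sqnorm n (vsub n v v') \<le> \<epsilon>\<^sup>2" "0 \<le> \<epsilon>"
  shows "ip n v x \<le> gmax n V x + \<epsilon> * sqrt (sqnorm n x)"
proof -
  have "ip n v x = ip n v' x + ip n (vsub n v v') x" by simp
  also have "ip n (vsub n v v') x \<le> sqrt (sqnorm n (vsub n v v')) * sqrt (sqnorm n x)" by (rule ip_le)
  also have "\<dots> \<le> \<epsilon> * sqrt (sqnorm n x)"
    using assms by (intro mult_right_mono real_le_lsqrt) auto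
  also have "ip n v' x \<le> gmax n V x" unfolding gmax_def using assms by (intro Max_ge) auto
  finally show ?thesis by simp
qed

text \<open>A pointwise limit of maxima over finer and finer finite nets. Truncation at 0 covers the
  points where \<open>F\<close> vanishes although every form may be negative.\<close>

lemma borel_measurable_support:
  assumes T: "compact T" and unit: "\<And>v. v \<in> T \<Longrightarrow> sqnorm n v = 1"
    and F: "\<And>x. 0 \<le> F x" "\<And>x v. v \<in> T \<Longrightarrow> ip n v x \<le> F x" "\<And>x. F x \<noteq> 0 \<Longrightarrow> \<exists>v\<in>T. ip n v x = F x"
  shows "F \<in> borel_measurable (gauss {..<n})"
proof (cases "T = {}")
  case True
  then have "F = (\<lambda>_. 0)" using F(3) by auto
  then show ?thesis by simp
next
  case False
  have "\<exists>V. finite V \<and> V \<subseteq> T \<and> (\<forall>x\<in>T. \<exists>v\<in>V. sqnorm n (vsub n x v) \<le> (1 / real (Suc k))\<^sup>2)" for k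
    using finite_net[OF T, of "1 / real (Suc k)" n] by (metis zero_less_divide_1_iff of_nat_0_less_iff zero_less_Suc)
  then obtain V where V: "\<And>k. finite (V k)" "\<And>k. V k \<subseteq> T"
    "\<And>k x. x \<in> T \<Longrightarrow> \<exists>v\<in>V k. sqnorm n (vsub n x v) \<le> (1 / real (Suc k))\<^sup>2"
    by metis
  have ne: "V k \<noteq> {}" for k using V(3) False by blast
  have unitV: "sqnorm n v = 1" if "v \<in> V k" for v k using that V(2) unit by blast
  show ?thesis
  proof (rule borel_measurable_LIMSEQ_real)
    show "(\<lambda>x. max 0 (gmax n (V k) x)) \<in> borel_measurable (gauss {..<n})" for k
      by (intro borel_measurable_max borel_measurable_const borel_measurable_gmax V ne unitV)
    fix x :: "nat \<Rightarrow> real"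
    have up: "max 0 (gmax n (V k) x) \<le> F x" for k
    proof -
      obtain v where "v \<in> V k" "gmax n (V k) x = ip n v x"
        using gmax_attained[OF V(1) ne, of k n x] unitV[of _ k] by blast
      then show ?thesis using F(1)[of x] F(2)[of v x] V(2)[of k] by auto
    qed
    have low: "F x - 1 / real (Suc k) * sqrt (sqnorm n x) \<le> max 0 (gmax n (V k) x)" for k
    proof (cases "F x = 0")
      case False
      then obtain v where v: "v \<in> T" "ip n v x = F x" using F(3) by blast
      obtain v' where v': "v' \<in> V k" "sqnorm n (vsub n v v') \<le> (1 / real (Suc k))\<^sup>2" using V(3)[OF v(1)] by blast
      show ?thesis using ip_net_le[OF v'(1) V(1) v'(2), of x] v(2) by simp
    next
      case True
      then have "F x - 1 / real (Suc k) * sqrt (sqnorm n x) \<le> 0" by simp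
      then show ?thesis by (rule order_trans) simp
    qed
    have "(\<lambda>k. F x - 1 / real (Suc k) * sqrt (sqnorm n x)) \<longlonglongrightarrow> F x - 0 * sqrt (sqnorm n x)"
      by (intro tendsto_intros LIMSEQ_Suc[OF lim_1_over_n])
    then have lim: "(\<lambda>k. F x - 1 / real (Suc k) * sqrt (sqnorm n x)) \<longlonglongrightarrow> F x" by (simp only: mult_zero_left diff_zero)
    show "(\<lambda>k. max 0 (gmax n (V k) x)) \<longlonglongrightarrow> F x"
      by (rule tendsto_sandwich[OF always_eventually always_eventually lim tendsto_const]) (intro allI low up)+
  qed
qed

text \<open>Supplies the hypothesis \<open>close\<close> of \<open>gmax_mean_close\<close>: the
  first error comes from the net, the second from a supremum that falls short of
  \<open>F\<close>.\<close>

lemma net_gmax_close: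
  assumes V: "finite V" "V \<subseteq> T" and net: "\<And>x. x \<in> T \<Longrightarrow> \<exists>v\<in>V. sqnorm n (vsub n x v) \<le> \<epsilon>\<^sup>2" and "0 \<le> \<epsilon>"
    and F: "\<And>v. v \<in> T \<Longrightarrow> ip n v x \<le> F" "\<exists>v\<in>T. F - 2 * \<bar>ip n a x\<bar> \<le> ip n v x"
  shows "\<bar>F - gmax n V x\<bar> \<le> \<epsilon> * sqrt (sqnorm n x) + 2 * \<bar>ip n a x\<bar>"
proof -
  obtain v where v: "v \<in> T" "F - 2 * \<bar>ip n a x\<bar> \<le> ip n v x" using F(2) by blast
  obtain v' where v': "v' \<in> V" "sqnorm n (vsub n v v') \<le> \<epsilon>\<^sup>2" using net[OF v(1)] by blast
  have "gmax n V x \<in> (\<lambda>v. ip n v x) ` V" unfolding gmax_def using V v' by (intro Max_in) auto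
  then have "gmax n V x \<le> F" using F(1) V(2) by auto
  moreover have "F \<le> gmax n V x + \<epsilon> * sqrt (sqnorm n x) + 2 * \<bar>ip n a x\<bar>"
    using ip_net_le[OF v'(1) V(1) v'(2) \<open>0 \<le> \<epsilon>\<close>, of x] v(2) by linarith
  ultimately show ?thesis by linarith
qed

text \<open>By the covariance identity the coefficients of the increment have squared norm |x -
  x'|^2 |y|^2, and Cauchy-Schwarz applies. Only the first argument moves: a condition on all
  \<open>y\<close> restricts to a net without error.\<close>

lemma bilinear_lipschitz:
  fixes c :: "(nat \<Rightarrow> real) \<times> (nat \<Rightarrow> real) \<Rightarrow> 'b \<Rightarrow> real"
  assumes c: "\<And>x y x' y'. (\<Sum>b\<in>B. c (x, y) b * c (x', y') b) = ip n x x' * ip m y y'"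
  shows "(\<Sum>b\<in>B. c (x', y) b * \<xi> b) \<le> (\<Sum>b\<in>B. c (x, y) b * \<xi> b)
    + sqrt (sqnorm n (vsub n x x') * sqnorm m y) * sqrt (\<Sum>b\<in>B. (\<xi> b)\<^sup>2)"
proof -
  have "(\<Sum>b\<in>B. (c (x', y) b - c (x, y) b)\<^sup>2)
      = (\<Sum>b\<in>B. c (x', y) b * c (x', y) b) - 2 * (\<Sum>b\<in>B. c (x, y) b * c (x', y) b) + (\<Sum>b\<in>B. c (x, y) b * c (x, y) b)"
    by (simp add: power2_eq_square algebra_simps sum.distrib sum_subtractf sum_distrib_left)
  also have "\<dots> = sqnorm n (vsub n x x') * sqnorm m y"
    unfolding c by (simp add: ip_self sqnorm_vsub algebra_simps)
  finally have "(\<Sum>b\<in>B. (c (x', y) b - c (x, y) b) * \<xi> b)\<^sup>2 \<le> (sqnorm n (vsub n x x') * sqnorm m y) * (\<Sum>b\<in>B. (\<xi> b)\<^sup>2)"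
    using Cauchy_Schwarz_ineq_sum[of "\<lambda>b. c (x', y) b - c (x, y) b" \<xi> B] by simp
  from real_le_rsqrt[OF this] have "(\<Sum>b\<in>B. (c (x', y) b - c (x, y) b) * \<xi> b)
      \<le> sqrt (sqnorm n (vsub n x x') * sqnorm m y) * sqrt (\<Sum>b\<in>B. (\<xi> b)\<^sup>2)"
    by (simp add: real_sqrt_mult)
  then show ?thesis by (simp add: left_diff_distrib sum_subtractf)
qed

text \<open>Outside the event, controlled by Markov's inequality, that the Gaussian array is large,
  passing to finite nets changes the form only slightly.\<close>
lemma crossing_probability:
  fixes c :: "(nat \<Rightarrow> real) \<times> (nat \<Rightarrow> real) \<Rightarrow> 'b \<Rightarrow> real"
  assumes T: "compact T" "\<And>v. v \<in> T \<Longrightarrow> sqnorm n v = 1"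
    and U: "compact U" "\<And>v. v \<in> U \<Longrightarrow> sqnorm m v = 1"
    and ab: "sqnorm n a = 1" "sqnorm m b = 1"
    and FT: "F \<in> borel_measurable (gauss {..<n})" "\<And>x v. v \<in> T \<Longrightarrow> ip n v x \<le> F x" "\<And>x. \<exists>v\<in>T. F x - 2 * \<bar>ip n a x\<bar> \<le> ip n v x"
    and FU: "H \<in> borel_measurable (gauss {..<m})" "\<And>x v. v \<in> U \<Longrightarrow> ip m v x \<le> H x" "\<And>x. \<exists>v\<in>U. H x - 2 * \<bar>ip m b x\<bar> \<le> ip m v x"
    and B: "finite B" and l: "l > 0"
    and c: "\<And>x y x' y'. (\<Sum>b\<in>B. c (x, y) b * c (x', y') b) = ip n x x' * ip m y y'"
    and E: "E \<in> sets (gauss B)" "\<And>\<xi>. \<xi> \<in> E \<Longrightarrow> \<exists>x\<in>T. \<forall>y\<in>U. (\<Sum>b\<in>B. c (x, y) b * \<xi> b) \<le> 0"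
  shows "measure (gauss B) E \<le> exp (3 / 2 * l\<^sup>2
    + l * (sqrt (\<integral>\<xi>. (F \<xi>)\<^sup>2 \<partial>gauss {..<n}) - sqrt (\<integral>\<xi>. (H \<xi>)\<^sup>2 \<partial>gauss {..<m}) + 12))"
proof -
  let ?dT = "sqrt (\<integral>\<xi>. (F \<xi>)\<^sup>2 \<partial>gauss {..<n})" and ?dU = "sqrt (\<integral>\<xi>. (H \<xi>)\<^sup>2 \<partial>gauss {..<m})"
  let ?X = "exp (3 / 2 * l\<^sup>2 + l * (?dT - ?dU + 12))"
  have TU: "T \<noteq> {}" "U \<noteq> {}" using FT(3) FU(3) by auto
  \<comment> \<open>Adding \<open>n\<close> and \<open>m\<close> in the denominator makes the
    squared radius times either dimension at most 1, as \<open>gmax_mean_close\<close>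
    requires.\<close>
  define e where "e N = 1 / real (Suc (N + n + m))" for N
  have main: "measure (gauss B) E \<le> exp (l * sqrt (e N)) * ?X + e N * real (card B)" for N
  proof -
    define \<epsilon> where "\<epsilon> = e N"
    have \<epsilon>: "\<epsilon> > 0" "\<epsilon> \<le> 1" by (auto simp: \<epsilon>_def e_def)
    have "\<epsilon> * real n \<le> 1" "\<epsilon> * real m \<le> 1" by (auto simp: \<epsilon>_def e_def field_simps)
    then have \<epsilon>nm: "\<epsilon>\<^sup>2 * real n \<le> 1" "\<epsilon>\<^sup>2 * real m \<le> 1"
      using \<epsilon> mult_mono[of \<epsilon> 1 "\<epsilon> * real n" 1] mult_mono[of \<epsilon> 1 "\<epsilon> * real m" 1]
      by (auto simp: power2_eq_square mult.assoc)
    obtain V where V: "finite V" "V \<subseteq> T" "\<And>x. x \<in> T \<Longrightarrow> \<exists>v\<in>V. sqnorm n (vsub n x v) \<le> \<epsilon>\<^sup>2"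
      using finite_net[OF T(1) \<epsilon>(1)] by blast
    obtain W where W: "finite W" "W \<subseteq> U" "\<And>x. x \<in> U \<Longrightarrow> \<exists>v\<in>W. sqnorm m (vsub m x v) \<le> \<epsilon>\<^sup>2"
      using finite_net[OF U(1) \<epsilon>(1)] by blast
    have ne: "V \<noteq> {}" "W \<noteq> {}" using TU V(3) W(3) by blast+
    have uV: "\<And>v. v \<in> V \<Longrightarrow> sqnorm n v = 1" and uW: "\<And>v. v \<in> W \<Longrightarrow> sqnorm m v = 1"
      using V(2) W(2) T(2) U(2) by blast+
    have cT: "\<bar>?dT - (\<integral>\<xi>. gmax n V \<xi> \<partial>gauss {..<n})\<bar> \<le> 6"
      using \<epsilon> FT by (intro gmax_mean_close[OF V(1) ne(1) uV FT(1) ab(1) \<epsilon>nm(1)] net_gmax_close[OF V]) auto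
    have cU: "\<bar>?dU - (\<integral>\<xi>. gmax m W \<xi> \<partial>gauss {..<m})\<bar> \<le> 6"
      using \<epsilon> FU by (intro gmax_mean_close[OF W(1) ne(2) uW FU(1) ab(2) \<epsilon>nm(2)] net_gmax_close[OF W]) auto
    \<comment> \<open>Off \<open>?R\<close> the array has norm at most
      \<open>sqrt (1 / \<epsilon>)\<close>, so moving to a net point at distance
      \<open>\<epsilon>\<close> changes the form by at most \<open>sqrt \<epsilon>\<close>. Both
      this slack and the probability bound \<open>\<epsilon> * real (card B)\<close> for
      \<open>?R\<close> vanish in the limit.\<close>
    let ?A = "{\<xi> \<in> space (gauss B). \<exists>x\<in>V. \<forall>y\<in>W. (\<Sum>b\<in>B. c (x, y) b * \<xi> b) \<le> sqrt \<epsilon>}"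
    let ?R = "{\<xi> \<in> space (gauss B). (\<Sum>b\<in>B. (\<xi> b)\<^sup>2) \<ge> 1 / \<epsilon>}"
    have A: "?A \<in> sets (gauss B)"
      using V(1) W(1) by (intro sets.sets_Collect_finite_Ex sets.sets_Collect_finite_All borel_measurable_le
        borel_measurable_linear_form borel_measurable_const)
    have R: "?R \<in> sets (gauss B)"
      by (intro borel_measurable_le borel_measurable_sum borel_measurable_power borel_measurable_coord borel_measurable_const)
    have "E \<subseteq> ?A \<union> ?R"
    proof
      fix \<xi> assume \<xi>: "\<xi> \<in> E"
      then have sp: "\<xi> \<in> space (gauss B)" using sets.sets_into_space[OF E(1)] by auto
      obtain x where x: "x \<in> T" "\<And>y. y \<in> U \<Longrightarrow> (\<Sum>b\<in>B. c (x, y) b * \<xi> b) \<le> 0" using E(2)[OF \<xi>] by blast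
      obtain x' where x': "x' \<in> V" "sqnorm n (vsub n x x') \<le> \<epsilon>\<^sup>2" using V(3)[OF x(1)] by blast
      show "\<xi> \<in> ?A \<union> ?R"
      proof (cases "\<xi> \<in> ?R")
        case False
        then have s: "(\<Sum>b\<in>B. (\<xi> b)\<^sup>2) \<le> 1 / \<epsilon>" using sp by auto
        have "(\<Sum>b\<in>B. c (x', y) b * \<xi> b) \<le> sqrt \<epsilon>" if y: "y \<in> W" for y
        proof -
          have "(\<Sum>b\<in>B. c (x', y) b * \<xi> b) \<le> 0 + sqrt (\<epsilon>\<^sup>2 * 1) * sqrt (1 / \<epsilon>)"
            using x(2)[of y] y W(2) uW[OF y] x'(2) s \<epsilon>
            by (intro order_trans[OF bilinear_lipschitz[OF c, of x' y \<xi> x]] add_mono mult_mono real_sqrt_le_mono) (auto simp: sum_nonneg)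
          also have "\<dots> = sqrt \<epsilon>"
            using \<epsilon> by (simp add: real_sqrt_divide real_div_sqrt)
          finally show ?thesis .
        qed
        then show ?thesis using sp x'(1) by auto
      qed auto
    qed
    then have "measure (gauss B) E \<le> measure (gauss B) (?A \<union> ?R)"
      using A R by (intro gauss.P.finite_measure_mono) auto
    also have "\<dots> \<le> measure (gauss B) ?A + measure (gauss B) ?R"
      using A R by (rule measure_Un_le)
    also have "measure (gauss B) ?A \<le> exp (l * sqrt \<epsilon> + 3 / 2 * l\<^sup>2 + l * ((\<integral>\<xi>. gmax n V \<xi> \<partial>gauss {..<n}) - (\<integral>\<xi>. gmax m W \<xi> \<partial>gauss {..<m})))"
      by (rule gordon_probability[OF V(1) ne(1) uV W(1) ne(2) uW B l c])
    also have "\<dots> \<le> exp (l * sqrt \<epsilon> + (3 / 2 * l\<^sup>2 + l * (?dT - ?dU + 12)))"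
    proof -
      have "(\<integral>\<xi>. gmax n V \<xi> \<partial>gauss {..<n}) - (\<integral>\<xi>. gmax m W \<xi> \<partial>gauss {..<m}) \<le> ?dT - ?dU + 12"
        using cT cU by linarith
      then show ?thesis using l by simp
    qed
    also have "\<dots> = exp (l * sqrt \<epsilon>) * ?X" by (rule exp_add)
    also have "measure (gauss B) ?R \<le> (\<integral>\<xi>. (\<Sum>b\<in>B. (\<xi> b)\<^sup>2) \<partial>gauss B) / (1 / \<epsilon>)"
      using \<epsilon> gauss_sum_squares(1)[OF B]
      by (intro integral_Markov_inequality_measure[of _ _ "{}"]) (auto simp: sum_nonneg)
    also have "\<dots> = \<epsilon> * real (card B)" using gauss_sum_squares(2)[OF B] by simp
    finally show ?thesis unfolding \<epsilon>_def by simp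
  qed
  have "e \<longlonglongrightarrow> 0"
  proof -
    have "(\<lambda>N. 1 / real (Suc (N + (n + m)))) \<longlonglongrightarrow> 0"
      using LIMSEQ_ignore_initial_segment[OF LIMSEQ_Suc[OF lim_1_over_n[where 'a=real]], of "n + m"] by simp
    then show ?thesis unfolding e_def[abs_def] by (simp add: add.assoc)
  qed
  then have "(\<lambda>N. exp (l * sqrt (e N)) * ?X + e N * real (card B)) \<longlonglongrightarrow> exp (l * sqrt 0) * ?X + 0 * real (card B)"
    by (intro tendsto_intros)
  from tendsto_lowerbound[OF this, of "measure (gauss B) E"] main show ?thesis by simp
qed

section \<open>The phase transition\<close>

lemma matvec_coord: "i < m \<Longrightarrow> matvec m n G x i = (\<Sum>j<n. G (i, j) * x j)"
  by (simp add: matvec_def)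

lemma matvec_in_rvec [simp]: "matvec m n G x \<in> rvec m"
  by (simp add: matvec_def rvec_def)

lemma matvec_vadd: "matvec m n G (vadd n x y) = vadd m (matvec m n G x) (matvec m n G y)"
  by (rule ext) (auto simp: matvec_def vadd_def restrict_def distrib_left sum.distrib)

lemma matvec_vscale: "matvec m n G (vscale n c x) = vscale m c (matvec m n G x)"
  by (rule ext) (auto simp: matvec_def vscale_def restrict_def sum_distrib_left mult_ac)

lemma matvec_zvec [simp]: "matvec m n G (zvec n) = zvec m"
  by (rule ext) (auto simp: matvec_def zvec_def restrict_def)

lemma ip_matvec: "ip m y (matvec m n G x) = (\<Sum>b\<in>{..<m} \<times> {..<n}. (y (fst b) * x (snd b)) * G b)"
proof -
  have "ip m y (matvec m n G x) = (\<Sum>i<m. \<Sum>j<n. (y i * x j) * G (i, j))"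
    by (simp add: ip_def matvec_coord sum_distrib_left mult_ac)
  then show ?thesis by (simp add: sum.cartesian_product')
qed

text \<open>The inner product of two rank-one matrices; this supplies the covariance hypothesis of
  \<open>crossing_probability\<close>.\<close>

lemma rank_one_covariance:
  "(\<Sum>b\<in>{..<m} \<times> {..<n}. (y (fst b) * x (snd b)) * (y' (fst b) * x' (snd b))) = ip n x x' * ip m y y'"
proof -
  have "ip n x x' * ip m y y' = (\<Sum>i<m. \<Sum>j<n. (y i * y' i) * (x j * x' j))"
    unfolding ip_def by (subst mult.commute) (rule sum_product)
  then show ?thesis by (simp add: sum.cartesian_product' mult_ac)
qed

lemma tendsto_matvec:
  assumes "G \<longlonglongrightarrow> G0" "x \<longlonglongrightarrow> x0"
  shows "(\<lambda>k. matvec m n (G k) (x k)) \<longlonglongrightarrow> matvec m n G0 x0"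
proof (rule tendsto_fun)
  fix i
  have "(\<lambda>k. \<Sum>j<n. G k (i, j) * x k j) \<longlonglongrightarrow> (\<Sum>j<n. G0 (i, j) * x0 j)"
    by (intro tendsto_sum tendsto_mult tendsto_coord assms)
  then show "(\<lambda>k. matvec m n (G k) (x k) i) \<longlonglongrightarrow> matvec m n G0 x0 i"
    by (cases "i < m") (simp_all add: matvec_def)
qed

text \<open>This serves the measurability of the event. Witnesses for a convergent sequence of
  matrices have a limit point in the compact set \<open>T\<close>, which is a witness for the limit
  matrix.\<close>

lemma closed_hitting_set:
  assumes T: "compact T" and L: "closed L"
  shows "closed {G :: nat \<times> nat \<Rightarrow> real. \<exists>x\<in>T. matvec m n G x \<in> L}"
  unfolding closed_sequential_limits
proof (intro allI impI, elim conjE)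
  fix G :: "nat \<Rightarrow> nat \<times> nat \<Rightarrow> real" and G0
  assume "\<forall>k. G k \<in> {G. \<exists>x\<in>T. matvec m n G x \<in> L}" and lim: "G \<longlonglongrightarrow> G0"
  then have "\<forall>k. \<exists>x. x \<in> T \<and> matvec m n (G k) x \<in> L" by blast
  then obtain x where x: "\<And>k. x k \<in> T" "\<And>k. matvec m n (G k) (x k) \<in> L" by metis
  obtain x0 r where r: "x0 \<in> T" "strict_mono r" "(x \<circ> r) \<longlonglongrightarrow> x0"
    using compact_imp_seq_compact[OF T] x(1) unfolding seq_compact_def by blast
  have "(\<lambda>k. matvec m n ((G \<circ> r) k) ((x \<circ> r) k)) \<longlonglongrightarrow> matvec m n G0 x0"
    by (intro tendsto_matvec r(3) LIMSEQ_subseq_LIMSEQ[OF lim r(2)])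
  then have "matvec m n G0 x0 \<in> L"
    using closed_sequentially[OF L, of "\<lambda>k. matvec m n ((G \<circ> r) k) ((x \<circ> r) k)"] x(2) by simp
  then show "G0 \<in> {G. \<exists>x\<in>T. matvec m n G x \<in> L}" using r(1) by blast
qed

lemma nontrivial_intersection_iff:
  assumes K: "closed_convex_cone n K" and L: "closed_convex_cone m L"
  shows "K \<inter> preimg m n G L \<noteq> {zvec n} \<longleftrightarrow> (\<exists>x\<in>usphere n K. matvec m n G x \<in> L)"
proof
  have z: "zvec n \<in> K \<inter> preimg m n G L"
    using cone_zvec[OF K] cone_zvec[OF L] by (simp add: preimg_def)
  assume "K \<inter> preimg m n G L \<noteq> {zvec n}"
  then obtain x where x: "x \<in> K" "matvec m n G x \<in> L" "x \<noteq> zvec n"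
    using z by (auto simp: preimg_def)
  have "matvec m n G (unitvec n x) \<in> L"
    unfolding unitvec_def matvec_vscale by (intro cone_vscale[OF L] x) simp
  then show "\<exists>x\<in>usphere n K. matvec m n G x \<in> L" using cone_unitvec[OF K x(1,3)] by blast
next
  assume "\<exists>x\<in>usphere n K. matvec m n G x \<in> L"
  then obtain x where x: "x \<in> K" "sqnorm n x = 1" "matvec m n G x \<in> L" by (auto simp: usphere_def)
  then have "x \<in> K \<inter> preimg m n G L" using cone_subset[OF K] by (auto simp: preimg_def)
  moreover have "x \<noteq> zvec n" using x(2) by auto
  ultimately show "K \<inter> preimg m n G L \<noteq> {zvec n}" by auto
qed

text \<open>A difference of closed cones need not be closed in general. Here |G x - l|^2 is at least
  a positive multiple of |x|^2: otherwise normalised counterexamples would converge to a unit vector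
  of \<open>K\<close> that \<open>G\<close> maps into \<open>L\<close>. Hence x stays bounded when G
  x - l converges, a subsequence of x converges, and l follows.\<close>

lemma closed_cone_difference:
  assumes K: "closed_convex_cone n K" and L: "closed_convex_cone m L"
    and triv: "\<And>x. x \<in> usphere n K \<Longrightarrow> matvec m n G x \<notin> L"
  shows "closed_convex_cone m {vsub m (matvec m n G x) l | x l. x \<in> K \<and> l \<in> L}" (is "closed_convex_cone m ?D")
proof -
  have T: "compact (usphere n K)" by (rule compact_usphere[OF cone_closed[OF K] cone_subset[OF K]])
  have "\<exists>c>0. \<forall>x\<in>K. \<forall>l\<in>L. c * sqnorm n x \<le> sqnorm m (vsub m (matvec m n G x) l)"
  proof (rule ccontr)
    assume "\<not> ?thesis"
    then have "\<exists>x l. x \<in> K \<and> l \<in> L \<and> sqnorm m (vsub m (matvec m n G x) l) < 1 / real (Suc k) * sqnorm n x" for k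
      by (meson not_le of_nat_0_less_iff zero_less_Suc zero_less_divide_1_iff)
    then obtain x l where xl: "\<And>k. x k \<in> K" "\<And>k. l k \<in> L"
      "\<And>k. sqnorm m (vsub m (matvec m n G (x k)) (l k)) < 1 / real (Suc k) * sqnorm n (x k)" by metis
    define s where "s k = 1 / sqrt (sqnorm n (x k))" for k
    have pos: "0 < sqnorm n (x k)" for k
      using order_le_less_trans[OF sqnorm_nonneg xl(3)[of k]] by (simp add: zero_less_divide_iff)
    have x1: "unitvec n (x k) \<in> usphere n K" for k
      using cone_unitvec[OF K xl(1)] pos[of k] by (metis less_irrefl sqnorm_zvec)
    have l1: "vscale m (s k) (l k) \<in> L" for k
      unfolding s_def by (intro cone_vscale[OF L] xl(2)) simp
    have small: "sqnorm m (vsub m (matvec m n G (unitvec n (x k))) (vscale m (s k) (l k))) \<le> 1 / real (Suc k)" for k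
    proof -
      have "vsub m (matvec m n G (unitvec n (x k))) (vscale m (s k) (l k)) = vscale m (s k) (vsub m (matvec m n G (x k)) (l k))"
        unfolding unitvec_def s_def[symmetric] matvec_vscale
        by (rule ext) (auto simp: vsub_def vscale_def restrict_def right_diff_distrib)
      then have "sqnorm m (vsub m (matvec m n G (unitvec n (x k))) (vscale m (s k) (l k)))
          = (s k)\<^sup>2 * sqnorm m (vsub m (matvec m n G (x k)) (l k))" by simp
      also have "\<dots> \<le> (s k)\<^sup>2 * (1 / real (Suc k) * sqnorm n (x k))"
        using less_imp_le[OF xl(3)] by (intro mult_left_mono) auto
      also have "\<dots> = 1 / real (Suc k)" using pos[of k] by (simp add: s_def power_divide)
      finally show ?thesis .
    qed
    obtain x0 r where r: "x0 \<in> usphere n K" "strict_mono r" "((\<lambda>k. unitvec n (x k)) \<circ> r) \<longlonglongrightarrow> x0"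
      using compact_imp_seq_compact[OF T] x1 unfolding seq_compact_def by metis
    have mv: "(\<lambda>k. matvec m n G (unitvec n (x (r k)))) \<longlonglongrightarrow> matvec m n G x0"
      using tendsto_matvec[OF tendsto_const[of G] r(3)] by (simp add: comp_def)
    have "(\<lambda>k. vscale m (s (r k)) (l (r k))) \<longlonglongrightarrow> matvec m n G x0"
    proof (rule tendsto_fun)
      fix i
      show "(\<lambda>k. vscale m (s (r k)) (l (r k)) i) \<longlonglongrightarrow> matvec m n G x0 i"
      proof (cases "i < m")
        case True
        let ?d = "\<lambda>k. vsub m (matvec m n G (unitvec n (x (r k)))) (vscale m (s (r k)) (l (r k)))"
        have sq: "(?d k i)\<^sup>2 \<le> 1 / real (Suc (r k))" for k
        proof -
          have "(?d k i)\<^sup>2 \<le> sqnorm m (?d k)" unfolding sqnorm_def using True by (intro member_le_sum) auto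
          then show ?thesis using small[of "r k"] by linarith
        qed
        have lim0: "(\<lambda>k. 1 / real (Suc (r k))) \<longlonglongrightarrow> 0"
          using LIMSEQ_subseq_LIMSEQ[OF LIMSEQ_Suc[OF lim_1_over_n[where 'a=real]] r(2)] by (simp add: comp_def)
        have "(\<lambda>k. (?d k i)\<^sup>2) \<longlonglongrightarrow> 0"
          by (rule tendsto_sandwich[OF always_eventually always_eventually tendsto_const[of 0] lim0])
            (intro allI zero_le_power2 sq)+
        then have "(\<lambda>k. ?d k i) \<longlonglongrightarrow> 0" by (simp add: tendsto_null_power)
        from tendsto_diff[OF tendsto_coord[OF mv, of i] this] show ?thesis
          using True by (simp add: vsub_def)
      qed (simp add: vscale_def matvec_def)
    qed
    then have "matvec m n G x0 \<in> L"
      using closed_sequentially[OF cone_closed[OF L], of "\<lambda>k. vscale m (s (r k)) (l (r k))"] l1 by simp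
    then show False using triv[OF r(1)] by simp
  qed
  then obtain c where c: "c > 0" "\<And>x l. x \<in> K \<Longrightarrow> l \<in> L \<Longrightarrow> c * sqnorm n x \<le> sqnorm m (vsub m (matvec m n G x) l)"
    by blast
  have closed: "closed ?D"
    unfolding closed_sequential_limits
  proof (intro allI impI, elim conjE)
    fix d d0 assume "\<forall>k. d k \<in> ?D" and lim: "d \<longlonglongrightarrow> d0"
    then have "\<forall>k. \<exists>x l. d k = vsub m (matvec m n G x) l \<and> x \<in> K \<and> l \<in> L" by blast
    then obtain x l where xl: "\<And>k. d k = vsub m (matvec m n G (x k)) (l k)" "\<And>k. x k \<in> K" "\<And>k. l k \<in> L" by metis
    have "(\<lambda>k. sqnorm m (d k)) \<longlonglongrightarrow> sqnorm m d0"
      unfolding sqnorm_def by (intro tendsto_intros tendsto_coord lim)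
    then have "Bseq (\<lambda>k. sqnorm m (d k))" by (intro convergent_imp_Bseq convergentI)
    then obtain M where M: "\<And>k. sqnorm m (d k) \<le> M" unfolding Bseq_def by (auto simp: abs_le_iff)
    have xM: "sqnorm n (x k) \<le> M / c" for k
      using c(2)[OF xl(2,3), of k k] M[of k] c(1) unfolding xl(1)[symmetric] by (simp add: field_simps)
    have "closed (K \<inter> {x. sqnorm n x \<le> M / c})"
      by (intro closed_Int cone_closed[OF K] closed_Collect_le continuous_on_sqnorm continuous_on_const)
    then have cpt: "compact (K \<inter> {x. sqnorm n x \<le> M / c})"
      using cone_subset[OF K] by (intro compact_rvec[of _ n "M / c"]) auto
    obtain x0 r where r: "x0 \<in> K" "strict_mono r" "(x \<circ> r) \<longlonglongrightarrow> x0"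
      using compact_imp_seq_compact[OF cpt] xl(2) xM unfolding seq_compact_def by (metis (no_types, lifting) IntD1 IntI mem_Collect_eq)
    have mv: "(\<lambda>k. matvec m n G (x (r k))) \<longlonglongrightarrow> matvec m n G x0"
      using tendsto_matvec[OF tendsto_const[of G] r(3)] by (simp add: comp_def)
    have dr: "(\<lambda>k. d (r k)) \<longlonglongrightarrow> d0" using LIMSEQ_subseq_LIMSEQ[OF lim r(2)] by (simp add: comp_def)
    have d0: "d0 \<in> rvec m"
      using closed_sequentially[OF closed_rvec[of m] _ lim] xl(1) by simp
    have leq: "l k = vsub m (matvec m n G (x k)) (d k)" for k
      using cone_subset[OF L] xl(3)[of k] unfolding xl(1) by (intro ext_rvec[of _ m] vec_in_rvec) (auto simp: vsub_def)
    have "(\<lambda>k. l (r k)) \<longlonglongrightarrow> vsub m (matvec m n G x0) d0"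
    proof (rule tendsto_fun)
      fix i
      show "(\<lambda>k. l (r k) i) \<longlonglongrightarrow> vsub m (matvec m n G x0) d0 i"
        using tendsto_diff[OF tendsto_coord[OF mv, of i] tendsto_coord[OF dr, of i]]
        unfolding leq by (cases "i < m") (simp_all add: vsub_def)
    qed
    then have l0: "vsub m (matvec m n G x0) d0 \<in> L"
      using closed_sequentially[OF cone_closed[OF L], of "\<lambda>k. l (r k)"] xl(3) by simp
    have "d0 = vsub m (matvec m n G x0) (vsub m (matvec m n G x0) d0)"
      using d0 by (intro ext_rvec[of _ m] vec_in_rvec) (auto simp: vsub_def)
    then show "d0 \<in> ?D" using r(1) l0 by blast
  qed
  have scale: "vscale m a d \<in> ?D" if d: "d \<in> ?D" and a: "0 \<le> a" for a d
  proof -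
    obtain x l where "d = vsub m (matvec m n G x) l" "x \<in> K" "l \<in> L" using d by blast
    moreover have "vscale m a (vsub m (matvec m n G x) l) = vsub m (matvec m n G (vscale n a x)) (vscale m a l)" for x l
      unfolding matvec_vscale by (rule ext) (auto simp: vsub_def vscale_def restrict_def right_diff_distrib)
    ultimately show ?thesis using cone_vscale[OF K _ a] cone_vscale[OF L _ a] by blast
  qed
  have add: "vadd m d d' \<in> ?D" if d: "d \<in> ?D" "d' \<in> ?D" for d d'
  proof -
    obtain x l where "d = vsub m (matvec m n G x) l" "x \<in> K" "l \<in> L" using d(1) by blast
    moreover obtain x' l' where "d' = vsub m (matvec m n G x') l'" "x' \<in> K" "l' \<in> L" using d(2) by blast
    moreover have "vadd m (vsub m (matvec m n G x) l) (vsub m (matvec m n G x') l')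
       = vsub m (matvec m n G (vadd n x x')) (vadd m l l')" for x l x' l'
      unfolding matvec_vadd by (rule ext) (auto simp: vsub_def vadd_def restrict_def)
    ultimately show ?thesis using cone_vadd[OF K] cone_vadd[OF L] by blast
  qed
  show ?thesis unfolding closed_convex_cone_def
  proof (intro conjI ballI allI impI)
    show "?D \<subseteq> rvec m" by auto
    have "zvec m = vsub m (matvec m n G (zvec n)) (zvec m)"
      using vsub_eq_zvec_iff[of "zvec m" m "zvec m"] by simp
    then show "zvec m \<in> ?D" using cone_zvec[OF K] cone_zvec[OF L] by blast
    show "closed ?D" by (rule closed)
    show "restrict (\<lambda>i. a * d i) {..<m} \<in> ?D" if "d \<in> ?D" "0 \<le> a" for a d
      using scale[OF that] by (simp only: vscale_def)
    show "restrict (\<lambda>i. u * d i + (1 - u) * d' i) {..<m} \<in> ?D" if "d \<in> ?D" "d' \<in> ?D" "0 \<le> u \<and> u \<le> 1" for u d d'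
    proof -
      have "restrict (\<lambda>i. u * d i + (1 - u) * d' i) {..<m} = vadd m (vscale m u d) (vscale m (1 - u) d')"
        by (rule ext) (auto simp: vadd_def vscale_def restrict_def)
      moreover have "vadd m (vscale m u d) (vscale m (1 - u) d') \<in> ?D"
        using that by (intro add scale) auto
      ultimately show ?thesis by (simp only:)
    qed
  qed
qed

text \<open>If \<open>K\<close> is not a linear subspace, then trivial intersection forces \<open>- G k0\<close> out of the closed cone
  \<open>G K - L\<close>, and the normalised residual of its projection is the separating functional.\<close>
lemma trivial_intersection_separation:
  assumes K: "closed_convex_cone n K" and L: "closed_convex_cone m L"
    and k0: "k0 \<in> K" "vscale n (- 1) k0 \<notin> K"
    and triv: "\<And>x. x \<in> usphere n K \<Longrightarrow> matvec m n G x \<notin> L"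
  shows "\<exists>v\<in>usphere m (polar m L). \<forall>y\<in>K. 0 \<le> ip m v (matvec m n G y)"
proof -
  let ?D = "{vsub m (matvec m n G x) l | x l. x \<in> K \<and> l \<in> L}"
  have D: "closed_convex_cone m ?D" by (rule closed_cone_difference[OF K L triv])
  define w where "w = matvec m n G (vscale n (- 1) k0)"
  \<comment> \<open>If - G k0 were G x - l, then \<open>G\<close> would map x + k0 into
    \<open>L\<close>; this vector of \<open>K\<close> is nonzero because - k0 is not in
    \<open>K\<close>.\<close>
  have "w \<notin> ?D"
  proof
    assume "w \<in> ?D"
    then obtain x l where x: "w = vsub m (matvec m n G x) l" "x \<in> K" "l \<in> L" by blast
    have "matvec m n G (vadd n x k0) = l"
    proof (rule ext_rvec[of _ m])
      show "l \<in> rvec m" using x(3) cone_subset[OF L] by auto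
      fix i assume i: "i < m"
      have "w i = - matvec m n G k0 i" unfolding w_def matvec_vscale using i by (simp add: vscale_def)
      moreover have "matvec m n G (vadd n x k0) i = matvec m n G x i + matvec m n G k0 i"
        unfolding matvec_vadd using i by (simp add: vadd_def)
      ultimately show "matvec m n G (vadd n x k0) i = l i"
        using i fun_cong[OF x(1), of i] by (simp add: vsub_def)
    qed simp
    moreover have "vadd n x k0 \<in> K" by (rule cone_vadd[OF K x(2) k0(1)])
    moreover have "vadd n x k0 \<noteq> zvec n"
    proof
      assume z: "vadd n x k0 = zvec n"
      have "x = vscale n (- 1) k0"
      proof (rule ext_rvec[of _ n])
        show "x \<in> rvec n" using x(2) cone_subset[OF K] by auto
        fix i assume "i < n"
        then show "x i = vscale n (- 1) k0 i" using fun_cong[OF z, of i] by (simp add: vadd_def vscale_def zvec_def)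
      qed simp
      then show False using x(2) k0(2) by simp
    qed
    ultimately show False
      using triv nontrivial_intersection_iff[OF K L, of G] x(3) by (auto simp: preimg_def)
  qed
  define \<rho> where "\<rho> = vsub m w (proj m ?D w)"
  have "\<rho> \<noteq> zvec m"
  proof
    assume "\<rho> = zvec m"
    then have "w = proj m ?D w"
      using proj_in[OF D, of w] cone_subset[OF D] unfolding \<rho>_def w_def by (subst (asm) vsub_eq_zvec_iff) auto
    then show False using proj_in[OF D, of w] \<open>w \<notin> ?D\<close> by simp
  qed
  then have pos: "0 < sqnorm m \<rho>" by (intro sqnorm_pos) (simp_all add: \<rho>_def)
  have pol: "ip m \<rho> d \<le> 0" if "d \<in> ?D" for d
    unfolding \<rho>_def by (rule proj_polar[OF D that])
  \<comment> \<open>The residual is nonpositive on G K and on - L, so its negative is nonpositive on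
    \<open>L\<close> and nonnegative on G K.\<close>
  define v where "v = vscale m (- 1) (unitvec m \<rho>)"
  have v: "ip m v z = - (ip m \<rho> z / sqrt (sqnorm m \<rho>))" for z
    by (simp add: v_def unitvec_def)
  have "ip m v l \<le> 0" if "l \<in> L" for l
  proof -
    have "ip m \<rho> (vsub m (matvec m n G (zvec n)) l) \<le> 0" using that cone_zvec[OF K] by (intro pol) blast
    then have "0 \<le> ip m \<rho> l" by simp
    then show ?thesis unfolding v by simp
  qed
  moreover have "0 \<le> ip m v (matvec m n G y)" if "y \<in> K" for y
  proof -
    have "ip m \<rho> (vsub m (matvec m n G y) (zvec m)) \<le> 0" using that cone_zvec[OF L] by (intro pol) blast
    then have "ip m \<rho> (matvec m n G y) \<le> 0" by simp
    then show ?thesis unfolding v by (simp add: divide_nonpos_nonneg)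
  qed
  moreover have "sqnorm m v = 1" using sqnorm_unitvec[OF pos] by (simp add: v_def)
  ultimately show ?thesis unfolding usphere_def polar_def by (intro bexI[of _ v]) (auto simp: v_def)
qed

text \<open>When the projection vanishes every form may be negative, but the one of \<open>a\<close>
  misses 0 by at most its absolute value. The factor 2 matches the bound of
  \<open>subspace_halfspace_support\<close>.\<close>

lemma cone_support_lower:
  assumes K: "closed_convex_cone n K" and a: "a \<in> usphere n K"
  shows "\<exists>v\<in>usphere n K. sqrt (sqnorm n (proj n K x)) - 2 * \<bar>ip n a x\<bar> \<le> ip n v x"
proof (cases "proj n K x = zvec n")
  case True
  then show ?thesis using a by (intro bexI[of _ a]) auto
next
  case False
  from proj_support_attained[OF K False] show ?thesis by force
qed

lemma polar_support_lower:
  assumes K: "closed_convex_cone n K" and a: "a \<in> usphere n (polar n K)"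
  shows "\<exists>v\<in>usphere n (polar n K). sqrt (sqnorm n x - sqnorm n (proj n K x)) - 2 * \<bar>ip n a x\<bar> \<le> ip n v x"
proof (cases "sqnorm n x - sqnorm n (proj n K x) = 0")
  case True
  then show ?thesis using a by (intro bexI[of _ a]) auto
next
  case False
  from polar_support_attained[OF K False] show ?thesis by force
qed

text \<open>If the projection p has a negative component s along \<open>a\<close>, removing it gives
  a point q of the half-space with |q|^2 = |p|^2 - s^2, so the norm drops by at most |s|. If nothing
  is left, p is a negative multiple of \<open>a\<close>, and \<open>a\<close> itself loses exactly 2
  |s|; this is the origin of the factor 2.\<close>

lemma subspace_halfspace_support:
  assumes K: "closed_convex_cone n K" and sub: "\<And>x. x \<in> K \<Longrightarrow> vscale n (- 1) x \<in> K"
    and a: "a \<in> usphere n K"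
  shows "\<exists>v\<in>usphere n {x \<in> K. 0 \<le> ip n a x}. sqrt (sqnorm n (proj n K x)) - 2 * \<bar>ip n a x\<bar> \<le> ip n v x"
proof -
  define p where "p = proj n K x"
  define s where "s = ip n a p"
  have aK: "a \<in> K" "sqnorm n a = 1" using a by (auto simp: usphere_def)
  have pK: "p \<in> K" unfolding p_def by (rule proj_in[OF K])
  \<comment> \<open>Both \<open>a\<close> and its negative lie in \<open>K\<close>, so the residual
    is orthogonal to \<open>a\<close>.\<close>
  have ax: "ip n a x = s"
    using proj_polar[OF K aK(1), of x] proj_polar[OF K sub[OF aK(1)], of x]
    unfolding s_def p_def by (simp add: ip_commute[of n a])
  have px: "ip n p x = sqnorm n p" unfolding p_def by (rule ip_proj[OF K])
  have am: "a \<in> usphere n {x \<in> K. 0 \<le> ip n a x}" using aK by (simp add: usphere_def ip_self)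
  show ?thesis
  proof (cases "0 \<le> s")
    case True
    show ?thesis
    proof (cases "p = zvec n")
      case True
      then show ?thesis using am by (intro bexI[of _ a]) (auto simp: p_def)
    next
      case False
      have pos: "0 < sqnorm n p" using False pK cone_subset[OF K] by (intro sqnorm_pos) auto
      have "unitvec n p \<in> usphere n {x \<in> K. 0 \<le> ip n a x}"
        using cone_unitvec[OF K pK False] True by (auto simp: usphere_def unitvec_def s_def)
      moreover have "ip n (unitvec n p) x = sqrt (sqnorm n p)"
        using pos by (simp add: unitvec_def px real_div_sqrt)
      ultimately show ?thesis unfolding p_def[symmetric] by (intro bexI[of _ "unitvec n p"]) auto
    qed
  next
    case False
    define q where "q = vadd n p (vscale n (- s) a)"
    have qK: "q \<in> K" unfolding q_def using False pK aK by (intro cone_vadd[OF K] cone_vscale[OF K]) auto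
    have aq: "ip n a q = 0" using aK by (simp add: q_def s_def ip_self)
    have qn: "sqnorm n q = sqnorm n p - s\<^sup>2"
      using aK by (simp add: q_def sqnorm_vadd s_def ip_commute[of n p a] power2_eq_square algebra_simps)
    have qx: "ip n q x = sqnorm n q"
      unfolding qn by (simp add: q_def px ax power2_eq_square)
    have s2: "s\<^sup>2 \<le> sqnorm n p" using qn sqnorm_nonneg[of n q] by linarith
    then have s1: "\<bar>s\<bar> \<le> sqrt (sqnorm n p)" by (intro real_le_rsqrt) simp
    show ?thesis
    proof (cases "q = zvec n")
      case True
      then have "sqrt (sqnorm n p) = \<bar>s\<bar>" using qn by simp
      then show ?thesis using am False unfolding p_def[symmetric] ax by (intro bexI[of _ a]) (auto simp: ax)
    next
      case False
      have pos: "0 < sqnorm n q" using False qK cone_subset[OF K] by (intro sqnorm_pos) auto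
      have "unitvec n q \<in> usphere n {x \<in> K. 0 \<le> ip n a x}"
        using cone_unitvec[OF K qK False] aq by (auto simp: usphere_def unitvec_def)
      moreover have "ip n (unitvec n q) x = sqrt (sqnorm n q)"
        using pos by (simp add: unitvec_def qx real_div_sqrt)
      moreover have "sqrt (sqnorm n p) - \<bar>s\<bar> \<le> sqrt (sqnorm n q)"
      proof (rule real_le_rsqrt)
        have "\<bar>s\<bar> * \<bar>s\<bar> \<le> sqrt (sqnorm n p) * \<bar>s\<bar>" by (intro mult_right_mono s1) simp
        then show "(sqrt (sqnorm n p) - \<bar>s\<bar>)\<^sup>2 \<le> sqnorm n q"
          unfolding qn power2_diff by (simp add: power2_eq_square)
      qed
      ultimately show ?thesis unfolding p_def[symmetric] ax by (intro bexI[of _ "unitvec n q"]) auto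
    qed
  qed
qed

text \<open>The separation argument needs a cone that is not a subspace; a subspace is replaced by a half of it.\<close>
lemma pointed_subcone:
  assumes K: "closed_convex_cone n K" and nt: "K \<noteq> {zvec n}"
  obtains K' k0 a where "closed_convex_cone n K'" "K' \<subseteq> K" "k0 \<in> K'" "vscale n (- 1) k0 \<notin> K'" "sqnorm n a = 1"
    "\<And>x. \<exists>v\<in>usphere n K'. sqrt (sqnorm n (proj n K x)) - 2 * \<bar>ip n a x\<bar> \<le> ip n v x"
proof -
  obtain z where "z \<in> K" "z \<noteq> zvec n" using nt cone_zvec[OF K] by auto
  then have a: "unitvec n z \<in> usphere n K" (is "?a \<in> _") by (rule cone_unitvec[OF K])
  then have aK: "?a \<in> K" "sqnorm n ?a = 1" by (auto simp: usphere_def)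
  show ?thesis
  proof (cases "\<forall>x\<in>K. vscale n (- 1) x \<in> K")
    case False
    then obtain k0 where "k0 \<in> K" "vscale n (- 1) k0 \<notin> K" by blast
    then show ?thesis using that[OF K order_refl _ _ aK(2) cone_support_lower[OF K a]] by blast
  next
    case True
    let ?K' = "{x \<in> K. 0 \<le> ip n ?a x}"
    have "closed_convex_cone n ?K'" unfolding closed_convex_cone_def
    proof (intro conjI ballI allI impI)
      show "?K' \<subseteq> rvec n" using cone_subset[OF K] by auto
      show "zvec n \<in> ?K'" using cone_zvec[OF K] by simp
      have "?K' = K \<inter> {x. 0 \<le> ip n x ?a}" by (auto simp: ip_commute)
      then show "closed ?K'"
        using cone_closed[OF K] by (auto intro!: closed_Int closed_Collect_le continuous_on_ip continuous_on_const)
      show "restrict (\<lambda>i. c * x i) {..<n} \<in> ?K'" if "x \<in> ?K'" "0 \<le> c" for c x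
        using that cone_vscale[OF K, of x c] unfolding vscale_def[symmetric] by simp
      show "restrict (\<lambda>i. u * x i + (1 - u) * y i) {..<n} \<in> ?K'" if "x \<in> ?K'" "y \<in> ?K'" "0 \<le> u \<and> u \<le> 1" for u x y
      proof -
        have "restrict (\<lambda>i. u * x i + (1 - u) * y i) {..<n} = vadd n (vscale n u x) (vscale n (1 - u) y)"
          by (rule ext) (auto simp: vadd_def vscale_def restrict_def)
        then show ?thesis using that by (auto intro!: cone_vadd[OF K] cone_vscale[OF K])
      qed
    qed
    moreover have "vscale n (- 1) ?a \<notin> ?K'" using aK(2) by (simp add: ip_self)
    moreover have "?a \<in> ?K'" using aK by (simp add: ip_self)
    ultimately show ?thesis
      using that[of ?K' ?a ?a] aK(2) subspace_halfspace_support[OF K _ a] True by blast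
  qed
qed

section \<open>Projection norms as random variables, and the statistical dimension\<close>

lemma borel_measurable_proj_norm:
  assumes K: "closed_convex_cone n K"
  shows "(\<lambda>x. sqrt (sqnorm n (proj n K x))) \<in> borel_measurable (gauss {..<n})"
proof (rule borel_measurable_support[OF compact_usphere[OF cone_closed[OF K] cone_subset[OF K]]])
  show "\<exists>v\<in>usphere n K. ip n v x = sqrt (sqnorm n (proj n K x))" if "sqrt (sqnorm n (proj n K x)) \<noteq> 0" for x
    using that by (intro proj_support_attained[OF K]) auto
qed (auto simp: usphere_def intro!: proj_support[OF K, unfolded usphere_def])

lemma borel_measurable_polar_norm:
  assumes K: "closed_convex_cone n K"
  shows "(\<lambda>x. sqrt (sqnorm n x - sqnorm n (proj n K x))) \<in> borel_measurable (gauss {..<n})"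
proof (rule borel_measurable_support[OF compact_usphere[OF closed_polar[OF K] polar_subset[OF K]]])
  show "0 \<le> sqrt (sqnorm n x - sqnorm n (proj n K x))" for x
    unfolding sqnorm_residual[OF K, symmetric] by simp
  show "\<exists>v\<in>usphere n (polar n K). ip n v x = sqrt (sqnorm n x - sqnorm n (proj n K x))"
    if "sqrt (sqnorm n x - sqnorm n (proj n K x)) \<noteq> 0" for x
    using that by (intro polar_support_attained[OF K]) auto
  show "ip n v x \<le> sqrt (sqnorm n x - sqnorm n (proj n K x))" if "v \<in> usphere n (polar n K)" for x v
    by (rule polar_support[OF K that])
qed (auto simp: usphere_def)

lemma sdim_eq: "sdim n K = (\<integral>x. (sqrt (sqnorm n (proj n K x)))\<^sup>2 \<partial>gauss {..<n})"
  by (simp add: sdim_def gauss_vec_def)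

text \<open>Pythagoras integrated over the Gaussian vector, whose squared norm has mean
  \<open>n\<close>.\<close>

lemma sdim_polar:
  assumes K: "closed_convex_cone n K"
  shows "real n - sdim n K = (\<integral>x. (sqrt (sqnorm n x - sqnorm n (proj n K x)))\<^sup>2 \<partial>gauss {..<n})"
proof -
  have sq: "integrable (gauss {..<n}) (sqnorm n)" "(\<integral>x. sqnorm n x \<partial>gauss {..<n}) = real n"
    using gauss_sum_squares[of "{..<n}"] by (simp_all add: sqnorm_def[abs_def])
  have le: "sqnorm n (proj n K x) \<le> sqnorm n x" for x
    using sqnorm_nonneg[of n "vsub n x (proj n K x)"] unfolding sqnorm_residual[OF K] by simp
  have "(\<lambda>x. (sqrt (sqnorm n (proj n K x)))\<^sup>2) \<in> borel_measurable (gauss {..<n})"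
    by (intro borel_measurable_power borel_measurable_proj_norm[OF K])
  then have "integrable (gauss {..<n}) (\<lambda>x. sqnorm n (proj n K x))"
    by (intro Bochner_Integration.integrable_bound[OF sq(1)]) (auto simp: le)
  then have "(\<integral>x. sqnorm n x - sqnorm n (proj n K x) \<partial>gauss {..<n}) = real n - sdim n K"
    using sq by (simp add: sdim_def gauss_vec_def)
  then show ?thesis using le by simp
qed

text \<open>The exponent of \<open>crossing_probability\<close> at \<open>l = sqrt t\<close>. Since
  \<open>sqrt t\<close> is at least 1, the 12 uses up 12 of the 15; the remaining 3 leave 3/2 t - 3
  t, which is at most - t.\<close>

lemma exponent_bound:
  assumes "t \<ge> 1" "d \<le> - 15 * sqrt t"
  shows "exp (3 / 2 * (sqrt t)\<^sup>2 + sqrt t * (d + 12)) \<le> exp (- t)"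
proof -
  have s: "sqrt t \<ge> 1" "sqrt t * sqrt t = t" using assms by auto
  have "sqrt t * (d + 12) \<le> sqrt t * (- 15 * sqrt t + 12 * sqrt t)"
    using assms s by (intro mult_left_mono; linarith)
  also have "\<dots> = - 3 * t" using s by (simp add: algebra_simps)
  finally show ?thesis using assms by simp
qed

section \<open>The two tail bounds\<close>

context
  fixes n m :: nat and K L :: "(nat \<Rightarrow> real) set" and t :: real
  assumes K: "closed_convex_cone n K" "K \<noteq> {zvec n}" and L: "closed_convex_cone m L" and t: "t \<ge> 1"
begin

lemma hitting_event_sets:
  "{G \<in> space (gauss_mat m n). K \<inter> preimg m n G L \<noteq> {zvec n}} \<in> sets (gauss_mat m n)"
proof -
  have "{G \<in> space (gauss_mat m n). K \<inter> preimg m n G L \<noteq> {zvec n}}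
    = {G. \<exists>x\<in>usphere n K. matvec m n G x \<in> L} \<inter> space (gauss_mat m n)"
    unfolding nontrivial_intersection_iff[OF K(1) L] by auto
  then show ?thesis
    unfolding gauss_mat_def
    using closed_Int_space_in_sets[OF closed_hitting_set[OF compact_usphere[OF cone_closed[OF K(1)] cone_subset[OF K(1)]] cone_closed[OF L]]]
    by simp
qed

lemma trivial_event_sets:
  "{G \<in> space (gauss_mat m n). K \<inter> preimg m n G L = {zvec n}} \<in> sets (gauss_mat m n)"
proof -
  have "{G \<in> space (gauss_mat m n). K \<inter> preimg m n G L = {zvec n}}
    = space (gauss_mat m n) - {G \<in> space (gauss_mat m n). K \<inter> preimg m n G L \<noteq> {zvec n}}" by auto
  then show ?thesis using hitting_event_sets by auto
qed

lemma measure_complement: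
  "measure (gauss_mat m n) {G \<in> space (gauss_mat m n). K \<inter> preimg m n G L = {zvec n}}
   = 1 - measure (gauss_mat m n) {G \<in> space (gauss_mat m n). K \<inter> preimg m n G L \<noteq> {zvec n}}"
proof -
  interpret prob_space "gauss_mat m n" unfolding gauss_mat_def by (rule gauss.P.prob_space_axioms)
  have "{G \<in> space (gauss_mat m n). K \<inter> preimg m n G L = {zvec n}}
    = space (gauss_mat m n) - {G \<in> space (gauss_mat m n). K \<inter> preimg m n G L \<noteq> {zvec n}}" by auto
  then show ?thesis using prob_compl[OF hitting_event_sets] by simp
qed

text \<open>An instance of \<open>crossing_probability\<close> with the minimum over unit vectors of
  \<open>K\<close> and the maximum over unit vectors of the polar of \<open>L\<close>: a unit vector
  mapped into \<open>L\<close> pairs nonpositively with the whole polar.\<close>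

lemma hitting_probability_small:
  assumes gap: "sqrt (sdim n K) - sqrt (real m - sdim m L) \<le> - 15 * sqrt t"
  shows "measure (gauss_mat m n) {G \<in> space (gauss_mat m n). K \<inter> preimg m n G L \<noteq> {zvec n}} \<le> exp (- t)"
proof -
  let ?E = "{G \<in> space (gauss_mat m n). K \<inter> preimg m n G L \<noteq> {zvec n}}"
  let ?T = "usphere n K" and ?U = "usphere m (polar m L)"
  obtain z where "z \<in> K" "z \<noteq> zvec n" using K(2) cone_zvec[OF K(1)] by auto
  then obtain a where a: "a \<in> ?T" using cone_unitvec[OF K(1)] by blast
  \<comment> \<open>Without unit vectors in the polar, \<open>real m - sdim m L\<close> would be 0,
    and the gap could not be negative.\<close>
  have "?U \<noteq> {}"
  proof
    assume "?U = {}"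
    then have "sqnorm m x - sqnorm m (proj m L x) = 0" for x
      using polar_support_attained[OF L, of x] by blast
    then have "sqrt (real m - sdim m L) = 0" unfolding sdim_polar[OF L] by simp
    moreover have "0 \<le> sqrt (sdim n K)" unfolding sdim_eq by (simp add: Bochner_Integration.integral_nonneg)
    moreover have "1 \<le> sqrt t" using t by simp
    ultimately show False using gap by linarith
  qed
  then obtain b where b: "b \<in> ?U" by blast
  have "measure (gauss ({..<m} \<times> {..<n})) ?E \<le> exp (3 / 2 * (sqrt t)\<^sup>2 + sqrt t *
      (sqrt (\<integral>x. (sqrt (sqnorm n (proj n K x)))\<^sup>2 \<partial>gauss {..<n})
       - sqrt (\<integral>x. (sqrt (sqnorm m x - sqnorm m (proj m L x)))\<^sup>2 \<partial>gauss {..<m}) + 12))"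
  proof (rule crossing_probability[where T="?T" and U="?U" and a=a and b=b and c="\<lambda>(x, y) b. y (fst b) * x (snd b)"])
    show "compact ?T" by (rule compact_usphere[OF cone_closed[OF K(1)] cone_subset[OF K(1)]])
    show "compact ?U" by (rule compact_usphere[OF closed_polar[OF L] polar_subset[OF L]])
    show "?E \<in> sets (gauss ({..<m} \<times> {..<n}))" using hitting_event_sets by (simp add: gauss_mat_def)
    fix G assume "G \<in> ?E"
    then obtain x where x: "x \<in> ?T" "matvec m n G x \<in> L"
      using nontrivial_intersection_iff[OF K(1) L] by auto
    have "(\<Sum>b\<in>{..<m} \<times> {..<n}. y (fst b) * x (snd b) * G b) \<le> 0" if "y \<in> ?U" for y
      using that x(2) unfolding ip_matvec[symmetric] by (auto simp: usphere_def polar_def)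
    then show "\<exists>x\<in>?T. \<forall>y\<in>?U. (\<Sum>b\<in>{..<m} \<times> {..<n}. (case (x, y) of (x, y) \<Rightarrow> \<lambda>b. y (fst b) * x (snd b)) b * G b) \<le> 0"
      using x(1) by auto
  next
    show "ip n v x \<le> sqrt (sqnorm n (proj n K x))" if "v \<in> ?T" for v x
      by (rule proj_support[OF K(1) that])
    show "\<exists>v\<in>?T. sqrt (sqnorm n (proj n K x)) - 2 * \<bar>ip n a x\<bar> \<le> ip n v x" for x
      by (rule cone_support_lower[OF K(1) a])
    show "ip m v x \<le> sqrt (sqnorm m x - sqnorm m (proj m L x))" if "v \<in> ?U" for v x
      by (rule polar_support[OF L that])
    show "\<exists>v\<in>?U. sqrt (sqnorm m x - sqnorm m (proj m L x)) - 2 * \<bar>ip m b x\<bar> \<le> ip m v x" for x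
      by (rule polar_support_lower[OF L b])
    show "(\<Sum>b\<in>{..<m} \<times> {..<n}. (case (x, y) of (x, y) \<Rightarrow> \<lambda>b. y (fst b) * x (snd b)) b
        * (case (x', y') of (x, y) \<Rightarrow> \<lambda>b. y (fst b) * x (snd b)) b) = ip n x x' * ip m y y'" for x y x' y'
      unfolding prod.case by (rule rank_one_covariance)
  qed (use a b t in \<open>auto simp: usphere_def intro!: borel_measurable_proj_norm[OF K(1)] borel_measurable_polar_norm[OF L]\<close>)
  also have "\<dots> \<le> exp (- t)"
    using gap unfolding sdim_eq[symmetric] sdim_polar[OF L, symmetric] by (intro exponent_bound t)
  finally show ?thesis by (simp add: gauss_mat_def)
qed

text \<open>The roles are exchanged and the sign of the form is reversed: the minimum runs over the
  polar of \<open>L\<close>, the maximum over unit vectors of a subcone of \<open>K\<close>. The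
  comparison function is still the projection norm onto \<open>K\<close> itself, so the statistical
  dimension of \<open>K\<close> appears and not that of the subcone.\<close>

lemma trivial_probability_small:
  assumes gap: "sqrt (sdim n K) - sqrt (real m - sdim m L) \<ge> 15 * sqrt t"
  shows "measure (gauss_mat m n) {G \<in> space (gauss_mat m n). K \<inter> preimg m n G L = {zvec n}} \<le> exp (- t)"
proof -
  let ?E = "{G \<in> space (gauss_mat m n). K \<inter> preimg m n G L = {zvec n}}"
  obtain K' k0 a where K': "closed_convex_cone n K'" "K' \<subseteq> K" and k0: "k0 \<in> K'" "vscale n (- 1) k0 \<notin> K'"
    and a: "sqnorm n a = 1" "\<And>x. \<exists>v\<in>usphere n K'. sqrt (sqnorm n (proj n K x)) - 2 * \<bar>ip n a x\<bar> \<le> ip n v x"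
    using pointed_subcone[OF K] by metis
  let ?T = "usphere m (polar m L)" and ?U = "usphere n K'"
  have sep: "\<exists>x\<in>?T. \<forall>y\<in>?U. 0 \<le> ip m x (matvec m n G y)" if "G \<in> ?E" for G
  proof -
    have "matvec m n G x \<notin> L" if "x \<in> usphere n K'" for x
      using nontrivial_intersection_iff[OF K(1) L, of G] \<open>G \<in> ?E\<close> that K'(2) by (auto simp: usphere_def)
    from trivial_intersection_separation[OF K'(1) L k0 this] show ?thesis by (auto simp: usphere_def)
  qed
  show ?thesis
  proof (cases "?E = {}")
    case False
    \<comment> \<open>A matrix in the event supplies a separating functional, hence a unit vector of
      the polar; an empty event has measure 0.\<close>
    then obtain b where b: "b \<in> ?T" using sep by blast
    have "measure (gauss ({..<m} \<times> {..<n})) ?E \<le> exp (3 / 2 * (sqrt t)\<^sup>2 + sqrt t *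
        (sqrt (\<integral>x. (sqrt (sqnorm m x - sqnorm m (proj m L x)))\<^sup>2 \<partial>gauss {..<m})
         - sqrt (\<integral>x. (sqrt (sqnorm n (proj n K x)))\<^sup>2 \<partial>gauss {..<n}) + 12))"
    proof (rule crossing_probability[where T="?T" and U="?U" and a=b and b=a and c="\<lambda>(x, y) b. - (x (fst b) * y (snd b))"])
      show "compact ?U" by (rule compact_usphere[OF cone_closed[OF K'(1)] cone_subset[OF K'(1)]])
      show "compact ?T" by (rule compact_usphere[OF closed_polar[OF L] polar_subset[OF L]])
      show "?E \<in> sets (gauss ({..<m} \<times> {..<n}))" using trivial_event_sets by (simp add: gauss_mat_def)
      fix G assume "G \<in> ?E"
      then obtain x where "x \<in> ?T" "\<And>y. y \<in> ?U \<Longrightarrow> 0 \<le> ip m x (matvec m n G y)" using sep by blast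
      then show "\<exists>x\<in>?T. \<forall>y\<in>?U. (\<Sum>b\<in>{..<m} \<times> {..<n}. (case (x, y) of (x, y) \<Rightarrow> \<lambda>b. - (x (fst b) * y (snd b))) b * G b) \<le> 0"
        unfolding ip_matvec by (auto simp: sum_negf)
    next
      show "ip n v x \<le> sqrt (sqnorm n (proj n K x))" if "v \<in> ?U" for v x
        using that K'(2) by (intro proj_support[OF K(1)]) (auto simp: usphere_def)
      show "\<exists>v\<in>?U. sqrt (sqnorm n (proj n K x)) - 2 * \<bar>ip n a x\<bar> \<le> ip n v x" for x
        by (rule a(2))
      show "ip m v x \<le> sqrt (sqnorm m x - sqnorm m (proj m L x))" if "v \<in> ?T" for v x
        by (rule polar_support[OF L that])
      show "\<exists>v\<in>?T. sqrt (sqnorm m x - sqnorm m (proj m L x)) - 2 * \<bar>ip m b x\<bar> \<le> ip m v x" for x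
        by (rule polar_support_lower[OF L b])
      fix x y x' y'
      show "(\<Sum>b\<in>{..<m} \<times> {..<n}. (case (x, y) of (x, y) \<Rightarrow> \<lambda>b. - (x (fst b) * y (snd b))) b
          * (case (x', y') of (x, y) \<Rightarrow> \<lambda>b. - (x (fst b) * y (snd b))) b) = ip m x x' * ip n y y'"
        using rank_one_covariance[where x=y and x'=y' and y=x and y'=x'] by (simp add: mult.commute)
    qed (use a(1) b t in \<open>auto simp: usphere_def intro!: borel_measurable_proj_norm[OF K(1)] borel_measurable_polar_norm[OF L]\<close>)
    also have "\<dots> \<le> exp (- t)"
      using gap unfolding sdim_eq[symmetric] sdim_polar[OF L, symmetric] by (intro exponent_bound t) linarith
    finally show ?thesis by (simp add: gauss_mat_def)
  next
    case True
    then show ?thesis by (simp only: measure_empty) simp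
  qed
qed

end

theorem theorem1p5:
  shows "\<exists>C>0. \<forall>(n::nat) (m::nat) K L (t::real).
     closed_convex_cone n K \<and> K \<noteq> {zvec n} \<and>
     closed_convex_cone m L \<and> L \<noteq> {zvec m} \<and> t \<ge> 1 \<longrightarrow>
     (sqrt (sdim n K) - sqrt (real m - sdim m L) \<le> - C * sqrt t \<longrightarrow>
        measure (gauss_mat m n) {G \<in> space (gauss_mat m n). K \<inter> preimg m n G L = {zvec n}}
          \<ge> 1 - exp (- t)) \<and>
     (sqrt (sdim n K) - sqrt (real m - sdim m L) \<ge> C * sqrt t \<longrightarrow>
        measure (gauss_mat m n) {G \<in> space (gauss_mat m n). K \<inter> preimg m n G L \<noteq> {zvec n}}
          \<ge> 1 - exp (- t))"
proof (intro exI[of _ 15] conjI allI impI; (elim conjE)?)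
  fix n m :: nat and K L :: "(nat \<Rightarrow> real) set" and t :: real
  assume *: "closed_convex_cone n K" "K \<noteq> {zvec n}" "closed_convex_cone m L" "1 \<le> t"
  show "1 - exp (- t) \<le> measure (gauss_mat m n) {G \<in> space (gauss_mat m n). K \<inter> preimg m n G L = {zvec n}}"
    if "sqrt (sdim n K) - sqrt (real m - sdim m L) \<le> - 15 * sqrt t"
    using hitting_probability_small[OF * that] measure_complement[OF *] by linarith
  show "1 - exp (- t) \<le> measure (gauss_mat m n) {G \<in> space (gauss_mat m n). K \<inter> preimg m n G L \<noteq> {zvec n}}"
    if "15 * sqrt t \<le> sqrt (sdim n K) - sqrt (real m - sdim m L)"
    using trivial_probability_small[OF * that] measure_complement[OF *] by linarith
qed simp

end
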